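(* Let $n\geq 7$ and $p\geq 2$. Among all unicyclic graphs of order $n$, $S_{n}+e$, $U_{1}$, $U_{2}$, $U_{3}$ and $U_{4}$ are, respectively, the unique unicyclic graphs with the first five maximum $p$-Sombor spectral radii; that is, for every unicyclic graph $G$ of order $n$ not isomorphic to any of these five graphs, $$\rho(\mathbf{S}_{p}(G))<\rho(\mathbf{S}_{p}(U_4))<\rho(\mathbf{S}_{p}(U_3))<\rho(\mathbf{S}_{p}(U_2))<\rho(\mathbf{S}_{p}(U_1))<\rho(\mathbf{S}_{p}(S_n+e)).$$
   Context: All graphs are simple and connected; $d_i$ is the degree of $v_i$. The $p$-Sombor matrix $\mathbf{S}_{p}(G)$ has $(i,j)$-entry $(d_i^{p}+d_j^{p})^{1/p}$ if $v_iv_j\in E(G)$ and $0$ otherwise; $\rho(\mathbf{S}_{p}(G))$ is its largest eigenvalue. A unicyclic graph is a connected graph with exactly one cycle. The graphs (all of order $n$): $S_n+e$ is the star $S_n$ with one edge added between two leaves (a triangle $xyz$ with $n-3$ pendant vertices at $x$); $U_1$ is a triangle $xyz$ with $n-4$ pendant vertices at $x$ and one pendant vertex at $y$; $U_2$ is a triangle $xyz$ where $x$ is adjacent to $n-5$ pendant vertices and to a further vertex $a$, and $a$ is adjacent to one pendant vertex; $U_3$ is a $4$-cycle with $n-4$ pendant vertices at one of its vertices; $U_4$ is a triangle $xyz$ with $n-5$ pendant vertices at $x$ and $2$ pendant vertices at $y$. *)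

theory Defs
  imports Complex_Main "Jordan_Normal_Form.Char_Poly"
begin

definition simple_graph :: "nat \<Rightarrow> nat set set \<Rightarrow> bool" where
  "simple_graph n E \<longleftrightarrow> (\<forall>e\<in>E. e \<subseteq> {0..<n} \<and> card e = 2)"

definition adj :: "nat set set \<Rightarrow> nat \<Rightarrow> nat \<Rightarrow> bool" where
  "adj E i j \<longleftrightarrow> {i, j} \<in> E"

definition deg :: "nat \<Rightarrow> nat set set \<Rightarrow> nat \<Rightarrow> nat" where
  "deg n E i = card {j \<in> {0..<n}. adj E i j}"

definition connected_graph :: "nat \<Rightarrow> nat set set \<Rightarrow> bool" where
  "connected_graph n E \<longleftrightarrow> n \<ge> 1 \<and> (\<forall>i<n. \<forall>j<n. (adj E)\<^sup>*\<^sup>* i j)"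

definition is_cycle :: "nat set set \<Rightarrow> nat set set \<Rightarrow> bool" where
  "is_cycle E C \<longleftrightarrow> (\<exists>vs. distinct vs \<and> length vs \<ge> 3 \<and>
      (\<forall>i<length vs. adj E (vs ! i) (vs ! ((i + 1) mod length vs))) \<and>
      C = {{vs ! i, vs ! ((i + 1) mod length vs)} | i. i < length vs})"

definition unicyclic :: "nat \<Rightarrow> nat set set \<Rightarrow> bool" where
  "unicyclic n E \<longleftrightarrow> simple_graph n E \<and> connected_graph n E \<and>
      card {C. is_cycle E C} = 1"

definition graph_iso :: "nat \<Rightarrow> nat set set \<Rightarrow> nat set set \<Rightarrow> bool" where
  "graph_iso n E E' \<longleftrightarrow> (\<exists>f. bij_betw f {0..<n} {0..<n} \<and>
      (\<forall>i<n. \<forall>j<n. adj E i j \<longleftrightarrow> adj E' (f i) (f j)))"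

definition sombor_matrix :: "real \<Rightarrow> nat \<Rightarrow> nat set set \<Rightarrow> real mat" where
  "sombor_matrix p n E = mat n n (\<lambda>(i, j). if adj E i j
      then (real (deg n E i) powr p + real (deg n E j) powr p) powr (1 / p) else 0)"

definition largest_eigenvalue :: "real mat \<Rightarrow> real" where
  "largest_eigenvalue A = Max {x. eigenvalue A x}"

definition sombor_rho :: "real \<Rightarrow> nat \<Rightarrow> nat set set \<Rightarrow> real" where
  "sombor_rho p n E = largest_eigenvalue (sombor_matrix p n E)"

definition Sn_e :: "nat \<Rightarrow> nat set set" where
  "Sn_e n = {{0,1},{0,2},{1,2}} \<union> {{0,k} | k. 3 \<le> k \<and> k < n}"

definition U1 :: "nat \<Rightarrow> nat set set" where
  "U1 n = {{0,1},{0,2},{1,2},{1,3}} \<union> {{0,k} | k. 4 \<le> k \<and> k < n}"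

definition U2 :: "nat \<Rightarrow> nat set set" where
  "U2 n = {{0,1},{0,2},{1,2},{0,3},{3,4}} \<union> {{0,k} | k. 5 \<le> k \<and> k < n}"

definition U3 :: "nat \<Rightarrow> nat set set" where
  "U3 n = {{0,1},{1,2},{2,3},{3,0}} \<union> {{0,k} | k. 4 \<le> k \<and> k < n}"

definition U4 :: "nat \<Rightarrow> nat set set" where
  "U4 n = {{0,1},{0,2},{1,2},{1,3},{1,4}} \<union> {{0,k} | k. 5 \<le> k \<and> k < n}"

end

theory Submission
  imports Defs "HOL-Analysis.Function_Topology" "HOL-Analysis.Harmonic_Numbers"
begin

text \<open>
The \<open>p\<close>-norm weight is convex in each degree. Hence, if the Perron vector satisfies \<open>x z \<le> x y\<close>,
moving to \<open>y\<close> all neighbours of \<open>z\<close> that are not neighbours of \<open>y\<close> (a Kelmans transformation) does not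
decrease the quadratic form, and increases it as soon as both \<open>y\<close> and \<open>z\<close> have a private neighbour.
Connectedness and the number \<open>n\<close> of edges are preserved if \<open>y\<close> and \<open>z\<close> are adjacent or have a common
neighbour. A graph of maximum degree \<open>n - 1\<close> or \<open>n - 2\<close> is \<open>S\<^sub>n + e\<close>, \<open>U\<^sub>1\<close>, \<open>U\<^sub>2\<close> or \<open>U\<^sub>3\<close>. Among
the graphs of maximum degree at most \<open>n - 3\<close>, one of largest radius admits no Kelmans transformation
inside this class; the only such graphs are the triangles with at least two pendant vertices at each
of two corners and none at the third, and a star with a triangle attached to one leaf. Moving single
pendant vertices, respectively one edge, shows that \<open>U\<^sub>4\<close> is the best of these.
\<close>

section \<open>Quadratic forms and Perron vectors\<close>

text \<open>Unicyclicity is traded for connectedness and \<open>card E = n\<close>, so that no cycle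
  has to be followed through a transformation. The degree bound is what a transformation can break:
  the recipient \<open>y\<close> ends with degree \<open>card (N y \<union> N z - {y})\<close>, so
  in a maximiser of the bounded class a pair of vertices with private neighbours is blocked only if
  this number exceeds \<open>n - 3\<close>. The classification is an edge count from there: two
  neighbourhoods that cover nearly all vertices leave room for at most two further edges. The
  comparison of \<open>U4\<close> with \<open>U3\<close> is numerical. The hub of \<open>U3\<close>
  has degree \<open>n - 2\<close>, that of \<open>U4\<close> only \<open>n - 3\<close>, and the
  radius of a star separates the two for \<open>n \<ge> 8\<close>. For \<open>n = 7\<close> that
  estimate is too weak, and explicit bounds in \<open>q = 2 / p\<close> take its place. The
  numerical estimates use \<open>p \<ge> 2\<close> through
  \<open>pnorm p a b \<le> sqrt (a^2 + b^2)\<close>.\<close>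

definition qform :: "(nat \<Rightarrow> nat \<Rightarrow> real) \<Rightarrow> nat \<Rightarrow> (nat \<Rightarrow> real) \<Rightarrow> real" where
  "qform A n x = (\<Sum>i<n. \<Sum>j<n. A i j * x i * x j)"

text \<open>Coordinates from \<open>n\<close> on are pinned to 0, so that the sphere is a closed
  subset of a product of compact sets and Tychonoff's theorem applies in the function space.\<close>

lemma compact_unit_sphere:
  "compact {x :: nat \<Rightarrow> real. (\<forall>i\<ge>n. x i = 0) \<and> (\<Sum>i<n. (x i)\<^sup>2) = 1}"
proof -
  let ?B = "PiE UNIV (\<lambda>i::nat. if i < n then {-1..1} else {0::real})"
  let ?S = "{x :: nat \<Rightarrow> real. (\<forall>i\<ge>n. x i = 0) \<and> (\<Sum>i<n. (x i)\<^sup>2) = 1}"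
  have "compactin (product_topology (\<lambda>i. euclidean) UNIV) ?B"
    unfolding compactin_PiE by auto
  then have B: "compact ?B"
    by (simp add: euclidean_product_topology)
  have "closed {x :: nat \<Rightarrow> real. (\<Sum>i<n. (x i)\<^sup>2) = 1}"
    by (intro closed_Collect_eq continuous_intros continuous_on_product_coordinates)
  moreover have "?S = ?B \<inter> {x. (\<Sum>i<n. (x i)\<^sup>2) = 1}"
  proof -
    have "x i \<in> {-1..1}" if "(\<Sum>i<n. (x i)\<^sup>2) = 1" "i < n" for x :: "nat \<Rightarrow> real" and i
    proof -
      have "(x i)\<^sup>2 \<le> (\<Sum>i<n. (x i)\<^sup>2)"
        using that(2) by (intro member_le_sum) auto
      then show ?thesis using that(1) by (simp add: abs_square_le_1 abs_le_iff)
    qed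
    then show ?thesis by (fastforce simp: PiE_iff extensional_def split: if_splits)
  qed
  ultimately show ?thesis using B by (simp add: compact_Int_closed)
qed

lemma qform_scale: "qform A n (\<lambda>i. c * x i) = c\<^sup>2 * qform A n x"
  unfolding qform_def by (simp add: sum_distrib_left power2_eq_square algebra_simps)

text \<open>The Rayleigh quotient attains its supremum by compactness, and \<open>qform\<close> is
  homogeneous of degree 2, so the bound on the sphere scales to every vector. The product form
  avoids a quotient at the zero vector.\<close>

lemma qform_maximum:
  assumes "n \<ge> 1"
  obtains x where "(\<Sum>i<n. (x i)\<^sup>2) = 1" "\<And>y. qform A n y \<le> qform A n x * (\<Sum>i<n. (y i)\<^sup>2)"
proof -
  let ?S = "{x :: nat \<Rightarrow> real. (\<forall>i\<ge>n. x i = 0) \<and> (\<Sum>i<n. (x i)\<^sup>2) = 1}"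
  have "(\<lambda>i. if i = 0 then 1 else 0) \<in> ?S"
    using assms by (auto simp: if_distrib[of "\<lambda>x. x\<^sup>2"] cong: if_cong)
  then have ne: "?S \<noteq> {}" by (metis (no_types, lifting) emptyE)
  have "continuous_on UNIV (qform A n)"
    unfolding qform_def
    by (intro continuous_on_sum continuous_on_mult continuous_on_const continuous_on_product_coordinates)
  then have "continuous_on ?S (qform A n)" by (rule continuous_on_subset) simp
  from continuous_attains_sup[OF compact_unit_sphere ne this]
  obtain x where x: "x \<in> ?S" and mx': "\<forall>y\<in>?S. qform A n y \<le> qform A n x"
    by (rule bexE)
  from mx' have mx: "qform A n y \<le> qform A n x" if "y \<in> ?S" for y using that by (rule bspec)
  show thesis
  proof
    show "(\<Sum>i<n. (x i)\<^sup>2) = 1" using x by simp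
    fix y :: "nat \<Rightarrow> real"
    define s where "s = (\<Sum>i<n. (y i)\<^sup>2)"
    show "qform A n y \<le> qform A n x * s"
    proof (cases "s = 0")
      case True
      then have "\<forall>i<n. y i = 0"
        unfolding s_def by (subst (asm) sum_nonneg_eq_0_iff) auto
      then show ?thesis using True by (simp add: qform_def)
    next
      case False
      then have s: "s > 0" unfolding s_def using sum_nonneg[of "{..<n}" "\<lambda>i. (y i)\<^sup>2"] by force
      define z where "z i = (if i < n then y i / sqrt s else 0)" for i
      have "(\<Sum>i<n. (z i)\<^sup>2) = (\<Sum>i<n. (y i)\<^sup>2 / s)"
        using s by (intro sum.cong) (auto simp: z_def power_divide)
      also have "\<dots> = 1" using s by (simp add: s_def flip: sum_divide_distrib)
      finally have "z \<in> ?S" by (simp add: z_def)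
      then have "qform A n z \<le> qform A n x" by (rule mx)
      moreover have "qform A n y = qform A n (\<lambda>i. sqrt s * z i)"
        unfolding qform_def z_def using s by (intro sum.cong) auto
      then have "qform A n y = s * qform A n z" using s by (simp add: qform_scale)
      ultimately show ?thesis using s by (simp add: mult.commute mult_left_mono)
    qed
  qed
qed

lemma qform_add:
  assumes "\<And>i j. A i j = A j i"
  shows "qform A n (\<lambda>i. x i + t * y i) =
    qform A n x + 2 * t * (\<Sum>i<n. y i * (\<Sum>j<n. A i j * x j)) + t\<^sup>2 * qform A n y"
proof -
  have "(\<Sum>i<n. \<Sum>j<n. A i j * x i * y j) = (\<Sum>i<n. \<Sum>j<n. A i j * y i * x j)"
    by (subst sum.swap) (simp add: assms mult_ac)
  moreover have "qform A n (\<lambda>i. x i + t * y i) = qform A n x + t * (\<Sum>i<n. \<Sum>j<n. A i j * x i * y j)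
    + t * (\<Sum>i<n. \<Sum>j<n. A i j * y i * x j) + t\<^sup>2 * qform A n y"
    unfolding qform_def
    by (simp add: sum_distrib_left power2_eq_square algebra_simps flip: sum.distrib)
  ultimately show ?thesis by (simp add: sum_distrib_left mult_ac)
qed

text \<open>Stationarity at a maximum: near 0 the linear term dominates the quadratic one, as
  \<open>t = b / d\<close> with a positive \<open>d > c\<close> shows.\<close>

lemma linear_bounded_by_square:
  fixes b c :: real
  assumes "\<And>t. 2 * t * b \<le> t\<^sup>2 * c"
  shows "b = 0"
proof (rule ccontr)
  assume b: "b \<noteq> 0"
  define d where "d = \<bar>c\<bar> + 1"
  have d: "d > 0" "c < d" by (auto simp: d_def)
  have "2 * (b / d) * b \<le> (b / d)\<^sup>2 * c" by (rule assms)
  also have "\<dots> \<le> (b / d)\<^sup>2 * d" using d by (intro mult_left_mono) auto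
  finally have "2 * b\<^sup>2 / d \<le> b\<^sup>2 / d" using d by (simp add: power2_eq_square)
  then show False using b d by (simp add: field_simps)
qed

text \<open>Perturbing the maximiser by \<open>t\<close> times the \<open>k\<close>-th unit vector
  gives \<open>2 * t * b \<le> t^2 * c\<close> for all \<open>t\<close>, where \<open>b\<close> is
  the defect of the \<open>k\<close>-th eigenvector equation; hence the defect is zero.\<close>

lemma maximizer_is_eigenvector:
  assumes sym: "\<And>i j. A i j = A j i"
    and mx: "\<And>y. qform A n y \<le> \<mu> * (\<Sum>i<n. (y i)\<^sup>2)"
    and x: "qform A n x = \<mu> * (\<Sum>i<n. (x i)\<^sup>2)"
    and "k < n"
  shows "(\<Sum>j<n. A k j * x j) = \<mu> * x k"
proof -
  define y where "y i = (if i = k then 1 else 0::real)" for i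
  have yk: "(\<Sum>i<n. y i * g i) = g k" for g :: "nat \<Rightarrow> real"
    using \<open>k < n\<close> by (simp add: y_def if_distrib[of "\<lambda>x. x * _"] cong: if_cong)
  define b where "b = (\<Sum>j<n. A k j * x j) - \<mu> * x k"
  have "2 * t * b \<le> t\<^sup>2 * (\<mu> - qform A n y)" for t
  proof -
    have "(\<Sum>i<n. (x i + t * y i)\<^sup>2) = (\<Sum>i<n. (x i)\<^sup>2 + 2 * t * (y i * x i) + t\<^sup>2 * (y i * y i))"
      by (intro sum.cong) (auto simp: power2_eq_square algebra_simps)
    also have "\<dots> = (\<Sum>i<n. (x i)\<^sup>2) + 2 * t * x k + t\<^sup>2 * y k"
      using yk[of x] yk[of y] by (simp add: sum.distrib flip: sum_distrib_left)
    also have "y k = 1" by (simp add: y_def)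
    finally have "(\<Sum>i<n. (x i + t * y i)\<^sup>2) = (\<Sum>i<n. (x i)\<^sup>2) + 2 * t * x k + t\<^sup>2" by simp
    with mx[of "\<lambda>i. x i + t * y i"] show ?thesis
      unfolding qform_add[OF sym] yk x b_def by (simp add: algebra_simps)
  qed
  then have "b = 0" by (rule linear_bounded_by_square)
  then show ?thesis by (simp add: b_def)
qed

lemma qform_of_eigenvector:
  assumes "\<And>i. i < n \<Longrightarrow> (\<Sum>j<n. A i j * x j) = \<mu> * x i"
  shows "qform A n x = \<mu> * (\<Sum>i<n. (x i)\<^sup>2)"
proof -
  have "qform A n x = (\<Sum>i<n. x i * (\<Sum>j<n. A i j * x j))"
    unfolding qform_def by (simp add: sum_distrib_left mult_ac)
  also have "\<dots> = (\<Sum>i<n. \<mu> * (x i)\<^sup>2)"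
    by (intro sum.cong) (auto simp: assms power2_eq_square)
  finally show ?thesis by (simp add: sum_distrib_left)
qed

text \<open>Trades matrices and vectors for functions on indices, in which all later estimates are
  phrased.\<close>

lemma eigenvalue_mat_iff:
  "eigenvalue (Matrix.mat n n (\<lambda>(i, j). A i j)) (\<mu>::real) \<longleftrightarrow>
    (\<exists>x. (\<exists>i<n. x i \<noteq> 0) \<and> (\<forall>i<n. (\<Sum>j<n. A i j * x j) = \<mu> * x i))"
proof -
  let ?M = "Matrix.mat n n (\<lambda>(i, j). A i j)"
  have mv: "(?M *\<^sub>v v) $ i = (\<Sum>j<n. A i j * v $ j)" if "i < n" "v \<in> carrier_vec n" for v i
    using that by (simp add: scalar_prod_def atLeast0LessThan)
  show ?thesis
  proof
    assume "eigenvalue ?M \<mu>"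
    then obtain v where v: "v \<in> carrier_vec n" "v \<noteq> 0\<^sub>v n" "?M *\<^sub>v v = \<mu> \<cdot>\<^sub>v v"
      unfolding eigenvalue_def eigenvector_def by auto
    have "\<exists>i<n. v $ i \<noteq> 0" using v(1,2) by (metis eq_vecI carrier_vecD index_zero_vec)
    moreover have "\<forall>i<n. (\<Sum>j<n. A i j * v $ j) = \<mu> * v $ i"
      using mv[OF _ v(1)] v(1,3) by auto
    ultimately show "\<exists>x. (\<exists>i<n. x i \<noteq> 0) \<and> (\<forall>i<n. (\<Sum>j<n. A i j * x j) = \<mu> * x i)" by blast
  next
    assume "\<exists>x. (\<exists>i<n. x i \<noteq> 0) \<and> (\<forall>i<n. (\<Sum>j<n. A i j * x j) = \<mu> * x i)"
    then obtain x where x: "\<exists>i<n. x i \<noteq> 0" "\<forall>i<n. (\<Sum>j<n. A i j * x j) = \<mu> * x i" by blast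
    let ?v = "Matrix.vec n x"
    have "?v \<noteq> 0\<^sub>v n" using x(1) by (metis index_vec index_zero_vec(1))
    moreover have "?M *\<^sub>v ?v = \<mu> \<cdot>\<^sub>v ?v"
    proof (rule eq_vecI)
      fix i assume "i < dim_vec (\<mu> \<cdot>\<^sub>v ?v)"
      then have i: "i < n" by simp
      have "(?M *\<^sub>v ?v) $ i = (\<Sum>j<n. A i j * ?v $ j)" by (rule mv[OF i]) simp
      also have "\<dots> = (\<Sum>j<n. A i j * x j)" by (intro sum.cong) auto
      finally show "(?M *\<^sub>v ?v) $ i = (\<mu> \<cdot>\<^sub>v ?v) $ i" using x(2) i by simp
    qed simp
    ultimately show "eigenvalue ?M \<mu>"
      unfolding eigenvalue_def eigenvector_def by (intro exI[of _ ?v]) auto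
  qed
qed

lemma largest_eigenvalue_mat:
  assumes "n \<ge> 1" and sym: "\<And>i j. A i j = A j i"
    and mx: "\<And>y. qform A n y \<le> \<mu> * (\<Sum>i<n. (y i)\<^sup>2)"
    and x: "qform A n x = \<mu> * (\<Sum>i<n. (x i)\<^sup>2)" "(\<Sum>i<n. (x i)\<^sup>2) > 0"
  shows "largest_eigenvalue (Matrix.mat n n (\<lambda>(i, j). A i j)) = \<mu>"
proof -
  let ?M = "Matrix.mat n n (\<lambda>(i, j). A i j)"
  have pos: "(\<Sum>i<n. (y i)\<^sup>2) > 0" if "\<exists>i<n. y i \<noteq> 0" for y :: "nat \<Rightarrow> real"
  proof -
    have "(\<Sum>i<n. (y i)\<^sup>2) \<noteq> 0" using that by (subst sum_nonneg_eq_0_iff) auto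
    then show ?thesis using sum_nonneg[of "{..<n}" "\<lambda>i. (y i)\<^sup>2"] by force
  qed
  have "\<exists>i<n. x i \<noteq> 0"
  proof (rule ccontr)
    assume "\<not> (\<exists>i<n. x i \<noteq> 0)"
    then have "(\<Sum>i<n. (x i)\<^sup>2) = 0" by simp
    then show False using x(2) by simp
  qed
  then have ev: "eigenvalue ?M \<mu>"
    unfolding eigenvalue_mat_iff using maximizer_is_eigenvector[OF sym mx x(1)] by blast
  have le: "\<kappa> \<le> \<mu>" if "eigenvalue ?M \<kappa>" for \<kappa>
  proof -
    from that obtain y where y: "\<exists>i<n. y i \<noteq> 0" "\<forall>i<n. (\<Sum>j<n. A i j * y j) = \<kappa> * y i"
      unfolding eigenvalue_mat_iff by blast
    have "\<kappa> * (\<Sum>i<n. (y i)\<^sup>2) \<le> \<mu> * (\<Sum>i<n. (y i)\<^sup>2)"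
      using mx[of y] qform_of_eigenvector[of n A y \<kappa>] y(2) by simp
    then show ?thesis using pos[OF y(1)] by simp
  qed
  have M: "?M \<in> carrier_mat n n" by simp
  \<comment> \<open>\<open>Max\<close> is meaningful only on a finite set; the eigenvalues are roots
    of the characteristic polynomial, which is monic and so nonzero.\<close>
  have "finite {x. eigenvalue ?M x}"
  proof -
    have "char_poly ?M \<noteq> 0" using degree_monic_char_poly[OF M] by auto
    then show ?thesis using poly_roots_finite unfolding eigenvalue_root_char_poly[OF M] by blast
  qed
  then show ?thesis unfolding largest_eigenvalue_def using ev le by (intro Max_eqI) auto
qed

section \<open>The Sombor matrix, its radius and its Perron vector\<close>

definition pnorm :: "real \<Rightarrow> real \<Rightarrow> real \<Rightarrow> real" where
  "pnorm p a b = (a powr p + b powr p) powr (1 / p)"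

definition entry :: "real \<Rightarrow> nat \<Rightarrow> nat set set \<Rightarrow> nat \<Rightarrow> nat \<Rightarrow> real" where
  "entry p n E i j = (if adj E i j then pnorm p (deg n E i) (deg n E j) else 0)"

definition nbrs :: "nat \<Rightarrow> nat set set \<Rightarrow> nat \<Rightarrow> nat set" where
  "nbrs n E i = {j \<in> {0..<n}. adj E i j}"

lemma pnorm_commute: "pnorm p a b = pnorm p b a"
  by (simp add: pnorm_def add.commute)

lemma adj_commute: "adj E i j = adj E j i"
  by (simp add: adj_def insert_commute)

lemma entry_commute: "entry p n E i j = entry p n E j i"
  by (simp add: entry_def adj_commute pnorm_commute)

lemma pnorm_nonneg: "pnorm p a b \<ge> 0"
  by (simp add: pnorm_def)

lemma entry_nonneg: "entry p n E i j \<ge> 0"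
  by (simp add: entry_def pnorm_nonneg)

lemma deg_eq_card_nbrs: "deg n E i = card (nbrs n E i)"
  by (simp add: deg_def nbrs_def)

lemma finite_nbrs [simp]: "finite (nbrs n E i)"
  by (simp add: nbrs_def)

lemma simple_graphD:
  assumes "simple_graph n E" "adj E i j"
  shows "i < n" "j < n" "i \<noteq> j"
proof -
  have "{i, j} \<subseteq> {0..<n}" "card {i, j} = 2"
    using assms by (auto simp: simple_graph_def adj_def)
  then show "i < n" "j < n" "i \<noteq> j" by auto
qed

lemma adj_irrefl: "simple_graph n E \<Longrightarrow> \<not> adj E i i"
  using simple_graphD(3) by blast

lemma mem_nbrs: "simple_graph n E \<Longrightarrow> j \<in> nbrs n E i \<longleftrightarrow> adj E i j"
  unfolding nbrs_def using simple_graphD by auto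

lemma deg_pos: "simple_graph n E \<Longrightarrow> adj E i j \<Longrightarrow> deg n E i > 0"
  by (metis card_gt_0_iff deg_eq_card_nbrs empty_iff finite_nbrs mem_nbrs)

lemma pnorm_pos: "a > 0 \<Longrightarrow> pnorm p a b > 0"
  unfolding pnorm_def by (smt (verit, best) powr_ge_zero powr_gt_zero)

lemma entry_pos: "simple_graph n E \<Longrightarrow> adj E i j \<Longrightarrow> entry p n E i j > 0"
  using deg_pos by (auto simp: entry_def intro!: pnorm_pos)

lemma sum_entry:
  "(\<Sum>j<n. entry p n E i j * x j) = (\<Sum>j\<in>nbrs n E i. pnorm p (deg n E i) (deg n E j) * x j)"
proof -
  have "(\<Sum>j<n. entry p n E i j * x j) = (\<Sum>j\<in>{0..<n}. if adj E i j then pnorm p (deg n E i) (deg n E j) * x j else 0)"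
    by (intro sum.cong) (auto simp: entry_def)
  also have "\<dots> = (\<Sum>j\<in>nbrs n E i. pnorm p (deg n E i) (deg n E j) * x j)"
    unfolding nbrs_def by (subst sum.inter_filter [symmetric]) auto
  finally show ?thesis .
qed

lemma sombor_matrix_entry: "sombor_matrix p n E = Matrix.mat n n (\<lambda>(i, j). entry p n E i j)"
  unfolding sombor_matrix_def by (rule cong_mat) (auto simp: entry_def pnorm_def)

text \<open>A property that passes along edges spreads over the whole graph. Used for zero
  coordinates of a vector, and with equality to one vertex to rule out isolated vertices.\<close>

lemma connected_zero_set:
  assumes "connected_graph n E" "i < n" "j < n" "P i" "\<And>i j. adj E i j \<Longrightarrow> P i \<Longrightarrow> P j"
  shows "P j"
proof -
  have "(adj E)\<^sup>*\<^sup>* i j" using assms by (auto simp: connected_graph_def)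
  then show ?thesis by (induction) (use assms in auto)
qed

lemma qform_abs_ge: "qform (entry p n E) n x \<le> qform (entry p n E) n (\<lambda>i. \<bar>x i\<bar>)"
  unfolding qform_def
proof (intro sum_mono)
  fix i j
  have "entry p n E i j * (x i * x j) \<le> entry p n E i j * (\<bar>x i\<bar> * \<bar>x j\<bar>)"
    by (intro mult_left_mono entry_nonneg) (metis abs_ge_self abs_mult)
  then show "entry p n E i j * x i * x j \<le> entry p n E i j * \<bar>x i\<bar> * \<bar>x j\<bar>" by (simp add: mult.assoc)
qed

text \<open>The variational description of the radius. Entries are nonnegative, so the absolute
  value of a maximiser is again a maximiser, and every maximiser is an eigenvector.\<close>

lemma sombor_rho_qform:
  assumes "n \<ge> 1"
  shows "qform (entry p n E) n y \<le> sombor_rho p n E * (\<Sum>i<n. (y i)\<^sup>2)"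
    and "\<exists>x. (\<forall>i. 0 \<le> x i) \<and> (\<Sum>i<n. (x i)\<^sup>2) = 1 \<and>
      (\<forall>i<n. (\<Sum>j<n. entry p n E i j * x j) = sombor_rho p n E * x i)"
proof -
  let ?A = "entry p n E"
  obtain x where x: "(\<Sum>i<n. (x i)\<^sup>2) = 1"
    and mx: "\<And>y. qform ?A n y \<le> qform ?A n x * (\<Sum>i<n. (y i)\<^sup>2)"
    by (rule qform_maximum[OF assms]) blast
  have rho: "sombor_rho p n E = qform ?A n x"
    unfolding sombor_rho_def sombor_matrix_entry
    by (rule largest_eigenvalue_mat[where x = x]) (use assms mx x entry_commute in auto)
  then show "qform ?A n y \<le> sombor_rho p n E * (\<Sum>i<n. (y i)\<^sup>2)" using mx by simp
  let ?x = "\<lambda>i. \<bar>x i\<bar>"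
  have "qform ?A n ?x \<le> qform ?A n x * (\<Sum>i<n. (?x i)\<^sup>2)" by (rule mx)
  with qform_abs_ge[of p n E x] x
  have "qform ?A n ?x = qform ?A n x * (\<Sum>i<n. (?x i)\<^sup>2)" by simp
  then have "(\<Sum>j<n. ?A k j * ?x j) = qform ?A n x * ?x k" if "k < n" for k
    using maximizer_is_eigenvector[of ?A n "qform ?A n x" ?x k, OF entry_commute mx _ that] by simp
  then show "\<exists>x. (\<forall>i. 0 \<le> x i) \<and> (\<Sum>i<n. (x i)\<^sup>2) = 1 \<and>
      (\<forall>i<n. (\<Sum>j<n. ?A i j * x j) = sombor_rho p n E * x i)"
    unfolding rho using x by (intro exI[of _ ?x]) auto
qed

definition perron :: "real \<Rightarrow> nat \<Rightarrow> nat set set \<Rightarrow> (nat \<Rightarrow> real) \<Rightarrow> bool" where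
  "perron p n E x \<longleftrightarrow> (\<forall>i<n. x i > 0) \<and>
    (\<forall>i<n. (\<Sum>j\<in>nbrs n E i. pnorm p (deg n E i) (deg n E j) * x j) = sombor_rho p n E * x i)"

text \<open>A zero coordinate makes a sum of nonnegative terms vanish in its row, so all neighbours
  are zero too; by connectedness the whole vector would be zero.\<close>

lemma perron_exists:
  assumes "simple_graph n E" "connected_graph n E"
  shows "\<exists>x. perron p n E x"
proof -
  have n: "n \<ge> 1" using assms(2) by (simp add: connected_graph_def)
  obtain x where x0: "\<And>i. 0 \<le> x i" and x1: "(\<Sum>i<n. (x i)\<^sup>2) = 1"
    and ev: "\<And>i. i < n \<Longrightarrow> (\<Sum>j<n. entry p n E i j * x j) = sombor_rho p n E * x i"
    using sombor_rho_qform(2)[OF n] by metis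
  have "x i > 0" if "i < n" for i
  proof (rule ccontr)
    assume "\<not> 0 < x i"
    then have xi: "x i = 0" using x0[of i] by simp
    have step: "l < n \<and> x l = 0" if "adj E k l" "k < n \<and> x k = 0" for k l
    proof -
      have "(\<Sum>j<n. entry p n E k j * x j) = 0" using ev[of k] that(2) by simp
      then have "\<forall>j<n. entry p n E k j * x j = 0"
        by (subst (asm) sum_nonneg_eq_0_iff) (auto simp: x0 entry_nonneg)
      moreover have "entry p n E k l > 0" using that(1) assms(1) by (rule entry_pos[rotated])
      ultimately show ?thesis using simple_graphD[OF assms(1) that(1)] by auto
    qed
    have "j < n \<and> x j = 0" if "j < n" for j
      by (rule connected_zero_set[OF assms(2) \<open>i < n\<close> that]) (use xi \<open>i < n\<close> step in auto)
    then have "(\<Sum>i<n. (x i)\<^sup>2) = 0" by simp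
    then show False using x1 by simp
  qed
  then show ?thesis unfolding perron_def using ev sum_entry by auto
qed

lemma perron_pos: "perron p n E x \<Longrightarrow> i < n \<Longrightarrow> x i > 0"
  by (simp add: perron_def)

lemma perron_eq:
  "perron p n E x \<Longrightarrow> i < n \<Longrightarrow>
    (\<Sum>j\<in>nbrs n E i. pnorm p (deg n E i) (deg n E j) * x j) = sombor_rho p n E * x i"
  by (simp add: perron_def)

lemma perron_qform: "perron p n E x \<Longrightarrow> qform (entry p n E) n x = sombor_rho p n E * (\<Sum>i<n. (x i)\<^sup>2)"
  by (rule qform_of_eigenvector) (simp add: sum_entry perron_eq)

text \<open>Rayleigh comparison. With a rearrangement of the Perron vector of \<open>E\<close> as
  \<open>y\<close>, a larger quadratic form on \<open>E'\<close> suffices; this is how edge moves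
  are judged.\<close>

lemma sombor_rho_less:
  assumes "n \<ge> 1" "perron p n E x" "(\<Sum>i<n. (y i)\<^sup>2) = (\<Sum>i<n. (x i)\<^sup>2)"
    and "qform (entry p n E) n x < qform (entry p n E') n y"
  shows "sombor_rho p n E < sombor_rho p n E'"
proof -
  have "sombor_rho p n E * (\<Sum>i<n. (x i)\<^sup>2) < sombor_rho p n E' * (\<Sum>i<n. (x i)\<^sup>2)"
    using sombor_rho_qform(1)[OF assms(1), of p E' y] assms(3,4) perron_qform[OF assms(2)] by simp
  then show ?thesis by (simp add: mult_less_cancel_right) (meson not_less sum_nonneg zero_le_power2)
qed

text \<open>A Collatz-Wielandt bound: the row inequalities, multiplied by \<open>x i\<close> and
  added, compare the Rayleigh quotient with \<open>\<mu>\<close>, and one strict row with positive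
  entry makes the comparison strict.\<close>

lemma sombor_rho_greater:
  assumes "n \<ge> 1" and pos: "\<And>i. i < n \<Longrightarrow> x i \<ge> 0"
    and ge: "\<And>i. i < n \<Longrightarrow> \<mu> * x i \<le> (\<Sum>j\<in>nbrs n E i. pnorm p (deg n E i) (deg n E j) * x j)"
    and k: "k < n" "x k > 0" "\<mu> * x k < (\<Sum>j\<in>nbrs n E k. pnorm p (deg n E k) (deg n E j) * x j)"
  shows "\<mu> < sombor_rho p n E"
proof -
  have q: "qform (entry p n E) n x = (\<Sum>i<n. x i * (\<Sum>j\<in>nbrs n E i. pnorm p (deg n E i) (deg n E j) * x j))"
    unfolding qform_def sum_entry[symmetric] by (simp add: sum_distrib_left mult_ac)
  have "\<mu> * (\<Sum>i<n. (x i)\<^sup>2) = (\<Sum>i<n. x i * (\<mu> * x i))"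
    by (simp add: sum_distrib_left power2_eq_square mult_ac)
  also have "\<dots> < qform (entry p n E) n x"
    unfolding q
  proof (rule sum_strict_mono_ex1)
    show "\<forall>i\<in>{..<n}. x i * (\<mu> * x i) \<le> x i * (\<Sum>j\<in>nbrs n E i. pnorm p (deg n E i) (deg n E j) * x j)"
      using ge pos by (auto intro!: mult_left_mono)
    show "\<exists>i\<in>{..<n}. x i * (\<mu> * x i) < x i * (\<Sum>j\<in>nbrs n E i. pnorm p (deg n E i) (deg n E j) * x j)"
      using k by (intro bexI[of _ k] mult_strict_left_mono) auto
  qed simp
  also have "\<dots> \<le> sombor_rho p n E * (\<Sum>i<n. (x i)\<^sup>2)" by (rule sombor_rho_qform(1)[OF assms(1)])
  finally show ?thesis by (simp add: mult_less_cancel_right) (meson not_less sum_nonneg zero_le_power2)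
qed

section \<open>The Kelmans transformation\<close>

text \<open>The pair \<open>(a + k, b - k)\<close> majorizes \<open>(a, b)\<close>: same sum, wider
  spread. Both old points are convex combinations of the new ones with the weights exchanged, so
  adding the two chord bounds gives the claim.\<close>

lemma convex_on_majorization:
  fixes g :: "real \<Rightarrow> real"
  assumes "convex_on {0<..} g" "0 \<le> k" "0 < b - k" "b \<le> a + k"
  shows "g a + g b \<le> g (a + k) + g (b - k)"
proof (cases "a + k = b - k")
  case True
  then have "a = b - k" "k = 0" using assms by auto
  then show ?thesis by simp
next
  case False
  define l where "l = a + k - (b - k)"
  have l: "l > 0" using False assms by (simp add: l_def)
  define t where "t = k / l"
  have t: "0 \<le> t" "t \<le> 1" using assms l by (auto simp: t_def l_def field_simps)
  have tl: "t * l = k" using l by (simp add: t_def)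
  have conv: "g ((1 - s) * (b - k) + s * (a + k)) \<le> (1 - s) * g (b - k) + s * g (a + k)"
    if "0 \<le> s" "s \<le> 1" for s
    using convex_onD[OF assms(1), of s "b - k" "a + k"] that assms by simp
  have "(1 - t) * (b - k) + t * (a + k) = (b - k) + t * l" by (simp add: l_def algebra_simps)
  then have "g b \<le> (1 - t) * g (b - k) + t * g (a + k)" using conv[of t] t tl by simp
  moreover have "(1 - (1 - t)) * (b - k) + (1 - t) * (a + k) = (a + k) - t * l"
    by (simp add: l_def algebra_simps)
  then have "g a \<le> t * g (b - k) + (1 - t) * g (a + k)" using conv[of "1 - t"] t tl by simp
  ultimately show ?thesis by (simp add: algebra_simps)
qed

lemma convex_pnorm:
  assumes "p \<ge> 1" "c > 0"
  shows "convex_on {0<..} (pnorm p c)"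
proof -
  \<comment> \<open>The derivative, arranged as a power of a ratio \<open>u / (C + u)\<close> with
    \<open>u = t powr p\<close>, so that its monotonicity is visible.\<close>
  define h where "h t = (t powr p / (c powr p + t powr p)) powr ((p - 1) / p)" for t
  have pos: "c powr p + t powr p > 0" for t using assms by (simp add: add_pos_nonneg)
  have D: "(pnorm p c has_real_derivative h t) (at t)" if "t > 0" for t
  proof -
    let ?s = "c powr p + t powr p"
    have "(pnorm p c has_real_derivative ((1 / p) * ?s powr (1 / p - 1) * (p * t powr (p - 1)))) (at t)"
      unfolding pnorm_def using that pos[of t] assms
      by (auto intro!: derivative_eq_intros simp: field_simps powr_diff)
    moreover have "(1 / p) * ?s powr (1 / p - 1) * (p * t powr (p - 1)) = h t"
    proof -
      have e: "1 / p - 1 = - ((p - 1) / p)" using assms by (simp add: field_simps)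
      have "t powr (p - 1) = (t powr p) powr ((p - 1) / p)" using assms by (simp add: powr_powr)
      then show ?thesis unfolding h_def e using assms pos[of t] that
        by (simp add: powr_divide powr_minus_divide)
    qed
    ultimately show ?thesis by simp
  qed
  have mono: "h s \<le> h t" if "0 < s" "s \<le> t" for s t
  proof -
    have "s powr p \<le> t powr p" using that assms by (intro powr_mono2) auto
    then have "s powr p * c powr p \<le> t powr p * c powr p" by (rule mult_right_mono) simp
    then have "s powr p / (c powr p + s powr p) \<le> t powr p / (c powr p + t powr p)"
      using pos[of s] pos[of t] by (simp add: field_simps)
    then show ?thesis unfolding h_def
      using assms pos[of s] by (intro powr_mono2) auto
  qed
  show ?thesis
    by (rule convex_on_realI[where f' = h]) (use D mono in auto)
qed

lemma pnorm_strict_mono: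
  assumes "p > 0" "0 \<le> a" "a < a'"
  shows "pnorm p a b < pnorm p a' b"
proof -
  have "a powr p + b powr p < a' powr p + b powr p" using assms by (simp add: powr_less_mono2)
  then show ?thesis unfolding pnorm_def using assms
    by (intro powr_less_mono2) (auto intro!: add_nonneg_nonneg)
qed

lemma pnorm_mono:
  assumes "p > 0" "0 \<le> a" "a \<le> a'" "0 \<le> b" "b \<le> b'"
  shows "pnorm p a b \<le> pnorm p a' b'"
proof -
  have "a powr p + b powr p \<le> a' powr p + b' powr p"
    using assms by (intro add_mono powr_mono2) auto
  then show ?thesis unfolding pnorm_def using assms
    by (intro powr_mono2) (auto intro!: add_nonneg_nonneg)
qed

text \<open>Stated with differences: the gain at the growing end covers the loss at the shrinking
  one, and the two sides can then be multiplied by different vector entries.\<close>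

lemma pnorm_transfer_fixed:
  assumes "p \<ge> 1" "c > 0" "0 \<le> k" "0 < b - k" "b \<le> a + k"
  shows "pnorm p c b - pnorm p c (b - k) \<le> pnorm p c (a + k) - pnorm p c a"
  using convex_on_majorization[OF convex_pnorm[OF assms(1,2)] assms(3-5)] by simp

text \<open>For the edge between the two vertices whose degrees change, both arguments move at once;
  convexity of \<open>t powr p\<close> handles this.\<close>

lemma pnorm_transfer:
  assumes "p \<ge> 1" "0 \<le> k" "0 < b - k" "b \<le> a + k"
  shows "pnorm p a b \<le> pnorm p (a + k) (b - k)"
proof -
  have "a powr p + b powr p \<le> (a + k) powr p + (b - k) powr p"
    using convex_on_majorization[OF powr_convex[OF assms(1)] assms(2-4)] .
  then show ?thesis unfolding pnorm_def using assms
    by (intro powr_mono2) (auto intro!: add_nonneg_nonneg)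
qed

lemma qform_split_two:
  assumes sym: "\<And>i j. A i j = A j i" and diag: "\<And>i. A i i = 0"
    and "y < n" "z < n" "y \<noteq> z"
  shows "qform A n x = (\<Sum>i\<in>{..<n} - {y, z}. \<Sum>j\<in>{..<n} - {y, z}. A i j * x i * x j)
    + 2 * (\<Sum>i\<in>{..<n} - {y, z}. A i y * x i * x y + A i z * x i * x z) + 2 * (A y z * x y * x z)"
proof -
  let ?R = "{..<n} - {y, z}"
  have split: "(\<Sum>i<n. g i) = g y + g z + (\<Sum>i\<in>?R. g i)" for g :: "nat \<Rightarrow> real"
  proof -
    have "{..<n} = insert y (insert z ?R)" using assms by auto
    then have "(\<Sum>i<n. g i) = (\<Sum>i\<in>insert y (insert z ?R). g i)" by simp
    then show ?thesis using \<open>y \<noteq> z\<close> by simp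
  qed
  have c: "(\<Sum>j\<in>?R. A k j * x k * x j) = (\<Sum>j\<in>?R. A j k * x j * x k)" for k
    by (intro sum.cong) (auto simp: sym[of k] mult_ac)
  show ?thesis
    unfolding qform_def split c
    using diag sym[of y z] by (simp add: sum.distrib algebra_simps)
qed

section \<open>The transformation: edges, degrees, connectedness, quadratic form\<close>

lemma entry_diag: "simple_graph n E \<Longrightarrow> entry p n E i i = 0"
  using simple_graphD(3) by (auto simp: entry_def)

text \<open>\<open>y\<close> is left out of the moved set, so that an edge between \<open>y\<close>
  and \<open>z\<close> stays in place; common neighbours stay as well.\<close>

definition kelmans :: "nat \<Rightarrow> nat \<Rightarrow> nat \<Rightarrow> nat set set \<Rightarrow> nat set set" where
  "kelmans n y z E = (E - (\<lambda>w. {z, w}) ` (nbrs n E z - nbrs n E y - {y}))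
    \<union> (\<lambda>w. {y, w}) ` (nbrs n E z - nbrs n E y - {y})"

lemma adj_kelmans:
  "adj (kelmans n y z E) i j \<longleftrightarrow>
    (adj E i j \<and> \<not> (i = z \<and> j \<in> nbrs n E z - nbrs n E y - {y}) \<and> \<not> (j = z \<and> i \<in> nbrs n E z - nbrs n E y - {y})) \<or>
    (i = y \<and> j \<in> nbrs n E z - nbrs n E y - {y}) \<or> (j = y \<and> i \<in> nbrs n E z - nbrs n E y - {y})"
  unfolding adj_def kelmans_def by (auto simp: doubleton_eq_iff image_iff)

context
  fixes n :: nat and E :: "nat set set" and y z :: nat and P
  assumes G: "simple_graph n E" and yz: "y < n" "z < n" "y \<noteq> z"
    and P: "P = nbrs n E z - nbrs n E y - {y}"
begin

lemma mem_P: "w \<in> P \<longleftrightarrow> adj E z w \<and> \<not> adj E y w \<and> w \<noteq> y"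
  by (auto simp: P mem_nbrs[OF G])

lemma P_sub: "w \<in> P \<Longrightarrow> w < n \<and> w \<noteq> y \<and> w \<noteq> z \<and> adj E z w \<and> \<not> adj E y w"
  using simple_graphD[OF G, of z w] by (auto simp: mem_P)

lemma simple_kelmans: "simple_graph n (kelmans n y z E)"
  unfolding simple_graph_def kelmans_def P[symmetric]
proof
  fix e assume "e \<in> E - (\<lambda>w. {z, w}) ` P \<union> (\<lambda>w. {y, w}) ` P"
  then show "e \<subseteq> {0..<n} \<and> card e = 2"
    using G P_sub yz by (force simp: simple_graph_def)
qed

lemma card_kelmans: "card (kelmans n y z E) = card E"
proof -
  have fE: "finite E"
    using G by (intro finite_subset[of E "Pow {0..<n}"]) (auto simp: simple_graph_def)
  have fP: "finite P" by (simp add: P)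
  have iz: "inj_on (\<lambda>w. {z, w}) P" and iy: "inj_on (\<lambda>w. {y, w}) P"
    by (auto simp: inj_on_def doubleton_eq_iff)
  have sub: "(\<lambda>w. {z, w}) ` P \<subseteq> E" using P_sub by (auto simp: adj_def)
  have dis: "(\<lambda>w. {y, w}) ` P \<inter> (E - (\<lambda>w. {z, w}) ` P) = {}" using P_sub by (auto simp: adj_def)
  have "card (kelmans n y z E) = card (E - (\<lambda>w. {z, w}) ` P) + card ((\<lambda>w. {y, w}) ` P)"
    unfolding kelmans_def P[symmetric] using dis fE fP by (subst card_Un_disjoint) auto
  also have "\<dots> = card E - card P + card P"
    using sub fP by (simp add: card_Diff_subset card_image iz iy)
  also have "card P \<le> card E" using card_mono[OF fE sub] by (simp add: card_image iz)
  then have "card E - card P + card P = card E" by simp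
  finally show ?thesis .
qed

lemma nbrs_kelmans:
  "nbrs n (kelmans n y z E) y = nbrs n E y \<union> P"
  "nbrs n (kelmans n y z E) z = nbrs n E z - P"
  "w \<in> P \<Longrightarrow> nbrs n (kelmans n y z E) w = insert y (nbrs n E w - {z})"
  "w \<notin> P \<Longrightarrow> w \<noteq> y \<Longrightarrow> w \<noteq> z \<Longrightarrow> nbrs n (kelmans n y z E) w = nbrs n E w"
  using simple_graphD[OF G] yz adj_commute[of E]
  by (auto simp: nbrs_def adj_kelmans P[symmetric] mem_P)

lemma deg_kelmans:
  "deg n (kelmans n y z E) y = deg n E y + card P"
  "card P \<le> deg n E z"
  "deg n (kelmans n y z E) z = deg n E z - card P"
  "w \<noteq> y \<Longrightarrow> w \<noteq> z \<Longrightarrow> deg n (kelmans n y z E) w = deg n E w"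
proof -
  have fP: "finite P" by (simp add: P)
  show "deg n (kelmans n y z E) y = deg n E y + card P"
    unfolding deg_eq_card_nbrs nbrs_kelmans using fP by (subst card_Un_disjoint) (auto simp: P)
  show "card P \<le> deg n E z"
    unfolding deg_eq_card_nbrs by (rule card_mono) (auto simp: P)
  show "deg n (kelmans n y z E) z = deg n E z - card P"
    unfolding deg_eq_card_nbrs nbrs_kelmans by (rule card_Diff_subset) (auto simp: P)
  assume w: "w \<noteq> y" "w \<noteq> z"
  show "deg n (kelmans n y z E) w = deg n E w"
  proof (cases "w \<in> P")
    case True
    then have "z \<in> nbrs n E w" "y \<notin> nbrs n E w"
      using P_sub[OF True] by (auto simp: mem_nbrs[OF G] adj_commute)
    then show ?thesis unfolding deg_eq_card_nbrs nbrs_kelmans(3)[OF True]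
      using card_Suc_Diff1[of "nbrs n E w" z] by simp
  next
    case False
    then show ?thesis unfolding deg_eq_card_nbrs using nbrs_kelmans(4) w by simp
  qed
qed

text \<open>\<open>y\<close> and \<open>z\<close> stay connected by their edge or by a common
  neighbour, neither of which is moved; a moved edge from \<open>z\<close> to \<open>w\<close> is
  then replaced by a walk from \<open>z\<close> to \<open>y\<close> and on to
  \<open>w\<close>.\<close>

lemma connected_kelmans:
  assumes "connected_graph n E" and yzc: "adj E y z \<or> (\<exists>c. adj E y c \<and> adj E z c)"
  shows "connected_graph n (kelmans n y z E)"
proof -
  let ?K = "kelmans n y z E"
  have "(adj ?K)\<^sup>*\<^sup>* y z \<and> (adj ?K)\<^sup>*\<^sup>* z y"
  proof (cases "adj E y z")
    case True
    then have "adj ?K y z" using P_sub yz by (auto simp: adj_kelmans P[symmetric])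
    then show ?thesis by (auto simp: adj_commute[of _ z])
  next
    case False
    then obtain c where c: "adj E y c" "adj E z c" using yzc by blast
    then have "adj ?K y c" "adj ?K z c"
      using P_sub yz simple_graphD[OF G] by (auto simp: adj_kelmans P[symmetric])
    moreover from this have "adj ?K c y" "adj ?K c z" by (simp_all add: adj_commute[of _ c])
    ultimately show ?thesis
      by (blast intro: rtranclp_trans r_into_rtranclp)
  qed
  then have yz': "(adj ?K)\<^sup>*\<^sup>* y z" "(adj ?K)\<^sup>*\<^sup>* z y" by auto
  have step: "(adj ?K)\<^sup>*\<^sup>* i j" if "adj E i j" for i j
  proof -
    from that consider "adj ?K i j" | "i = z" "j \<in> P" | "j = z" "i \<in> P"
      by (auto simp: adj_kelmans P[symmetric])
    then show ?thesis
    proof cases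
      case 2
      then have "adj ?K y j" by (simp add: adj_kelmans P[symmetric])
      then show ?thesis using yz' 2 by (meson rtranclp.rtrancl_into_rtrancl)
    next
      case 3
      then have "adj ?K i y" by (simp add: adj_kelmans P[symmetric])
      then show ?thesis using yz' 3 by (meson converse_rtranclp_into_rtranclp)
    qed auto
  qed
  have "(adj E)\<^sup>*\<^sup>* i j \<Longrightarrow> (adj ?K)\<^sup>*\<^sup>* i j" for i j
    by (induction rule: rtranclp_induct) (use step in \<open>auto intro: rtranclp_trans\<close>)
  then show ?thesis using assms(1) by (auto simp: connected_graph_def)
qed

text \<open>The old Perron vector is tested on the new graph, vertex by vertex. A moved neighbour
  sees an entry at least as large and a larger degree, a private neighbour of \<open>y\<close> sees
  a larger degree, and at a common neighbour convexity lets the gain at \<open>y\<close> pay for the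
  loss at \<open>z\<close>. The moved neighbours give strictness.\<close>

lemma sombor_rho_kelmans:
  assumes p: "p \<ge> 1" and x: "perron p n E x" "x z \<le> x y"
    and yzc: "adj E y z \<or> (\<exists>c. adj E y c \<and> adj E z c)"
    and Pne: "P \<noteq> {}" and Qne: "nbrs n E y - nbrs n E z - {z} \<noteq> {}"
  shows "sombor_rho p n E < sombor_rho p n (kelmans n y z E)"
proof (rule sombor_rho_less[OF _ x(1) refl])
  show "n \<ge> 1" using yz by simp
  let ?K = "kelmans n y z E" and ?R = "{..<n} - {y, z}"
  let ?d = "\<lambda>i. real (deg n E i)" and ?k = "real (card P)"
  have xp: "x i > 0" if "i < n" for i using perron_pos[OF x(1) that] .
  have fP: "finite P" by (simp add: P)
  have k1: "card P > 0" using Pne fP by (simp add: card_gt_0_iff)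
  let ?C = "nbrs n E y \<inter> nbrs n E z"
  have zC: "nbrs n E z - P = ?C \<union> (nbrs n E z \<inter> {y})" by (auto simp: P)
  have cz: "deg n E z - card P = card (nbrs n E z - P)"
    unfolding deg_eq_card_nbrs by (rule card_Diff_subset[symmetric]) (auto simp: P)
  \<comment> \<open>\<open>z\<close> keeps \<open>y\<close> or a common neighbour. Its remaining
    degree must be positive because convexity is available on the open half-line only.\<close>
  have cz1: "deg n E z - card P > 0"
    unfolding cz zC card_gt_0_iff using yzc by (auto simp: mem_nbrs[OF G] adj_commute[of E z y])
  \<comment> \<open>The neighbours that \<open>z\<close> keeps are matched by neighbours of
    \<open>y\<close>, which has a private one besides. This yields
    \<open>deg z < deg y + card P\<close>, the condition for majorization and for
    strictness.\<close>
  have lt: "deg n E z - card P < deg n E y"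
  proof -
    have "card (nbrs n E z - P) = card ?C + card (nbrs n E z \<inter> {y})"
      unfolding zC by (rule card_Un_disjoint) (auto simp: nbrs_def dest: simple_graphD[OF G])
    also have "card (nbrs n E z \<inter> {y}) = card (nbrs n E y \<inter> {z})"
      by (auto simp: mem_nbrs[OF G] adj_commute Int_insert_right)
    also have "card ?C + card (nbrs n E y \<inter> {z}) = card (?C \<union> (nbrs n E y \<inter> {z}))"
      by (rule card_Un_disjoint[symmetric]) (auto simp: nbrs_def dest: simple_graphD[OF G])
    also have "\<dots> < card (nbrs n E y)"
      using Qne by (intro psubset_card_mono) auto
    finally show ?thesis using cz by (simp add: deg_eq_card_nbrs)
  qed
  have rk: "?k > 0" "0 < ?d z - ?k" "?d z < ?d y + ?k" using k1 cz1 lt deg_kelmans(2) by linarith+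
  have dK: "real (deg n ?K y) = ?d y + ?k" "real (deg n ?K z) = ?d z - ?k"
    using deg_kelmans by (simp_all add: of_nat_diff)
  have dK': "real (deg n ?K w) = ?d w" if "w \<noteq> y" "w \<noteq> z" for w using deg_kelmans(4)[OF that] by simp
  have R: "entry p n ?K i j = entry p n E i j" if "i \<in> ?R" "j \<in> ?R" for i j
    using that dK' by (auto simp: entry_def adj_kelmans P[symmetric])
  have yzle: "entry p n E y z * x y * x z \<le> entry p n ?K y z * x y * x z"
  proof -
    have "entry p n E y z \<le> entry p n ?K y z"
      unfolding entry_def dK using pnorm_transfer[of p ?k "?d z" "?d y"] p rk P_sub yz
      by (auto simp: adj_kelmans P[symmetric] pnorm_nonneg)
    then show ?thesis using xp yz by (intro mult_right_mono) (auto simp: less_imp_le)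
  qed
  have wle: "entry p n E w y * x w * x y + entry p n E w z * x w * x z
      \<le> entry p n ?K w y * x w * x y + entry p n ?K w z * x w * x z \<and>
      (w \<in> P \<longrightarrow> entry p n E w y * x w * x y + entry p n E w z * x w * x z
      < entry p n ?K w y * x w * x y + entry p n ?K w z * x w * x z)" if w: "w \<in> ?R" for w
  proof -
    have w': "w < n" "w \<noteq> y" "w \<noteq> z" using w by auto
    have xw: "x w > 0" "x y > 0" "x z > 0" using xp yz w' by auto
    have d0: "?d w > 0" if "adj E w v" for v using deg_pos[OF G that] by simp
    have "entry p n E w y * x y + entry p n E w z * x z \<le> entry p n ?K w y * x y + entry p n ?K w z * x z \<and>
      (w \<in> P \<longrightarrow> entry p n E w y * x y + entry p n E w z * x z < entry p n ?K w y * x y + entry p n ?K w z * x z)"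
    proof (cases "w \<in> P")
      case True
      then have a: "adj E w z" "\<not> adj E w y" "adj ?K w y" "\<not> adj ?K w z"
        using P_sub[OF True] yz by (auto simp: adj_kelmans P[symmetric] adj_commute)
      have "pnorm p (?d w) (?d z) * x z \<le> pnorm p (?d w) (?d z) * x y"
        using x(2) by (intro mult_left_mono pnorm_nonneg)
      also have "\<dots> < pnorm p (?d w) (?d y + ?k) * x y"
        using pnorm_strict_mono[of p "?d z" "?d y + ?k" "?d w"] rk p xw
        by (simp add: pnorm_commute[of p "?d w"])
      finally show ?thesis using a True by (simp add: entry_def dK dK'[OF w'(2,3)])
    next
      case False
      have aK: "adj ?K w y = adj E w y" "adj ?K w z = adj E w z"
        using False w' yz by (auto simp: adj_kelmans P[symmetric])
      show ?thesis
      proof (cases "adj E w y")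
        case True
        have up: "pnorm p (?d w) (?d y) \<le> pnorm p (?d w) (?d y + ?k)"
          using p rk by (intro pnorm_mono) auto
        show ?thesis
        proof (cases "adj E w z")
          case wz: True
          have "pnorm p (?d w) (?d z) - pnorm p (?d w) (?d z - ?k) \<le> pnorm p (?d w) (?d y + ?k) - pnorm p (?d w) (?d y)"
            using pnorm_transfer_fixed[of p "?d w" ?k "?d z" "?d y"] p rk d0[OF True] by simp
          then have "(pnorm p (?d w) (?d z) - pnorm p (?d w) (?d z - ?k)) * x z
              \<le> (pnorm p (?d w) (?d y + ?k) - pnorm p (?d w) (?d y)) * x z"
            using xw by (intro mult_right_mono) auto
          also have "\<dots> \<le> (pnorm p (?d w) (?d y + ?k) - pnorm p (?d w) (?d y)) * x y"
            using up x(2) by (intro mult_left_mono) auto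
          finally show ?thesis using True wz False aK by (simp add: entry_def dK dK'[OF w'(2,3)] algebra_simps)
        next
          case wz: False
          show ?thesis using True wz False aK up xw
            by (simp add: entry_def dK dK'[OF w'(2,3)])
        qed
      next
        case wy: False
        have "\<not> adj E w z" using False wy w' by (auto simp: P nbrs_def adj_commute)
        then show ?thesis using wy False aK by (simp add: entry_def)
      qed
    qed
    then have "x w * (entry p n E w y * x y + entry p n E w z * x z) \<le> x w * (entry p n ?K w y * x y + entry p n ?K w z * x z)"
      "w \<in> P \<longrightarrow> x w * (entry p n E w y * x y + entry p n E w z * x z) < x w * (entry p n ?K w y * x y + entry p n ?K w z * x z)"
      using xw(1) by (auto intro!: mult_left_mono)
    then show ?thesis by (simp add: algebra_simps)
  qed
  obtain w where w: "w \<in> P" using Pne by blast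
  have "w \<in> ?R" using P_sub[OF w] by auto
  have "(\<Sum>w\<in>?R. entry p n E w y * x w * x y + entry p n E w z * x w * x z)
      < (\<Sum>w\<in>?R. entry p n ?K w y * x w * x y + entry p n ?K w z * x w * x z)"
  proof (rule sum_strict_mono_ex1)
    show "\<exists>a\<in>?R. entry p n E a y * x a * x y + entry p n E a z * x a * x z
      < entry p n ?K a y * x a * x y + entry p n ?K a z * x a * x z"
      using wle[OF \<open>w \<in> ?R\<close>] w \<open>w \<in> ?R\<close> by blast
  qed (use wle in auto)
  moreover have "(\<Sum>i\<in>?R. \<Sum>j\<in>?R. entry p n ?K i j * x i * x j) = (\<Sum>i\<in>?R. \<Sum>j\<in>?R. entry p n E i j * x i * x j)"
    using R by (intro sum.cong refl) auto
  ultimately show "qform (entry p n E) n x < qform (entry p n ?K) n x"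
    using yzle
    unfolding qform_split_two[OF entry_commute entry_diag[OF G] yz] qform_split_two[OF entry_commute entry_diag[OF simple_kelmans] yz]
    by linarith
qed

end

section \<open>Triangles with pendant vertices at two corners\<close>

lemma pnorm_gt:
  assumes "p > 0" "a > 0" "b > 0"
  shows "a < pnorm p a b"
proof -
  have "pnorm p a 0 < pnorm p a b" using pnorm_strict_mono[of p 0 b a] assms by (simp add: pnorm_commute)
  moreover have "pnorm p a 0 = a" using assms by (simp add: pnorm_def powr_powr)
  ultimately show ?thesis by simp
qed

text \<open>The test vector is the Perron vector of an unweighted star, \<open>sqrt d\<close> at the
  centre and 1 at the leaves. Each edge at \<open>k\<close> weighs more than \<open>d\<close>, and
  all other edges only add to the rows.\<close>

lemma sombor_rho_star:
  assumes G: "simple_graph n E" and p: "p > 0" and d: "k < n" "deg n E k = d" "d > 0"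
  shows "real d * sqrt d < sombor_rho p n E"
proof (rule sombor_rho_greater[where k = k and x = "\<lambda>i. if i = k then sqrt d else if adj E k i then 1 else 0"])
  let ?x = "\<lambda>i. if i = k then sqrt d else if adj E k i then 1 else 0"
  let ?f = "\<lambda>i j. pnorm p (deg n E i) (deg n E j)"
  have nk: "\<not> adj E k k" using simple_graphD(3)[OF G] by blast
  have kx: "?x j = 1" if "j \<in> nbrs n E k" for j using that nk by (auto simp: mem_nbrs[OF G])
  have gt: "real d < ?f k j" if "j \<in> nbrs n E k" for j
    using pnorm_gt[OF p, of d "deg n E j"] d deg_pos[OF G, of j k] that
    by (simp add: mem_nbrs[OF G] adj_commute[of E j])
  have "real d * real d = (\<Sum>j\<in>nbrs n E k. real d)" using d by (simp add: deg_eq_card_nbrs)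
  also have "\<dots> < (\<Sum>j\<in>nbrs n E k. ?f k j * ?x j)"
  proof (rule sum_strict_mono)
    show "nbrs n E k \<noteq> {}" using d by (auto simp: deg_eq_card_nbrs)
  qed (use gt kx in auto)
  finally show *: "real d * sqrt d * ?x k < (\<Sum>j\<in>nbrs n E k. ?f k j * ?x j)" by (simp add: mult.assoc)
  show "?x k > 0" using d by simp
  show "real d * sqrt d * ?x i \<le> (\<Sum>j\<in>nbrs n E i. ?f i j * ?x j)" if "i < n" for i
  proof (cases "i = k")
    case True
    then show ?thesis using * by simp
  next
    case ik: False
    show ?thesis
    proof (cases "adj E k i")
      case True
      then have ki: "k \<in> nbrs n E i" by (simp add: mem_nbrs[OF G] adj_commute)
      have "real d \<le> ?f i k" using gt[of i] True by (simp add: mem_nbrs[OF G] pnorm_commute less_imp_le)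
      then have "real d * sqrt d * ?x i \<le> ?f i k * ?x k" using True ik by (simp add: mult_right_mono)
      also have "\<dots> \<le> (\<Sum>j\<in>nbrs n E i. ?f i j * ?x j)"
        using ki by (intro member_le_sum) (auto simp: pnorm_nonneg)
      finally show ?thesis .
    next
      case False
      then show ?thesis using ik by (auto intro!: sum_nonneg simp: pnorm_nonneg)
    qed
  qed
qed (use d in auto)

text \<open>\<open>D\<close> lists each edge once, smaller end first; the factor 2 accounts for the
  reversed pairs.\<close>

lemma qform_pairs:
  assumes D: "\<And>i j. (i, j) \<in> D \<Longrightarrow> i < j \<and> j < n" and E: "E = (\<lambda>(i, j). {i, j}) ` D"
  shows "qform (entry p n E) n x =
    2 * (\<Sum>(i, j)\<in>D. pnorm p (deg n E i) (deg n E j) * x i * x j)"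
proof -
  let ?g = "\<lambda>(i, j). pnorm p (deg n E i) (deg n E j) * x i * x j"
  have sw: "(i, j) \<in> prod.swap ` D \<longleftrightarrow> (j, i) \<in> D" for i j by force
  have adj: "adj E i j \<longleftrightarrow> (i, j) \<in> D \<union> prod.swap ` D" for i j
    unfolding adj_def E Un_iff sw by (auto simp: doubleton_eq_iff image_iff split: prod.splits)
  have wt0: "entry p n E i j = 0" if "(i, j) \<notin> D \<union> prod.swap ` D" for i j
    using that unfolding entry_def adj by (rule if_not_P)
  have wt1: "entry p n E i j = pnorm p (deg n E i) (deg n E j)" if "(i, j) \<in> D \<union> prod.swap ` D" for i j
    using that unfolding entry_def adj by (rule if_P)
  have sub: "D \<union> prod.swap ` D \<subseteq> {..<n} \<times> {..<n}" using D by fastforce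
  then have fin: "finite D" by (meson finite_Un finite_SigmaI finite_lessThan finite_subset)
  have "z \<notin> prod.swap ` D" if "z \<in> D" for z
  proof (cases z)
    case (Pair i j)
    then show ?thesis using that D[of i j] D[of j i] sw[of i j] by auto
  qed
  then have dis: "D \<inter> prod.swap ` D = {}" by blast
  have "qform (entry p n E) n x = (\<Sum>(i, j)\<in>{..<n} \<times> {..<n}. entry p n E i j * x i * x j)"
    unfolding qform_def by (simp add: sum.cartesian_product)
  also have "\<dots> = (\<Sum>(i, j)\<in>D \<union> prod.swap ` D. entry p n E i j * x i * x j)"
  proof (rule sum.mono_neutral_right[OF _ sub], simp, rule ballI)
    fix z assume "z \<in> {..<n} \<times> {..<n} - (D \<union> prod.swap ` D)"
    then show "(case z of (i, j) \<Rightarrow> entry p n E i j * x i * x j) = 0"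
      using wt0[of "fst z" "snd z"] by (cases z) simp
  qed
  also have "\<dots> = (\<Sum>z\<in>D \<union> prod.swap ` D. ?g z)"
  proof (rule sum.cong[OF refl])
    fix z assume "z \<in> D \<union> prod.swap ` D"
    then show "(case z of (i, j) \<Rightarrow> entry p n E i j * x i * x j) = ?g z"
      using wt1[of "fst z" "snd z"] by (cases z) simp
  qed
  also have "\<dots> = (\<Sum>z\<in>D. ?g z) + (\<Sum>z\<in>prod.swap ` D. ?g z)"
    using fin dis by (intro sum.union_disjoint) auto
  also have "(\<Sum>z\<in>prod.swap ` D. ?g z) = (\<Sum>z\<in>D. ?g z)"
    by (subst sum.reindex) (auto simp: pnorm_commute mult_ac intro!: sum.cong)
  finally show ?thesis by simp
qed

lemma pendant_edges: "{{c, k} | k. l \<le> k \<and> k < m} = (\<lambda>(i, j). {i, j}) ` Pair c ` {l..<m}" for c :: nat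
  unfolding image_image by auto

text \<open>One family for three of the five graphs: \<open>b\<close> pendant vertices hang at
  corner 1 and the remaining \<open>n - 3 - b\<close> at corner 0; \<open>b = 0, 1, 2\<close> give
  \<open>Sn_e\<close>, \<open>U1\<close> and \<open>U4\<close>.\<close>

definition tri :: "nat \<Rightarrow> nat \<Rightarrow> nat set set" where
  "tri n b = {{0,1},{0,2},{1,2}} \<union> {{1,k} | k. 3 \<le> k \<and> k < 3 + b} \<union> {{0,k} | k. 3 + b \<le> k \<and> k < n}"

lemma adj_tri:
  "adj (tri n b) i j \<longleftrightarrow> (i = 0 \<and> j = 1) \<or> (i = 1 \<and> j = 0) \<or> (i = 0 \<and> j = 2) \<or> (i = 2 \<and> j = 0)
    \<or> (i = 1 \<and> j = 2) \<or> (i = 2 \<and> j = 1) \<or> (i = 1 \<and> 3 \<le> j \<and> j < 3 + b) \<or> (j = 1 \<and> 3 \<le> i \<and> i < 3 + b)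
    \<or> (i = 0 \<and> 3 + b \<le> j \<and> j < n) \<or> (j = 0 \<and> 3 + b \<le> i \<and> i < n)"
  unfolding adj_def tri_def by (auto simp: doubleton_eq_iff)

context
  fixes n b :: nat
  assumes nb: "3 + b \<le> n"
begin

lemma nbrs_tri:
  "nbrs n (tri n b) 0 = {1, 2} \<union> {3 + b..<n}"
  "nbrs n (tri n b) 1 = {0, 2} \<union> {3..<3 + b}"
  "nbrs n (tri n b) 2 = {0, 1}"
  "k \<in> {3..<3 + b} \<Longrightarrow> nbrs n (tri n b) k = {1}"
  "k \<in> {3 + b..<n} \<Longrightarrow> nbrs n (tri n b) k = {0}"
  using nb by (auto simp: nbrs_def adj_tri)

lemma deg_tri:
  "deg n (tri n b) 0 = n - b - 1"
  "deg n (tri n b) (Suc 0) = b + 2"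
  "deg n (tri n b) 2 = 2"
  "k \<in> {3..<3 + b} \<Longrightarrow> deg n (tri n b) k = 1"
  "k \<in> {3 + b..<n} \<Longrightarrow> deg n (tri n b) k = 1"
proof -
  have "card ({1, 2} \<union> {3 + b..<n}) = 2 + (n - (3 + b))"
    by (subst card_Un_disjoint) auto
  then show "deg n (tri n b) 0 = n - b - 1" using nb by (simp add: deg_eq_card_nbrs nbrs_tri)
  have "card ({0, 2} \<union> {3..<3 + b}) = 2 + b"
    by (subst card_Un_disjoint) auto
  then show "deg n (tri n b) (Suc 0) = b + 2" using nbrs_tri(2) by (simp add: deg_eq_card_nbrs)
qed (simp_all add: deg_eq_card_nbrs nbrs_tri)

lemma simple_tri: "simple_graph n (tri n b)"
  using nb by (auto simp: simple_graph_def tri_def)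

lemma qform_tri:
  "qform (entry p n (tri n b)) n x = 2 *
    (pnorm p (n - b - 1) (b + 2) * x 0 * x 1 + pnorm p (n - b - 1) 2 * x 0 * x 2 + pnorm p (b + 2) 2 * x 1 * x 2
    + (\<Sum>k\<in>{3..<3 + b}. pnorm p (b + 2) 1 * x 1 * x k) + (\<Sum>k\<in>{3 + b..<n}. pnorm p (n - b - 1) 1 * x 0 * x k))"
proof -
  let ?D = "{(0,1),(0,2),(1,2)} \<union> (Pair 1 ` {3..<3 + b} \<union> Pair 0 ` {3 + b..<n})"
  let ?g = "\<lambda>(i, j). pnorm p (deg n (tri n b) i) (deg n (tri n b) j) * x i * x j"
  have E: "tri n b = (\<lambda>(i, j). {i, j}) ` ?D" unfolding tri_def pendant_edges by (simp add: image_Un Un_assoc)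
  have "qform (entry p n (tri n b)) n x = 2 * (\<Sum>z\<in>?D. ?g z)"
    by (rule qform_pairs[OF _ E]) (use nb in auto)
  also have "(\<Sum>z\<in>?D. ?g z) = (\<Sum>z\<in>{(0,1),(0,2),(1,2)}. ?g z) + ((\<Sum>z\<in>Pair 1 ` {3..<3 + b}. ?g z)
      + (\<Sum>z\<in>Pair 0 ` {3 + b..<n}. ?g z))"
    by (subst sum.union_disjoint; (subst sum.union_disjoint)?) auto
  also have "(\<Sum>z\<in>Pair 1 ` {3..<3 + b}. ?g z) = (\<Sum>k\<in>{3..<3 + b}. pnorm p (b + 2) 1 * x 1 * x k)"
    by (subst sum.reindex) (auto simp: inj_on_def deg_tri intro!: sum.cong)
  also have "(\<Sum>z\<in>Pair 0 ` {3 + b..<n}. ?g z) = (\<Sum>k\<in>{3 + b..<n}. pnorm p (n - b - 1) 1 * x 0 * x k)"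
    by (subst sum.reindex) (auto simp: inj_on_def deg_tri intro!: sum.cong)
  finally show ?thesis by (simp add: deg_tri)
qed

lemma connected_tri: "connected_graph n (tri n b)"
proof -
  have "(adj (tri n b))\<^sup>*\<^sup>* 0 i \<and> (adj (tri n b))\<^sup>*\<^sup>* i 0" if "i < n" for i
  proof -
    have 1: "(adj (tri n b))\<^sup>*\<^sup>* 0 1" "(adj (tri n b))\<^sup>*\<^sup>* 1 0" by (auto simp: adj_tri)
    consider "i = 0" | "i = 1" | "i = 2" | "i \<in> {3..<3 + b}" | "i \<in> {3 + b..<n}" using \<open>i < n\<close> by force
    then show ?thesis
    proof cases
      case 4
      then have "adj (tri n b) 1 i" "adj (tri n b) i 1" by (auto simp: adj_tri)
      then show ?thesis using 1 by (meson rtranclp.rtrancl_into_rtrancl converse_rtranclp_into_rtranclp)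
    qed (use 1 in \<open>auto simp: adj_tri\<close>)
  qed
  then show ?thesis using nb unfolding connected_graph_def by (meson rtranclp_trans le_trans one_le_numeral trans_le_add1)
qed

end

lemma perron_rho_pos:
  assumes G: "simple_graph n E" and x: "perron p n E x" and "i < n" "adj E i j"
  shows "sombor_rho p n E > 0"
proof -
  have j: "j < n" "j \<in> nbrs n E i" using simple_graphD[OF G assms(4)] assms(4) by (auto simp: mem_nbrs[OF G])
  have "0 < pnorm p (deg n E i) (deg n E j) * x j"
    using perron_pos[OF x j(1)] deg_pos[OF G assms(4)] by (intro mult_pos_pos pnorm_pos) auto
  also have "\<dots> \<le> (\<Sum>j\<in>nbrs n E i. pnorm p (deg n E i) (deg n E j) * x j)"
    using j perron_pos[OF x] by (intro member_le_sum) (auto simp: pnorm_nonneg nbrs_def less_imp_le)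
  also have "\<dots> = sombor_rho p n E * x i" by (rule perron_eq[OF x assms(3)])
  finally show ?thesis using perron_pos[OF x assms(3)] by (simp add: zero_less_mult_iff)
qed

text \<open>The eigenvector equations with the pendant entries eliminated: each pendant vertex feeds
  the squared weight of its edge, divided by \<open>l\<close>, back into the row of its
  corner.\<close>

lemma tri_rows:
  assumes nb: "3 + b \<le> n" and x: "perron p n (tri n b) x"
  defines "l \<equiv> sombor_rho p n (tri n b)" and "d0 \<equiv> real (n - b - 1)" and "d1 \<equiv> real (b + 2)"
  shows "l > 0"
    and "k \<in> {3..<3 + b} \<Longrightarrow> x k = pnorm p d1 1 * x 1 / l"
    and "k \<in> {3 + b..<n} \<Longrightarrow> x k = pnorm p d0 1 * x 0 / l"
    and "l * x 0 = pnorm p d0 d1 * x 1 + pnorm p d0 2 * x 2 + real (n - (3 + b)) * (pnorm p d0 1)\<^sup>2 * x 0 / l"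
    and "l * x 1 = pnorm p d0 d1 * x 0 + pnorm p d1 2 * x 2 + real b * (pnorm p d1 1)\<^sup>2 * x 1 / l"
    and "l * x 2 = pnorm p d0 2 * x 0 + pnorm p d1 2 * x 1"
proof -
  note dT = deg_tri[OF nb] and nT = nbrs_tri[OF nb]
  have dg: "real (deg n (tri n b) 0) = d0" "real (deg n (tri n b) (Suc 0)) = d1" "real (deg n (tri n b) 2) = 2"
    using dT by (simp_all add: d0_def d1_def)
  show l: "l > 0" unfolding l_def
    by (rule perron_rho_pos[OF simple_tri[OF nb] x, of 0 1]) (use nb in \<open>auto simp: adj_tri\<close>)
  show leaf1: "x k = pnorm p d1 1 * x 1 / l" if k: "k \<in> {3..<3 + b}" for k
  proof -
    have "l * x k = pnorm p 1 d1 * x 1"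
      using perron_eq[OF x, of k] k nb unfolding nT(4)[OF k] by (simp add: dg dT(4,5) l_def)
    then show ?thesis using l by (simp add: field_simps pnorm_commute)
  qed
  show leaf0: "x k = pnorm p d0 1 * x 0 / l" if k: "k \<in> {3 + b..<n}" for k
  proof -
    have "l * x k = pnorm p 1 d0 * x 0"
      using perron_eq[OF x, of k] k nb unfolding nT(5)[OF k] by (simp add: dg dT(4,5) l_def)
    then show ?thesis using l by (simp add: field_simps pnorm_commute)
  qed
  have "l * x 0 = (\<Sum>j\<in>{1, 2} \<union> {3 + b..<n}. pnorm p d0 (deg n (tri n b) j) * x j)"
    using perron_eq[OF x, of 0] nb unfolding nT by (simp add: dg l_def)
  also have "\<dots> = (\<Sum>j\<in>{1, 2}. pnorm p d0 (deg n (tri n b) j) * x j)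
      + (\<Sum>j\<in>{3 + b..<n}. pnorm p d0 (deg n (tri n b) j) * x j)"
    by (rule sum.union_disjoint) auto
  also have "(\<Sum>j\<in>{3 + b..<n}. pnorm p d0 (deg n (tri n b) j) * x j)
      = (\<Sum>j\<in>{3 + b..<n}. pnorm p d0 1 * (pnorm p d0 1 * x 0 / l))"
    by (intro sum.cong refl) (simp add: dT(4,5) leaf0)
  finally show "l * x 0 = pnorm p d0 d1 * x 1 + pnorm p d0 2 * x 2 + real (n - (3 + b)) * (pnorm p d0 1)\<^sup>2 * x 0 / l"
    by (simp add: dg power2_eq_square)
  have "l * x 1 = (\<Sum>j\<in>{0, 2} \<union> {3..<3 + b}. pnorm p d1 (deg n (tri n b) j) * x j)"
    using perron_eq[OF x, of 1] nb unfolding nT by (simp add: dg l_def)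
  also have "\<dots> = (\<Sum>j\<in>{0, 2}. pnorm p d1 (deg n (tri n b) j) * x j)
      + (\<Sum>j\<in>{3..<3 + b}. pnorm p d1 (deg n (tri n b) j) * x j)"
    by (rule sum.union_disjoint) auto
  also have "(\<Sum>j\<in>{3..<3 + b}. pnorm p d1 (deg n (tri n b) j) * x j)
      = (\<Sum>j\<in>{3..<3 + b}. pnorm p d1 1 * (pnorm p d1 1 * x 1 / l))"
    by (intro sum.cong refl) (simp add: dT(4,5) leaf1)
  finally show "l * x 1 = pnorm p d0 d1 * x 0 + pnorm p d1 2 * x 2 + real b * (pnorm p d1 1)\<^sup>2 * x 1 / l"
    by (simp add: dg pnorm_commute[of p d1 d0] power2_eq_square)
  show "l * x 2 = pnorm p d0 2 * x 0 + pnorm p d1 2 * x 1"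
    using perron_eq[OF x, of 2] nb unfolding nT by (simp add: dg l_def pnorm_commute)
qed

text \<open>A single pendant vertex moves from corner 1 to corner 0, whereas a Kelmans
  transformation would move all \<open>b\<close> of them and produce \<open>Sn_e\<close>. Corner 0
  carries at least as many pendant vertices and has the larger Perron entry, so convexity works in
  its favour.\<close>

lemma sombor_rho_tri_less:
  assumes p: "p \<ge> 1" and B: "1 \<le> b" "3 + 2 * b \<le> n"
  shows "sombor_rho p n (tri n b) < sombor_rho p n (tri n (b - 1))"
proof -
  have nb: "3 + b \<le> n" "3 + (b - 1) \<le> n" using B by auto
  define A where "A = n - 3 - b"
  have n: "n = 3 + b + A" and AB: "b \<le> A" and nA: "n - (3 + b) = A"
    using B by (auto simp: A_def)
  obtain x where x: "perron p n (tri n b) x"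
    using perron_exists[OF simple_tri connected_tri] nb by blast
  define l where "l = sombor_rho p n (tri n b)"
  define d0 d1 where "d0 = real A + 2" and "d1 = real b + 2"
  have d: "d1 \<le> d0" "d1 \<ge> 3" using AB B by (auto simp: d0_def d1_def)
  have D0: "real (n - b - 1) = d0" "real (n - (b - 1) - 1) = d0 + 1" "real (b - 1 + 2) = d1 - 1" "real (b + 2) = d1"
    using n B by (auto simp: d0_def d1_def)
  have xp: "x i > 0" if "i < n" for i using perron_pos[OF x that] .
  have x012: "x 0 > 0" "x 1 > 0" "x 2 > 0" using xp nb by auto
  note rows = tri_rows[OF nb(1) x, folded l_def, unfolded D0 nA]
  note l = rows(1)
  define p0 p1 where "p0 = pnorm p d0 1 * x 0 / l" and "p1 = pnorm p d1 1 * x 1 / l"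
  have leaf1: "x k = p1" if "k \<in> {3..<3 + b}" for k using rows(2)[OF that] by (simp add: p1_def)
  have leaf0: "x k = p0" if "k \<in> {3 + b..<n}" for k using rows(3)[OF that] by (simp add: p0_def)
  have f01: "pnorm p d1 1 \<le> pnorm p d0 1" and f02: "pnorm p d1 2 \<le> pnorm p d0 2"
    using d p by (auto intro!: pnorm_mono)
  have x10: "x 1 \<le> x 0"
  proof (rule ccontr)
    assume "\<not> x 1 \<le> x 0"
    then have lt: "x 0 < x 1" by simp
    \<comment> \<open>What remains of \<open>l\<close> after the pendant vertices are eliminated.
      Corner 0 has at least as many pendant edges, each at least as heavy, so
      \<open>c0 \<le> c1\<close>; with the smaller entry at corner 0 the two reduced rows would
      contradict each other.\<close>
    define c0 c1 where "c0 = l - real A * (pnorm p d0 1)\<^sup>2 / l" and "c1 = l - real b * (pnorm p d1 1)\<^sup>2 / l"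
    have e0: "c0 * x 0 = pnorm p d0 d1 * x 1 + pnorm p d0 2 * x 2"
      using rows(4) by (simp add: c0_def algebra_simps)
    have e1: "c1 * x 1 = pnorm p d0 d1 * x 0 + pnorm p d1 2 * x 2"
      using rows(5) by (simp add: c1_def algebra_simps)
    have "real b * (pnorm p d1 1)\<^sup>2 \<le> real A * (pnorm p d0 1)\<^sup>2"
      using AB f01 by (intro mult_mono power_mono) (auto simp: pnorm_nonneg)
    then have c: "c0 \<le> c1" using l by (simp add: c0_def c1_def divide_right_mono)
    have fp: "pnorm p d0 d1 > 0" using d by (intro pnorm_pos) auto
    have "c1 * x 1 < c0 * x 0" unfolding e0 e1
      using lt fp f02 x012 by (intro add_less_le_mono mult_strict_left_mono mult_right_mono) auto
    also have "\<dots> \<le> c1 * x 0" using c x012 by (intro mult_right_mono) auto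
    finally have "c1 * x 1 < c1 * x 0" .
    moreover have "c1 * x 1 > 0" unfolding e1 using fp x012 by (intro add_pos_nonneg) (auto simp: pnorm_nonneg)
    then have "c1 > 0" using x012 by (simp add: zero_less_mult_iff)
    ultimately show False using lt by simp
  qed
  have p10: "p1 \<le> p0" unfolding p0_def p1_def
    using x10 f01 x012 l by (intro divide_right_mono mult_mono) (auto simp: pnorm_nonneg)
  have p1: "p1 > 0" unfolding p1_def using x012 l d by (intro divide_pos_pos mult_pos_pos pnorm_pos) auto
  have q: "qform (entry p n (tri n b)) n x = 2 * (pnorm p d0 d1 * x 0 * x 1 + pnorm p d0 2 * x 0 * x 2 + pnorm p d1 2 * x 1 * x 2
      + real b * (pnorm p d1 1 * x 1 * p1) + real A * (pnorm p d0 1 * x 0 * p0))"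
  proof -
    have "(\<Sum>k\<in>{3..<3 + b}. pnorm p d1 1 * x 1 * x k) = (\<Sum>k\<in>{3..<3 + b}. pnorm p d1 1 * x 1 * p1)"
      by (intro sum.cong refl) (simp add: leaf1)
    moreover have "(\<Sum>k\<in>{3 + b..<n}. pnorm p d0 1 * x 0 * x k) = (\<Sum>k\<in>{3 + b..<n}. pnorm p d0 1 * x 0 * p0)"
      by (intro sum.cong refl) (simp add: leaf0)
    ultimately show ?thesis unfolding qform_tri[OF nb(1)] D0 by (simp add: nA)
  qed
  have q': "qform (entry p n (tri n (b - 1))) n x = 2 * (pnorm p (d0 + 1) (d1 - 1) * x 0 * x 1 + pnorm p (d0 + 1) 2 * x 0 * x 2
      + pnorm p (d1 - 1) 2 * x 1 * x 2
      + (real b - 1) * (pnorm p (d1 - 1) 1 * x 1 * p1) + (pnorm p (d0 + 1) 1 * x 0 * p1 + real A * (pnorm p (d0 + 1) 1 * x 0 * p0)))"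
  proof -
    have "(\<Sum>k\<in>{3..<3 + (b - 1)}. pnorm p (d1 - 1) 1 * x 1 * x k) = (\<Sum>k\<in>{3..<3 + (b - 1)}. pnorm p (d1 - 1) 1 * x 1 * p1)"
      by (intro sum.cong refl) (use leaf1 in auto)
    moreover have "(\<Sum>k\<in>{3 + (b - 1)..<n}. pnorm p (d0 + 1) 1 * x 0 * x k)
        = pnorm p (d0 + 1) 1 * x 0 * x (3 + (b - 1)) + (\<Sum>k\<in>{3 + b..<n}. pnorm p (d0 + 1) 1 * x 0 * x k)"
      using B nb by (subst sum.atLeast_Suc_lessThan) (auto simp: numeral_3_eq_3)
    moreover have "(\<Sum>k\<in>{3 + b..<n}. pnorm p (d0 + 1) 1 * x 0 * x k) = (\<Sum>k\<in>{3 + b..<n}. pnorm p (d0 + 1) 1 * x 0 * p0)"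
      by (intro sum.cong refl) (simp add: leaf0)
    moreover have "x (3 + (b - 1)) = p1" using B by (intro leaf1) auto
    ultimately show ?thesis unfolding qform_tri[OF nb(2)] D0 using B by (simp add: of_nat_diff nA)
  qed
  have i1: "pnorm p d0 d1 * x 0 * x 1 \<le> pnorm p (d0 + 1) (d1 - 1) * x 0 * x 1"
    using pnorm_transfer[of p 1 d1 d0] p d x012 by (intro mult_right_mono) auto
  have d2: "pnorm p d1 2 - pnorm p (d1 - 1) 2 \<le> pnorm p (d0 + 1) 2 - pnorm p d0 2"
    using pnorm_transfer_fixed[of p 2 1 d1 d0] p d by (simp add: pnorm_commute)
  have d2': "0 \<le> pnorm p (d0 + 1) 2 - pnorm p d0 2" using p d by (auto intro!: pnorm_mono)
  have "(pnorm p d1 2 - pnorm p (d1 - 1) 2) * x 1 \<le> (pnorm p (d0 + 1) 2 - pnorm p d0 2) * x 0"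
    using mult_right_mono[OF d2, of "x 1"] mult_left_mono[OF x10 d2'] x012 by linarith
  then have i2: "(pnorm p d1 2 - pnorm p (d1 - 1) 2) * x 1 * x 2 \<le> (pnorm p (d0 + 1) 2 - pnorm p d0 2) * x 0 * x 2"
    using x012 by (intro mult_right_mono) auto
  have d3: "pnorm p d1 1 - pnorm p (d1 - 1) 1 \<le> pnorm p (d0 + 1) 1 - pnorm p d0 1"
    using pnorm_transfer_fixed[of p 1 1 d1 d0] p d by (simp add: pnorm_commute)
  have d3': "0 \<le> pnorm p (d0 + 1) 1 - pnorm p d0 1" using p d by (auto intro!: pnorm_mono)
  \<comment> \<open>The \<open>b - 1\<close> pendant edges left at corner 1 lose weight; each of the
    \<open>A \<ge> b\<close> old ones at corner 0 gains at least as much.\<close>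
  have "(real b - 1) * (pnorm p d1 1 - pnorm p (d1 - 1) 1) \<le> real A * (pnorm p (d0 + 1) 1 - pnorm p d0 1)"
  proof -
    have "(real b - 1) * (pnorm p d1 1 - pnorm p (d1 - 1) 1) \<le> (real b - 1) * (pnorm p (d0 + 1) 1 - pnorm p d0 1)"
      using d3 B by (intro mult_left_mono) auto
    also have "\<dots> \<le> real A * (pnorm p (d0 + 1) 1 - pnorm p d0 1)"
      using d3' AB by (intro mult_right_mono) auto
    finally show ?thesis .
  qed
  moreover have "x 1 * p1 \<le> x 0 * p0" using x10 p10 x012 p1 by (intro mult_mono) auto
  ultimately have i3: "(real b - 1) * (pnorm p d1 1 - pnorm p (d1 - 1) 1) * (x 1 * p1)
      \<le> real A * (pnorm p (d0 + 1) 1 - pnorm p d0 1) * (x 0 * p0)"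
    by (rule mult_mono) (use d3' x012 p1 in auto)
  \<comment> \<open>The moved pendant edge supplies the strict inequality.\<close>
  have "pnorm p d1 1 < pnorm p (d0 + 1) 1" using p d by (intro pnorm_strict_mono) auto
  then have i4: "pnorm p d1 1 * x 1 * p1 < pnorm p (d0 + 1) 1 * x 0 * p1"
    using x10 x012 p1 by (intro mult_strict_right_mono mult_less_le_imp_less) (auto simp: pnorm_nonneg)
  have "qform (entry p n (tri n b)) n x < qform (entry p n (tri n (b - 1))) n x"
    unfolding q q' using i1 i2 i3 i4 by (simp add: algebra_simps)
  then show ?thesis using sombor_rho_less[OF _ x refl] nb by simp
qed

section \<open>Graphs on which no Kelmans transformation is available\<close>

definition rest :: "nat set set \<Rightarrow> nat \<Rightarrow> nat \<Rightarrow> nat set set" where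
  "rest E y z = {e \<in> E. y \<notin> e \<and> z \<notin> e}"

lemma simple_edgeE:
  assumes "simple_graph n E" "e \<in> E"
  obtains i j where "e = {i, j}" "i \<noteq> j" "adj E i j" "i < n" "j < n"
proof -
  have "card e = 2" using assms by (simp add: simple_graph_def)
  then obtain i j where e: "e = {i, j}" "i \<noteq> j" by (meson card_2_iff)
  then have "adj E i j" using assms(2) by (simp add: adj_def)
  then show thesis using that e simple_graphD[OF assms(1)] by blast
qed

lemma finite_simple_graph: "simple_graph n E \<Longrightarrow> finite E"
  by (rule finite_subset[of E "Pow {0..<n}"]) (auto simp: simple_graph_def)

text \<open>The two degrees count every edge meeting \<open>y\<close> or \<open>z\<close>, and only
  an edge joining them is counted twice.\<close>

lemma card_edges_split:
  assumes G: "simple_graph n E" and "y \<noteq> z"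
  shows "card E + (if adj E y z then 1 else 0) = deg n E y + deg n E z + card (rest E y z)"
proof -
  have fin: "finite E" using G by (rule finite_simple_graph)
  let ?Ey = "(\<lambda>j. {y, j}) ` nbrs n E y" and ?Ez = "(\<lambda>j. {z, j}) ` nbrs n E z"
  have cy: "card ?Ey = deg n E y" and cz: "card ?Ez = deg n E z"
    unfolding deg_eq_card_nbrs by (auto intro!: card_image simp: inj_on_def doubleton_eq_iff)
  have E: "E = (?Ey \<union> ?Ez) \<union> rest E y z"
  proof (intro equalityI subsetI)
    fix e assume e: "e \<in> E"
    obtain i j where ij: "e = {i, j}" "adj E i j" using simple_edgeE[OF G e] by metis
    show "e \<in> (?Ey \<union> ?Ez) \<union> rest E y z"
      using e ij adj_commute[of E i j] by (auto simp: rest_def mem_nbrs[OF G] insert_commute)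
  qed (auto simp: rest_def mem_nbrs[OF G] adj_def)
  have I: "?Ey \<inter> ?Ez = (if adj E y z then {{y, z}} else {})"
    using \<open>y \<noteq> z\<close> adj_commute[of E y z]
    by (auto simp: mem_nbrs[OF G] doubleton_eq_iff)
  have "card E = card (?Ey \<union> ?Ez) + card (rest E y z)"
    by (subst E, rule card_Un_disjoint) (use fin in \<open>auto simp: rest_def\<close>)
  moreover have "card (?Ey \<union> ?Ez) + card (?Ey \<inter> ?Ez) = card ?Ey + card ?Ez"
    by (rule card_Un_Int[symmetric]) auto
  ultimately show ?thesis using I cy cz by (simp split: if_splits)
qed

text \<open>A star with centre \<open>y\<close>, one of whose leaves, \<open>c\<close>, is also a
  corner of a triangle \<open>c z q\<close>.\<close>

definition star_tri_shape :: "nat \<Rightarrow> nat set set \<Rightarrow> nat \<Rightarrow> nat \<Rightarrow> nat \<Rightarrow> nat \<Rightarrow> bool" where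
  "star_tri_shape n E y c z q \<longleftrightarrow> distinct [y, c, z, q] \<and> {y, c, z, q} \<subseteq> {0..<n} \<and>
    (\<forall>i<n. \<forall>j<n. adj E i j \<longleftrightarrow> {i, j} = {y, c} \<or> {i, j} = {c, z} \<or> {i, j} = {c, q} \<or> {i, j} = {z, q}
      \<or> (i = y \<and> j \<notin> {y, c, z, q}) \<or> (j = y \<and> i \<notin> {y, c, z, q}))"

text \<open>The intrinsic form of the graphs \<open>tri n b\<close>: \<open>x\<close> and
  \<open>u\<close> are the loaded corners, \<open>c\<close> is the third one, and every other vertex
  hangs at exactly one of \<open>x\<close> and \<open>u\<close>.\<close>

definition tri_shape :: "nat \<Rightarrow> nat set set \<Rightarrow> nat \<Rightarrow> nat \<Rightarrow> nat \<Rightarrow> bool" where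
  "tri_shape n E x u c \<longleftrightarrow> distinct [x, u, c] \<and> {x, u, c} \<subseteq> {0..<n} \<and> adj E x u \<and>
    nbrs n E x \<inter> nbrs n E u = {c} \<and> nbrs n E x \<union> nbrs n E u = {0..<n} \<and> rest E x u = {} \<and>
    deg n E u \<le> deg n E x"

text \<open>A pair at distance two on which a Kelmans transformation would be strict but is blocked:
  the neighbourhoods cover all other vertices, so the recipient would get degree
  \<open>n - 2\<close>.\<close>

definition dominating_pair :: "nat \<Rightarrow> nat set set \<Rightarrow> nat \<Rightarrow> nat \<Rightarrow> nat \<Rightarrow> bool" where
  "dominating_pair n E y z c \<longleftrightarrow> y \<noteq> z \<and> \<not> adj E y z \<and> adj E y c \<and> adj E z c \<and>
    (\<exists>v. adj E y v \<and> \<not> adj E z v) \<and> (\<exists>v. adj E z v \<and> \<not> adj E y v) \<and>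
    (\<forall>v<n. v \<noteq> y \<longrightarrow> v \<noteq> z \<longrightarrow> adj E y v \<or> adj E z v)"

text \<open>An edge \<open>x u\<close> with a private neighbour \<open>v\<close> of \<open>x\<close>
  and a private neighbour \<open>w\<close> of \<open>u\<close>: a Kelmans transformation along it
  would be strict.\<close>

definition nontriv :: "nat set set \<Rightarrow> nat \<Rightarrow> nat \<Rightarrow> nat \<Rightarrow> nat \<Rightarrow> bool" where
  "nontriv E x u v w \<longleftrightarrow> adj E x u \<and> adj E x v \<and> v \<noteq> u \<and> \<not> adj E u v \<and> adj E u w \<and> w \<noteq> x \<and> \<not> adj E x w"

text \<open>The situation of a maximiser of the bounded class. \<open>stuck_adj\<close> expresses
  that a strict transformation along an edge leaves the class: the recipient would get degree
  \<open>card (N y \<union> N z) - 1\<close>, which must be at least \<open>n - 2\<close>.\<close>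

context
  fixes n :: nat and E :: "nat set set"
  assumes G: "simple_graph n E" and conn: "connected_graph n E" and cE: "card E = n" and n7: "n \<ge> 7"
    and dle: "\<And>i. i < n \<Longrightarrow> deg n E i \<le> n - 3"
    and stuck_adj: "\<And>y z a b. adj E y z \<Longrightarrow> adj E y a \<Longrightarrow> \<not> adj E z a \<Longrightarrow> a \<noteq> z \<Longrightarrow>
        adj E z b \<Longrightarrow> \<not> adj E y b \<Longrightarrow> b \<noteq> y \<Longrightarrow> n - 1 \<le> card (nbrs n E y \<union> nbrs n E z)"
begin

private abbreviation "a \<equiv> adj E"
private abbreviation "N \<equiv> nbrs n E"

lemma sym: "a i j \<Longrightarrow> a j i"
  by (simp add: adj_commute)

lemma irr: "\<not> a i i"
  using simple_graphD(3)[OF G] by blast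

lemma lt: "a i j \<Longrightarrow> i < n \<and> j < n"
  using simple_graphD[OF G] by blast

lemma mN: "j \<in> N i \<longleftrightarrow> a i j"
  by (rule mem_nbrs[OF G])

lemma rest_mem: "{i, j} \<in> rest E y z \<longleftrightarrow> a i j \<and> i \<noteq> y \<and> i \<noteq> z \<and> j \<noteq> y \<and> j \<noteq> z"
  by (auto simp: rest_def adj_def)

lemma finite_rest: "finite (rest E y z)"
  using finite_simple_graph[OF G] by (simp add: rest_def)

lemma rest_singleton:
  assumes "card (rest E y z) \<le> 1" "a i j" "a k l" "{i, j, k, l} \<inter> {y, z} = {}"
  shows "{i, j} = {k, l}"
proof -
  have "{i, j} \<in> rest E y z" "{k, l} \<in> rest E y z" using assms by (auto simp: rest_mem)
  then show ?thesis using assms(1) finite_rest[of y z] by (metis card_le_Suc0_iff_eq One_nat_def)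
qed

lemma rest_pair:
  assumes "card (rest E y z) \<le> 2" "a i j" "a k l" "a s t" "{i, j, k, l, s, t} \<inter> {y, z} = {}"
    "{i, j} \<noteq> {k, l}"
  shows "{s, t} = {i, j} \<or> {s, t} = {k, l}"
proof (rule ccontr)
  assume no: "\<not> ?thesis"
  have c3: "card {e1, e2, e3} = 3" if "e1 \<noteq> e2" "e3 \<noteq> e1" "e3 \<noteq> e2" for e1 e2 e3 :: "nat set"
    using that by simp
  have "card {{i, j}, {k, l}, {s, t}} = 3" by (rule c3) (use assms(6) no in blast)+
  moreover have "{{i, j}, {k, l}, {s, t}} \<subseteq> rest E y z" using assms by (auto simp: rest_mem)
  then have "card {{i, j}, {k, l}, {s, t}} \<le> 2" using card_mono[OF finite_rest] assms(1) by (meson le_trans)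
  ultimately show False by simp
qed

lemma card_union_le: "N y \<subseteq> X \<union> Y \<Longrightarrow> N z \<subseteq> X \<union> Y \<Longrightarrow> finite X \<Longrightarrow> finite Y \<Longrightarrow> card (N y \<union> N z) \<le> card X + card Y"
  by (meson card_Un_le card_mono finite_Un le_trans Un_least)

section \<open>Nonadjacent vertices with a common neighbour\<close>

lemma dominating_sym: "dominating_pair n E y z c \<Longrightarrow> dominating_pair n E z y c"
  using sym by (auto simp: dominating_pair_def)

text \<open>The neighbourhoods cover everything but \<open>y\<close> and \<open>z\<close>.
  Comparison with the total of \<open>n\<close> edges shows that common neighbours and edges
  avoiding the pair number two together.\<close>

lemma dominating_counts:
  assumes d: "dominating_pair n E y z c"
  shows "deg n E y + deg n E z = n - 2 + card (N y \<inter> N z)"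
    and "card (rest E y z) + card (N y \<inter> N z) = 2"
proof -
  have yz: "y \<noteq> z" "\<not> a y z" "y < n" "z < n" using d lt by (auto simp: dominating_pair_def)
  have zy: "\<not> a z y" using yz sym by blast
  have "N y \<union> N z = {0..<n} - {y, z}"
  proof (intro equalityI subsetI)
    fix v assume "v \<in> N y \<union> N z"
    then have "a y v \<or> a z v" by (simp add: mN)
    then show "v \<in> {0..<n} - {y, z}" using lt[of y v] lt[of z v] yz zy irr by auto
  next
    fix v assume "v \<in> {0..<n} - {y, z}"
    then show "v \<in> N y \<union> N z" using d by (simp add: mN dominating_pair_def)
  qed
  then have "card (N y \<union> N z) = n - 2" using yz by (simp add: card_Diff_subset)
  then show 1: "deg n E y + deg n E z = n - 2 + card (N y \<inter> N z)"
    using card_Un_Int[of "N y" "N z"] by (simp add: deg_eq_card_nbrs)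
  show "card (rest E y z) + card (N y \<inter> N z) = 2"
    using card_edges_split[OF G yz(1)] 1 yz cE n7 by simp
qed

text \<open>Here \<open>y c z c'\<close> is a 4-cycle and \<open>c\<close> has no neighbours but
  \<open>y\<close> and \<open>z\<close>. The edge from \<open>y\<close> to \<open>c\<close> has the
  private neighbours \<open>c'\<close> and \<open>z\<close>, hence is blocked, and
  \<open>N c\<close> adds at most two vertices to \<open>N y\<close>.\<close>

lemma dominating_two_common:
  assumes d: "dominating_pair n E y z c" and c2: "a y c'" "a z c'" "c' \<noteq> c" and R: "rest E y z = {}"
  shows "deg n E y \<ge> n - 3"
proof -
  have yz: "y \<noteq> z" "\<not> a y z" "a y c" "a z c" using d by (auto simp: dominating_pair_def)
  have ncc: "\<not> a c c'"
    using R rest_mem[of c c' y z] yz c2 irr by auto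
  have Nc: "v \<in> {y, z}" if "a c v" for v
    using R rest_mem[of c v y z] yz that irr by auto
  have "n - 1 \<le> card (N y \<union> N c)"
    by (rule stuck_adj[of y c c' z]) (use yz c2 ncc sym in auto)
  also have "\<dots> \<le> card (N y) + card {y, z}"
    by (rule card_union_le) (auto simp: mN dest!: Nc)
  finally show ?thesis using yz by (simp add: deg_eq_card_nbrs)
qed

text \<open>The edge from \<open>y\<close> to \<open>c\<close> is examined; \<open>z\<close> is
  private to \<open>c\<close>. If \<open>y\<close> has a private neighbour there, the edge is
  blocked, and \<open>N c\<close> adds to \<open>N y\<close> only \<open>y\<close>, \<open>z\<close>
  and possibly an end of the one edge avoiding the pair. Otherwise that edge closes a triangle at
  \<open>y\<close>, which has no further neighbours.\<close>

lemma dominating_one_common: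
  assumes d: "dominating_pair n E y z c" and C: "N y \<inter> N z = {c}" and R: "card (rest E y z) \<le> 1"
  shows "(deg n E y = 2 \<and> (\<exists>v. a y v \<and> \<not> a z v \<and> a c v)) \<or> deg n E y \<ge> n - 3 \<or>
    (deg n E y \<ge> n - 4 \<and> (\<exists>v. a z v \<and> \<not> a y v \<and> a c v))"
proof -
  have yz: "y \<noteq> z" "\<not> a y z" "a y c" "a z c" using d by (auto simp: dominating_pair_def)
  have uniq: "v = w" if "a c v" "a c w" "v \<notin> {y, z}" "w \<notin> {y, z}" for v w
    using rest_singleton[OF R, of c v c w] that yz irr by (auto simp: doubleton_eq_iff)
  have cover: "a y v \<or> a z v" if "a c v" "v \<notin> {y, z}" for v
    using d that lt by (auto simp: dominating_pair_def)
  show ?thesis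
  proof (cases "\<exists>v. a y v \<and> v \<noteq> c \<and> \<not> a c v")
    case True
    then obtain v where v: "a y v" "v \<noteq> c" "\<not> a c v" by blast
    have le: "n - 1 \<le> card (N y \<union> N c)"
      by (rule stuck_adj[of y c v z]) (use yz v sym in auto)
    show ?thesis
    proof (cases "\<exists>v. a z v \<and> \<not> a y v \<and> a c v")
      case q: True
      then obtain q where q: "a z q" "\<not> a y q" "a c q" by blast
      have cw: "w \<in> {y, z, q}" if "a c w" for w
      proof -
        have "q \<noteq> y" "q \<noteq> z" using q(1) yz(2) sym irr by metis+
        then show ?thesis using uniq[OF q(3) that] by blast
      qed
      have "N c \<subseteq> {y, z, q}" by (rule subsetI, rule cw) (simp add: mN)
      then have "card (N y \<union> N c) \<le> card (N y) + card {y, z, q}"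
        by (intro card_union_le) auto
      also have "card {y, z, q} \<le> 3" by (simp add: card_insert_if)
      finally show ?thesis using le q by (auto simp: deg_eq_card_nbrs)
    next
      case False
      have "v \<in> N y \<union> {y, z}" if "v \<in> N c" for v
        using that False cover[of v] unfolding mN Un_iff by blast
      then have "card (N y \<union> N c) \<le> card (N y) + card {y, z}"
        by (intro card_union_le) auto
      also have "card {y, z} = 2" using yz by simp
      finally show ?thesis using le by (auto simp: deg_eq_card_nbrs)
    qed
  next
    case False
    obtain p where p: "a y p" "\<not> a z p" using d by (auto simp: dominating_pair_def)
    then have pc: "p \<noteq> c" "a c p" using yz False by auto
    have "N y = {c, p}"
    proof (intro equalityI subsetI)
      fix v assume v: "v \<in> N y"
      show "v \<in> {c, p}"
      proof (cases "v = c")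
        case False
        then have "a c v" using v \<open>\<not> (\<exists>v. a y v \<and> v \<noteq> c \<and> \<not> a c v)\<close> by (auto simp: mN)
        then show ?thesis using uniq[of v p] pc p v yz irr by (auto simp: mN)
      qed simp
    qed (use p yz in \<open>auto simp: mN\<close>)
    then have "deg n E y = 2" using pc by (simp add: deg_eq_card_nbrs)
    then show ?thesis using p pc by blast
  qed
qed

text \<open>With \<open>N z = {c, q}\<close> and \<open>c q\<close> the only edge avoiding the pair,
  domination joins \<open>y\<close> to everything except \<open>y\<close>, \<open>z\<close> and
  \<open>q\<close>; the adjacency is then fully determined.\<close>

lemma dominating_star_tri_shape:
  assumes d: "dominating_pair n E y z c" and C: "N y \<inter> N z = {c}" and R: "card (rest E y z) \<le> 1"
    and q: "deg n E z = 2" "a z q" "\<not> a y q" "a c q"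
  shows "star_tri_shape n E y c z q"
proof -
  have yz: "y \<noteq> z" "\<not> a y z" "a y c" "a z c" using d by (auto simp: dominating_pair_def)
  have cq: "c \<noteq> q" using q yz by auto
  have dist: "y \<noteq> c" "y \<noteq> q" "z \<noteq> c" "z \<noteq> q" using yz q irr sym by metis+
  have "N z = {c, q}"
  proof (rule card_subset_eq[symmetric])
    show "{c, q} \<subseteq> N z" using yz q by (auto simp: mN)
  qed (use q cq in \<open>auto simp: deg_eq_card_nbrs\<close>)
  then have z: "a z v \<longleftrightarrow> v = c \<or> v = q" for v by (auto simp flip: mN)
  have y: "a y v \<longleftrightarrow> v \<notin> {y, z, q}" if "v < n" for v
    using d that z yz q irr by (auto simp: dominating_pair_def)
  have r: "a i j \<longleftrightarrow> {i, j} = {c, q}" if "i \<notin> {y, z}" "j \<notin> {y, z}" for i j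
  proof
    assume "a i j"
    then show "{i, j} = {c, q}" using rest_singleton[OF R, of i j c q] q that dist by auto
  next
    assume "{i, j} = {c, q}"
    then show "a i j" using q sym by (auto simp: doubleton_eq_iff)
  qed
  have "a i j \<longleftrightarrow> {i, j} = {y, c} \<or> {i, j} = {c, z} \<or> {i, j} = {c, q} \<or> {i, j} = {z, q}
      \<or> (i = y \<and> j \<notin> {y, c, z, q}) \<or> (j = y \<and> i \<notin> {y, c, z, q})" if ij: "i < n" "j < n" for i j
  proof -
    consider "i = y" | "i = z" | "j = y" | "j = z" | "i \<notin> {y, z}" "j \<notin> {y, z}" by blast
    then show ?thesis
    proof cases
      case 1 then show ?thesis using y[OF ij(2)] yz dist cq by (auto simp: doubleton_eq_iff)
    next
      case 2 then show ?thesis using z[of j] yz dist cq by (auto simp: doubleton_eq_iff)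
    next
      case 3
      then have "a i j \<longleftrightarrow> i \<notin> {y, z, q}" using y[OF ij(1)] adj_commute[of E i y] by simp
      then show ?thesis using 3 yz dist cq by (auto simp: doubleton_eq_iff)
    next
      case 4
      then have "a i j \<longleftrightarrow> i = c \<or> i = q" using z[of i] adj_commute[of E i z] by simp
      then show ?thesis using 4 yz dist cq by (auto simp: doubleton_eq_iff)
    next
      case 5 then show ?thesis using r dist cq by (auto simp: doubleton_eq_iff)
    qed
  qed
  then show ?thesis using yz q dist cq lt[of y c] lt[of z q] unfolding star_tri_shape_def by simp
qed

text \<open>The pair is symmetric, so both ends pass through the same case analysis; the degree sum
  \<open>n - 1\<close> or \<open>n\<close> is too small for both to have large degree.\<close>

lemma dominating_pair_star_tri:
  assumes d: "dominating_pair n E y z c"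
  shows "\<exists>y c z q. star_tri_shape n E y c z q"
proof -
  have yz: "y \<noteq> z" "\<not> a y z" "a y c" "a z c" using d by (auto simp: dominating_pair_def)
  have cC: "c \<in> N y \<inter> N z" using yz by (simp add: mN)
  then have "card (N y \<inter> N z) > 0" by (auto simp: card_gt_0_iff)
  moreover note dominating_counts[OF d]
  ultimately consider "card (N y \<inter> N z) = 1" "card (rest E y z) = 1" "deg n E y + deg n E z = n - 1"
    | "card (N y \<inter> N z) = 2" "card (rest E y z) = 0" "deg n E y + deg n E z = n"
    using n7 by linarith
  then show ?thesis
  proof cases
    case 1
    then have C: "N y \<inter> N z = {c}" using cC by (metis card_1_singletonE singletonD)
    then have C': "N z \<inter> N y = {c}" by blast
    have R: "card (rest E y z) \<le> 1" "card (rest E z y) \<le> 1" using 1 by (auto simp: rest_def conj_commute)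
    note Ay = dominating_one_common[OF d C R(1)]
    note Az = dominating_one_common[OF dominating_sym[OF d] C' R(2)]
    show ?thesis
    proof (rule ccontr)
      assume no: "\<not> ?thesis"
      then have "\<not> (deg n E z = 2 \<and> (\<exists>v. a z v \<and> \<not> a y v \<and> a c v))"
        using dominating_star_tri_shape[OF d C R(1)] by blast
      with Az have Az': "deg n E z \<ge> n - 3 \<or> (deg n E z \<ge> n - 4 \<and> (\<exists>v. a y v \<and> \<not> a z v \<and> a c v))" by blast
      from no have "\<not> (deg n E y = 2 \<and> (\<exists>v. a y v \<and> \<not> a z v \<and> a c v))"
        using dominating_star_tri_shape[OF dominating_sym[OF d] C' R(2)] by blast
      with Ay have Ay': "deg n E y \<ge> n - 3 \<or> (deg n E y \<ge> n - 4 \<and> (\<exists>v. a z v \<and> \<not> a y v \<and> a c v))" by blast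
      have "\<not> deg n E z \<ge> n - 3" "\<not> deg n E y \<ge> n - 3" using Az' Ay' 1(3) n7 by auto
      \<comment> \<open>For \<open>n = 7\<close> the degree sum alone does not exclude that both
        ends have degree \<open>n - 4\<close>. But then \<open>c\<close> would have two edges
        avoiding the pair, to \<open>p\<close> and to \<open>q\<close>, and only one exists.\<close>
      with Az' Ay' obtain p q where "a y p" "\<not> a z p" "a c p" "a z q" "\<not> a y q" "a c q" by blast
      then show False
        using rest_singleton[OF R(1), of c p c q] yz irr sym by (auto simp: doubleton_eq_iff)
    qed
  next
    case 2
    then have R: "rest E y z = {}" "rest E z y = {}"
      using finite_rest by (auto simp: rest_def)
    have "\<exists>c'. c' \<in> N y \<inter> N z \<and> c' \<noteq> c"
    proof (rule ccontr)
      assume "\<not> ?thesis"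
      then have "N y \<inter> N z \<subseteq> {c}" by blast
      then have "card (N y \<inter> N z) \<le> card {c}" by (intro card_mono) auto
      then show False using 2 by simp
    qed
    then obtain c' where "a y c'" "a z c'" "c' \<noteq> c" by (auto simp: mN)
    then have "deg n E y \<ge> n - 3" "deg n E z \<ge> n - 3"
      using dominating_two_common[OF d _ _ _ R(1)] dominating_two_common[OF dominating_sym[OF d] _ _ _ R(2)] by auto
    then show ?thesis using 2 n7 by simp
  qed
qed

section \<open>Adjacent vertices, once the nonadjacent case is excluded\<close>

context
  assumes no_dom: "\<And>y z c v w. y \<noteq> z \<Longrightarrow> \<not> a y z \<Longrightarrow> a y c \<Longrightarrow> a z c \<Longrightarrow> a y v \<Longrightarrow> \<not> a z v \<Longrightarrow> a z w \<Longrightarrow> \<not> a y w \<Longrightarrow> False"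
begin

lemma nontriv_sym: "nontriv E x u v w \<Longrightarrow> nontriv E u x w v"
  using sym by (auto simp: nontriv_def)

text \<open>\<open>x\<close> has maximum degree but does not reach every vertex, so some neighbour
  \<open>u\<close> has a neighbour \<open>w\<close> outside \<open>N x\<close>. If \<open>u\<close>
  were adjacent to all other neighbours of \<open>x\<close>, its degree would exceed that of
  \<open>x\<close>.\<close>

lemma nontriv_exists:
  assumes "x < n" "\<And>i. i < n \<Longrightarrow> deg n E i \<le> deg n E x"
  shows "\<exists>u v w. nontriv E x u v w"
proof -
  have "\<exists>u w. a x u \<and> a u w \<and> \<not> a x w \<and> w \<noteq> x"
  proof (rule ccontr)
    assume no: "\<not> ?thesis"
    have all: "i = x \<or> a x i" if "i < n" for i
      by (rule connected_zero_set[OF conn assms(1) that, of "\<lambda>i. i = x \<or> a x i"]) (use no in auto)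
    have "card ({0..<n} - {x}) \<le> deg n E x"
      unfolding deg_eq_card_nbrs by (rule card_mono) (auto simp: mN dest: all)
    moreover have "deg n E x \<le> n - 3" using dle assms(1) by blast
    ultimately show False using assms(1) n7 by simp
  qed
  then obtain u w where u: "a x u" "a u w" "\<not> a x w" "w \<noteq> x" by blast
  have "\<exists>v. a x v \<and> v \<noteq> u \<and> \<not> a u v"
  proof (rule ccontr)
    assume no: "\<not> ?thesis"
    have "insert x (insert w (N x - {u})) \<subseteq> N u" using no u sym by (auto simp: mN)
    then have "card (insert x (insert w (N x - {u}))) \<le> deg n E u"
      unfolding deg_eq_card_nbrs by (intro card_mono) auto
    moreover have "card (insert x (insert w (N x - {u}))) = Suc (Suc (card (N x - {u})))"
      using u irr by (simp add: mN)
    moreover have "Suc (card (N x - {u})) = deg n E x"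
      unfolding deg_eq_card_nbrs by (rule card_Suc_Diff1) (use u in \<open>auto simp: mN\<close>)
    moreover have "deg n E u \<le> deg n E x" using assms(2) lt u by blast
    ultimately show False by simp
  qed
  then show ?thesis using u by (auto simp: nontriv_def)
qed

text \<open>The last identity is the edge count. As the union has \<open>n - 1\<close> or
  \<open>n\<close> vertices, common neighbours and edges avoiding the pair number two or
  one.\<close>

lemma nontriv_counts:
  assumes "nontriv E x u v w"
  shows "n - 1 \<le> card (N x \<union> N u)" "card (N x \<union> N u) \<le> n"
    "deg n E x + deg n E u = card (N x \<union> N u) + card (N x \<inter> N u)"
    "card (rest E x u) + card (N x \<union> N u) + card (N x \<inter> N u) = n + 1"
proof -
  have u: "a x u" "a x v" "v \<noteq> u" "\<not> a u v" "a u w" "w \<noteq> x" "\<not> a x w"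
    using assms by (auto simp: nontriv_def)
  show "n - 1 \<le> card (N x \<union> N u)" by (rule stuck_adj[of x u v w]) (use u in auto)
  have "card (N x \<union> N u) \<le> card {0..<n}" by (rule card_mono) (auto simp: nbrs_def)
  then show "card (N x \<union> N u) \<le> n" by simp
  show 3: "deg n E x + deg n E u = card (N x \<union> N u) + card (N x \<inter> N u)"
    unfolding deg_eq_card_nbrs by (rule card_Un_Int) auto
  have "x \<noteq> u" using u irr by auto
  then show "card (rest E x u) + card (N x \<union> N u) + card (N x \<inter> N u) = n + 1"
    using card_edges_split[OF G, of x u] u cE 3 by simp
qed

text \<open>An edge inside the private neighbourhood of \<open>x\<close> would close a triangle \<open>x r s\<close> sharing only \<open>x\<close> with \<open>u\<close>.\<close>

lemma no_edge_in_private: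
  assumes "nontriv E x u v w" and R: "card (rest E x u) \<le> 1" and C: "N x \<inter> N u = {}"
    and rs: "a r s" "a x r" "a x s" "r \<noteq> u" "s \<noteq> u"
  shows False
proof -
  have u: "a x u" "a u w" "w \<noteq> x" "\<not> a x w" using assms(1) by (auto simp: nontriv_def)
  have nu: "\<not> a u r" "\<not> a u s" using C rs by (auto simp: mN disjoint_iff)
  have ne: "r \<noteq> x" "s \<noteq> x" "w \<noteq> u" "w \<noteq> r" "w \<noteq> s" using rs u irr by auto
  have "\<not> a r w"
  proof
    assume "a r w"
    then have "{r, w} = {r, s}" using rest_singleton[OF R, of r w r s] rs ne u(3) by auto
    then show False using ne by (auto simp: doubleton_eq_iff)
  qed
  then show False
    using no_dom[of r u x s w] rs nu u sym by blast
qed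

text \<open>\<open>x r s u\<close> is a 4-cycle whose edge \<open>r s\<close> is the only one
  avoiding the pair, so \<open>N r\<close> lies in \<open>{x, s}\<close>. The edge from
  \<open>x\<close> to \<open>r\<close> has the private neighbours \<open>u\<close> and
  \<open>s\<close>; being blocked, it forces \<open>N x\<close> to be large.\<close>

lemma no_edge_across:
  assumes "nontriv E x u v w" and R: "card (rest E x u) \<le> 1" and C: "N x \<inter> N u = {}"
    and rs: "a r s" "a x r" "a u s" "r \<noteq> u" "s \<noteq> x"
  shows "deg n E x \<ge> n - 3"
proof -
  have u: "a x u" using assms(1) by (auto simp: nontriv_def)
  have nu: "\<not> a u r" "\<not> a x s" using C rs by (auto simp: mN disjoint_iff)
  have ne: "r \<noteq> x" "s \<noteq> u" "r \<noteq> s" using rs u irr by auto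
  have Nr: "t \<in> {x, s}" if "a r t" for t
  proof (rule ccontr)
    assume t: "t \<notin> {x, s}"
    then have "t \<noteq> u" using that nu sym by auto
    then have "{r, t} = {r, s}" using rest_singleton[OF R, of r t r s] rs ne t that by auto
    then show False using t by (auto simp: doubleton_eq_iff)
  qed
  have "n - 1 \<le> card (N x \<union> N r)"
    by (rule stuck_adj[of x r u s]) (use u rs nu ne sym in auto)
  also have "\<dots> \<le> card (N x) + card {x, s}"
    by (rule card_union_le) (auto simp: mN dest!: Nr)
  also have "card {x, s} \<le> 2" by (simp add: card_insert_if)
  finally show ?thesis by (simp add: deg_eq_card_nbrs)
qed

text \<open>\<open>r\<close> and \<open>u\<close> are not adjacent and share the neighbour
  \<open>x\<close>; as \<open>t\<close> is private to \<open>r\<close>, every private neighbour of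
  \<open>u\<close> must be joined to \<open>r\<close>. The edges \<open>t r\<close> and
  \<open>r w\<close> then exhaust \<open>rest E x u\<close>, so \<open>N u\<close> lies in
  \<open>{x, w}\<close> and \<open>N w\<close> in \<open>{u, r}\<close>, too little for the blocked
  edge \<open>u w\<close>.\<close>

lemma missing_vertex_private:
  assumes nt: "nontriv E x u v w" and R: "card (rest E x u) + card (N x \<inter> N u) = 2"
    and t: "a t r" "a x r" "\<not> a u r" "\<not> a x t" "\<not> a u t"
  shows False
proof -
  have u: "a x u" "a u w" "w \<noteq> x" "\<not> a x w" using nt by (auto simp: nontriv_def)
  have ne: "r \<noteq> x" "r \<noteq> u" "t \<noteq> x" "t \<noteq> u" "t \<noteq> w" "r \<noteq> w" "w \<noteq> u" "t \<noteq> r" "x \<noteq> u"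
    using t u irr sym by auto
  have key: "a r w'" if "a u w'" "\<not> a x w'" "w' \<noteq> x" for w'
    using no_dom[of r u x t w'] t u ne that sym by blast
  have rw: "a r w" using key u by blast
  have trw: "{t, r} \<noteq> {r, w}" using ne by (auto simp: doubleton_eq_iff)
  have R2: "card (rest E x u) \<le> 2" using R by simp
  have pair: "{i, j} = {t, r} \<or> {i, j} = {r, w}" if "a i j" "{i, j} \<inter> {x, u} = {}" for i j
    by (rule rest_pair[OF R2, of t r r w i j]) (use t rw that ne trw u(3) in auto)
  have "card {{t, r}, {r, w}} \<le> card (rest E x u)"
    by (rule card_mono[OF finite_rest]) (use t rw ne u(3) in \<open>auto simp: rest_mem\<close>)
  then have "card (rest E x u) = 2" using trw R by simp
  then have "N x \<inter> N u = {}" using R by simp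
  then have C: "\<not> a x i" if "a u i" for i using that by (auto simp: mN disjoint_iff)
  have Nu: "i \<in> {x, w}" if "a u i" for i
  proof (rule ccontr)
    assume i: "i \<notin> {x, w}"
    then have "a r i" using key[OF that C[OF that]] by simp
    moreover have "i \<noteq> u" "i \<noteq> t" "i \<noteq> r" using that irr t by auto
    ultimately have "{r, i} = {t, r} \<or> {r, i} = {r, w}" using pair[of r i] i ne by auto
    then show False using i \<open>i \<noteq> t\<close> \<open>i \<noteq> r\<close> by (auto simp: doubleton_eq_iff)
  qed
  have Nw: "i \<in> {u, r}" if "a w i" for i
  proof (rule ccontr)
    assume i: "i \<notin> {u, r}"
    have "i \<noteq> x" "i \<noteq> w" using that u irr sym by auto
    then have "{w, i} = {t, r} \<or> {w, i} = {r, w}" using pair[of w i] i ne u that by auto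
    then show False using i ne by (auto simp: doubleton_eq_iff)
  qed
  have "n - 1 \<le> card (N u \<union> N w)"
    by (rule stuck_adj[of u w x r]) (use u t rw ne sym in auto)
  also have "\<dots> \<le> card {x, w} + card {u, r}"
    by (rule card_union_le) (auto simp: mN dest!: Nu Nw)
  also have "\<dots> \<le> 4" by (simp add: card_insert_if)
  finally show False using n7 by simp
qed

text \<open>The edge \<open>t r\<close> is the only one avoiding the pair, so \<open>N r\<close>
  lies in \<open>{x, u, t}\<close>. The edge from \<open>x\<close> to \<open>r\<close>, with private
  neighbours \<open>v\<close> and \<open>t\<close>, is blocked, although \<open>N r\<close> adds
  only \<open>x\<close> and \<open>t\<close> to \<open>N x\<close>.\<close>

lemma missing_vertex_common:
  assumes nt: "nontriv E x u v w" and R: "card (rest E x u) \<le> 1"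
    and t: "a t r" "a x r" "a u r" "\<not> a x t" "\<not> a u t"
  shows "deg n E x \<ge> n - 3"
proof -
  have u: "a x u" "a x v" "v \<noteq> u" "\<not> a u v" using nt by (auto simp: nontriv_def)
  have ne: "r \<noteq> x" "r \<noteq> u" "t \<noteq> x" "t \<noteq> u" "t \<noteq> v" "r \<noteq> v" "v \<noteq> x" "t \<noteq> r" "x \<noteq> u"
    using t u irr sym by auto
  have Nr: "i \<in> {x, u, t}" if "a r i" for i
  proof (rule ccontr)
    assume i: "i \<notin> {x, u, t}"
    then have "{r, i} = {t, r}" using rest_singleton[OF R, of r i t r] that t ne by auto
    then show False using i ne by (auto simp: doubleton_eq_iff)
  qed
  have "n - 1 \<le> card (N x \<union> N r)"
    by (rule stuck_adj[of x r v t]) (use u t ne sym Nr[of v] in auto)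
  also have "\<dots> \<le> card (N x) + card {x, t}"
    by (rule card_union_le) (use u in \<open>auto simp: mN dest!: Nr\<close>)
  also have "card {x, t} \<le> 2" by (simp add: card_insert_if)
  finally show ?thesis by (simp add: deg_eq_card_nbrs)
qed

text \<open>If the neighbourhoods of the edge \<open>x u\<close> cover all vertices and share one,
  the shape is reached. Every other distribution is contradictory outright or forces both ends to
  degree at least \<open>n - 3\<close>, while the degree sum is only \<open>n\<close>.\<close>

lemma tri_shape_exists: "\<exists>x u c. tri_shape n E x u c"
proof -
  define x where "x = (ARG_MAX (deg n E) i. i < n)"
  have "deg n E i < n" if "i < n" for i using dle[OF that] that by simp
  then have "x < n \<and> (\<forall>i. i < n \<longrightarrow> deg n E i \<le> deg n E x)" unfolding x_def
    using arg_max_nat_lemma[of "\<lambda>i. i < n" 0 "deg n E" n] n7 by auto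
  then have x: "x < n" "\<And>i. i < n \<Longrightarrow> deg n E i \<le> deg n E x" by auto
  obtain u v w where nt: "nontriv E x u v w" using nontriv_exists[OF x] by blast
  note nt' = nontriv_sym[OF nt]
  note cnt = nontriv_counts[OF nt]
  have xu: "a x u" "a u x" "x \<noteq> u" "u < n" using nt irr sym lt by (auto simp: nontriv_def)
  have sr: "rest E u x = rest E x u" "N u \<inter> N x = N x \<inter> N u" by (auto simp: rest_def)
  have sub: "N x \<union> N u \<subseteq> {0..<n}" by (auto simp: nbrs_def)
  consider "card (N x \<union> N u) = n" | "card (N x \<union> N u) = n - 1" using cnt by linarith
  then show ?thesis
  proof cases
    case 1
    then have all: "N x \<union> N u = {0..<n}" using sub by (intro card_subset_eq) auto
    show ?thesis
    proof (cases "N x \<inter> N u = {}")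
      case True
      then have r1: "card (rest E x u) = 1" using cnt 1 by simp
      then obtain e where e: "rest E x u = {e}" by (auto simp: card_1_singleton_iff)
      then have "e \<in> E" by (auto simp: rest_def)
      then obtain r s where rs: "e = {r, s}" "a r s" using simple_edgeE[OF G] by metis
      then have rsx: "r \<notin> {x, u}" "s \<notin> {x, u}" using e rest_mem[of r s x u] by auto
      have R: "card (rest E x u) \<le> 1" "card (rest E u x) \<le> 1" using r1 sr by auto
      have C: "N u \<inter> N x = {}" using True by blast
      have "r \<in> N x \<union> N u" "s \<in> N x \<union> N u" unfolding all using lt[OF rs(2)] by auto
      then have rsN: "a x r \<or> a u r" "a x s \<or> a u s" by (simp_all add: mN)
      have big: "deg n E x \<ge> n - 3 \<and> deg n E u \<ge> n - 3"
      proof -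
        consider "a x r" "a x s" | "a u r" "a u s" | "a x r" "a u s" | "a u r" "a x s" using rsN by blast
        then show ?thesis
        proof cases
          case 1 then show ?thesis using no_edge_in_private[OF nt R(1) True rs(2)] rsx by auto
        next
          case 2 then show ?thesis using no_edge_in_private[OF nt' R(2) C rs(2)] rsx by auto
        next
          case 3 then show ?thesis
            using no_edge_across[OF nt R(1) True rs(2)] no_edge_across[OF nt' R(2) C sym[OF rs(2)]] rsx by auto
        next
          case 4 then show ?thesis
            using no_edge_across[OF nt R(1) True sym[OF rs(2)]] no_edge_across[OF nt' R(2) C rs(2)] rsx by auto
        qed
      qed
      moreover have "deg n E x + deg n E u = n" using cnt(3) 1 True by simp
      ultimately have False using n7 by linarith
      then show ?thesis ..
    next
      case False
      then have "card (N x \<inter> N u) > 0" by (simp add: card_gt_0_iff)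
      then have "card (N x \<inter> N u) = 1" "card (rest E x u) = 0" using cnt 1 by auto
      then obtain c where c: "N x \<inter> N u = {c}" and R: "rest E x u = {}"
        using finite_rest by (auto simp: card_1_singleton_iff)
      have "a x c" "a u c" using c by (auto simp flip: mN)
      then have "tri_shape n E x u c"
        unfolding tri_shape_def using all c R xu x irr lt by (auto simp del: Un_iff)
      then show ?thesis by blast
    qed
  next
    case 2
    have R: "card (rest E x u) + card (N x \<inter> N u) = 2" "card (rest E u x) + card (N u \<inter> N x) = 2"
      using cnt(4) 2 n7 sr by auto
    \<comment> \<open>The one vertex outside both neighbourhoods; connectedness will attach it to
      some \<open>r\<close> inside.\<close>
    have "\<exists>t<n. t \<notin> N x \<union> N u"
    proof (rule ccontr)
      assume "\<not> ?thesis"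
      then have "card {0..<n} \<le> card (N x \<union> N u)" by (intro card_mono) auto
      then show False using 2 n7 by simp
    qed
    then obtain t where t: "t < n" "\<not> a x t" "\<not> a u t" by (auto simp: mN)
    have only: "a x i \<or> a u i" if "i < n" "i \<noteq> t" for i
    proof (rule ccontr)
      assume "\<not> ?thesis"
      then have "N x \<union> N u \<subseteq> {0..<n} - {t, i}" using t by (auto simp: mN dest: lt)
      then have "card (N x \<union> N u) \<le> card ({0..<n} - {t, i})" by (intro card_mono) auto
      also have "\<dots> = n - 2" using that t by (simp add: card_Diff_subset)
      finally show False using 2 n7 by simp
    qed
    have "\<exists>r. a t r"
    proof (rule ccontr)
      assume no: "\<not> ?thesis"
      have "x = t" by (rule connected_zero_set[OF conn t(1) x(1), of "\<lambda>i. i = t"]) (use no in auto)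
      then show False using t xu sym by auto
    qed
    then obtain r where r: "a t r" by blast
    then have rt: "r < n" "r \<noteq> t" using lt irr by auto
    show ?thesis
    proof (cases "a x r \<and> a u r")
      case True
      then have "r \<in> N x \<inter> N u" by (simp add: mN)
      then have c0: "card (N x \<inter> N u) > 0" by (auto simp: card_gt_0_iff)
      have "r \<notin> {x, u}" "t \<notin> {x, u}" using True irr t xu by auto
      then have "{t, r} \<in> rest E x u" using r by (simp add: rest_mem)
      then have "card (rest E x u) > 0" using finite_rest by (auto simp: card_gt_0_iff)
      then have c1: "card (N x \<inter> N u) = 1" "card (rest E x u) \<le> 1" "card (rest E u x) \<le> 1"
        using c0 R sr by auto
      have "deg n E x \<ge> n - 3" "deg n E u \<ge> n - 3"
        using missing_vertex_common[OF nt c1(2) r] missing_vertex_common[OF nt' c1(3) r] True t by auto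
      moreover have "deg n E x + deg n E u = n" using cnt(3) 2 c1 n7 by simp
      ultimately have False using n7 by linarith
      then show ?thesis ..
    next
      case False
      then show ?thesis
        using only[OF rt] missing_vertex_private[OF nt R(1) r] missing_vertex_private[OF nt' R(2) r] t by blast
    qed
  qed
qed

end

end

section \<open>Isomorphism\<close>

lemma graph_iso_deg:
  assumes f: "bij_betw f {0..<n} {0..<n}" "\<forall>i<n. \<forall>j<n. adj E i j \<longleftrightarrow> adj E' (f i) (f j)" and i: "i < n"
  shows "deg n E' (f i) = deg n E i"
proof -
  have "bij_betw f (nbrs n E i) (nbrs n E' (f i))"
  proof (rule bij_betw_imageI)
    show "inj_on f (nbrs n E i)"
      using f(1) by (auto simp: bij_betw_def nbrs_def intro: inj_on_subset)
    have im: "f ` {0..<n} = {0..<n}" using f(1) by (simp add: bij_betw_def)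
    show "f ` nbrs n E i = nbrs n E' (f i)"
    proof (intro equalityI subsetI)
      fix k assume "k \<in> f ` nbrs n E i"
      then show "k \<in> nbrs n E' (f i)" using f(2) i im by (auto simp: nbrs_def)
    next
      fix k assume k: "k \<in> nbrs n E' (f i)"
      then have "k \<in> f ` {0..<n}" using im by (simp add: nbrs_def)
      then show "k \<in> f ` nbrs n E i" using k f(2) i by (auto simp: nbrs_def)
    qed
  qed
  then show ?thesis by (simp add: deg_eq_card_nbrs bij_betw_same_card)
qed

text \<open>An eigenvector is transported along the bijection. One inequality suffices, because
  isomorphism is symmetric.\<close>

lemma graph_iso_rho_le:
  assumes "graph_iso n E E'" "n \<ge> 1"
  shows "sombor_rho p n E \<le> sombor_rho p n E'"
proof -
  obtain f where f: "bij_betw f {0..<n} {0..<n}" "\<forall>i<n. \<forall>j<n. adj E i j \<longleftrightarrow> adj E' (f i) (f j)"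
    using assms(1) by (auto simp: graph_iso_def)
  have f': "bij_betw f {..<n} {..<n}" using f(1) by (simp add: atLeast0LessThan)
  obtain x where x: "(\<Sum>i<n. (x i)\<^sup>2) = 1" "\<forall>i<n. (\<Sum>j<n. entry p n E i j * x j) = sombor_rho p n E * x i"
    using sombor_rho_qform(2)[OF assms(2)] by blast
  define y where "y = x \<circ> inv_into {..<n} f"
  have yf: "y (f i) = x i" if "i < n" for i
    unfolding y_def using that f' by (simp add: bij_betw_def inv_into_f_f)
  have wf: "entry p n E' (f i) (f j) = entry p n E i j" if "i < n" "j < n" for i j
    using that f graph_iso_deg[OF f] by (simp add: entry_def)
  have n1: "(\<Sum>i<n. (y i)\<^sup>2) = 1"
    by (subst sum.reindex_bij_betw[OF f', symmetric]) (use x yf in simp)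
  have "qform (entry p n E') n y = (\<Sum>i<n. \<Sum>j<n. entry p n E' (f i) (f j) * y (f i) * y (f j))"
    unfolding qform_def
    by (subst sum.reindex_bij_betw[OF f', symmetric], rule sum.cong[OF refl],
        subst sum.reindex_bij_betw[OF f', symmetric]) simp
  also have "\<dots> = qform (entry p n E) n x"
    unfolding qform_def by (intro sum.cong refl) (simp add: wf yf)
  also have "\<dots> = sombor_rho p n E" using qform_of_eigenvector[of n _ x] x by simp
  finally show ?thesis using sombor_rho_qform(1)[OF assms(2), of p E' y] n1 by simp
qed

lemma graph_iso_sym:
  assumes "graph_iso n E E'"
  shows "graph_iso n E' E"
proof -
  obtain f where f: "bij_betw f {0..<n} {0..<n}" "\<forall>i<n. \<forall>j<n. adj E i j \<longleftrightarrow> adj E' (f i) (f j)"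
    using assms by (auto simp: graph_iso_def)
  let ?g = "inv_into {0..<n} f"
  have g: "bij_betw ?g {0..<n} {0..<n}" by (rule bij_betw_inv_into[OF f(1)])
  have gl: "?g i < n" "f (?g i) = i" if "i < n" for i
    using that f(1) g bij_betw_inv_into_right[OF f(1), of i] by (auto simp: bij_betw_def)
  show ?thesis unfolding graph_iso_def
    using g gl f(2) by (intro exI[of _ ?g]) auto
qed

lemma graph_iso_rho: "graph_iso n E E' \<Longrightarrow> n \<ge> 1 \<Longrightarrow> sombor_rho p n E = sombor_rho p n E'"
  by (meson graph_iso_rho_le graph_iso_sym order_antisym)

text \<open>Pendant vertices at the same vertex are interchangeable: if colours decide adjacency,
  any bijections between colour classes of equal size glue to an isomorphism, and no explicit
  numbering of the pendant vertices is built.\<close>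

lemma graph_iso_colouring:
  assumes E: "\<And>i j. i < n \<Longrightarrow> j < n \<Longrightarrow> adj E i j \<longleftrightarrow> R (clr i) (clr j)"
    and E': "\<And>i j. i < n \<Longrightarrow> j < n \<Longrightarrow> adj E' i j \<longleftrightarrow> R (clr' i) (clr' j)"
    and card: "\<And>k. card {i \<in> {0..<n}. clr i = k} = card {i \<in> {0..<n}. clr' i = k}"
  shows "graph_iso n E E'"
proof -
  have "\<exists>g. bij_betw g {i \<in> {0..<n}. clr i = k} {i \<in> {0..<n}. clr' i = k}" for k
    using card[of k] by (intro finite_same_card_bij) auto
  then obtain g where g: "\<And>k. bij_betw (g k) {i \<in> {0..<n}. clr i = k} {i \<in> {0..<n}. clr' i = k}" by metis
  define f where "f i = g (clr i) i" for i
  have fi: "f i < n \<and> clr' (f i) = clr i" if "i < n" for i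
    using bij_betwE[OF g[of "clr i"]] that by (auto simp: f_def)
  have inj: "inj_on f {0..<n}"
  proof (rule inj_onI)
    fix i j assume ij: "i \<in> {0..<n}" "j \<in> {0..<n}" "f i = f j"
    then have c: "clr i = clr j" using fi by (metis atLeastLessThan_iff)
    then show "i = j" using ij g[of "clr i"] by (auto simp: f_def bij_betw_def dest!: inj_onD)
  qed
  have "f ` {0..<n} \<subseteq> {0..<n}" using fi by auto
  then have "f ` {0..<n} = {0..<n}" using inj by (intro endo_inj_surj) auto
  then have "bij_betw f {0..<n} {0..<n}" using inj by (simp add: bij_betw_def)
  then show ?thesis unfolding graph_iso_def using E E' fi by (intro exI[of _ f]) auto
qed

text \<open>For a small core with all other vertices pendant at one core vertex. The core is matched
  by position in \<open>xs\<close>, the pendant vertices by their number.\<close>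

lemma graph_iso_core:
  assumes xs: "distinct xs" "xs \<noteq> []" "set xs \<subseteq> {0..<n}"
    and core: "\<And>i j. i < length xs \<Longrightarrow> j < length xs \<Longrightarrow> adj E (xs ! i) (xs ! j) \<longleftrightarrow> adj E' i j"
    and E: "\<And>v u. v < n \<Longrightarrow> v \<notin> set xs \<Longrightarrow> u < n \<Longrightarrow> adj E v u \<longleftrightarrow> u = xs ! 0"
    and E': "\<And>v u. length xs \<le> v \<Longrightarrow> v < n \<Longrightarrow> u < n \<Longrightarrow> adj E' v u \<longleftrightarrow> u = 0"
  shows "graph_iso n E E'"
proof -
  let ?k = "length xs"
  have k: "0 < ?k" "?k \<le> n" using xs card_mono[of "{0..<n}" "set xs"] by (auto simp: distinct_card)
  \<comment> \<open>The colour of a core vertex is its position; the value \<open>length xs\<close>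
    is the common colour of all pendant vertices.\<close>
  define idx where "idx v = (if v \<in> set xs then (SOME i. i < ?k \<and> xs ! i = v) else ?k)" for v
  have idx: "idx v < ?k \<and> xs ! idx v = v" if "v \<in> set xs" for v
  proof -
    have "\<exists>i. i < ?k \<and> xs ! i = v" using that by (auto simp: in_set_conv_nth)
    from someI_ex[OF this] show ?thesis using that by (simp add: idx_def)
  qed
  have idx_k: "idx v = ?k \<longleftrightarrow> v \<notin> set xs" for v
    using idx[of v] by (cases "v \<in> set xs") (force, simp add: idx_def)
  have idx_nth: "idx (xs ! i) = i" if "i < ?k" for i
    using idx[of "xs ! i"] that nth_eq_iff_index_eq[OF xs(1)] by (metis nth_mem)
  define R where "R i j \<longleftrightarrow> (if i < ?k \<and> j < ?k then adj E' i j else (i = 0 \<and> j = ?k) \<or> (j = 0 \<and> i = ?k))" for i j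
  have x0: "idx u = 0 \<longleftrightarrow> u = xs ! 0" for u
  proof (cases "u \<in> set xs")
    case True
    then show ?thesis using idx[OF True] idx_nth[of 0] k by auto
  next
    case False
    moreover have "xs ! 0 \<in> set xs" using k by simp
    ultimately show ?thesis using k by (auto simp: idx_def)
  qed
  show ?thesis
  proof (rule graph_iso_colouring[of n E R idx E' "\<lambda>i. min i ?k"])
    fix i j assume ij: "i < n" "j < n"
    show "adj E i j \<longleftrightarrow> R (idx i) (idx j)"
    proof (cases "i \<in> set xs")
      case i: True
      show ?thesis
      proof (cases "j \<in> set xs")
        case True
        then show ?thesis using core[of "idx i" "idx j"] idx[OF i] idx[OF True] by (simp add: R_def)
      next
        case False
        then have "adj E i j \<longleftrightarrow> i = xs ! 0" using E[OF ij(2) False ij(1)] by (simp add: adj_commute)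
        then show ?thesis using False idx[OF i] x0[of i] k by (auto simp: R_def idx_def[of j])
      qed
    next
      case False
      then have "adj E i j \<longleftrightarrow> j = xs ! 0" using E[OF ij(1) False ij(2)] by simp
      then show ?thesis using False x0[of j] k by (auto simp: R_def idx_def[of i])
    qed
    show "adj E' i j \<longleftrightarrow> R (min i ?k) (min j ?k)"
    proof (cases "i < ?k \<and> j < ?k")
      case True
      then show ?thesis by (simp add: R_def)
    next
      case False
      then consider "?k \<le> i" | "i < ?k" "?k \<le> j" by linarith
      then show ?thesis
      proof cases
        case 1
        then show ?thesis using E'[OF 1 ij] k by (auto simp: R_def min_def)
      next
        case 2
        then have "adj E' i j \<longleftrightarrow> i = 0" using E'[OF 2(2) ij(2,1)] by (simp add: adj_commute)
        then show ?thesis using 2 k by (auto simp: R_def min_def)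
      qed
    qed
  next
    fix c
    consider "c < ?k" | "c = ?k" | "c > ?k" by linarith
    then show "card {i \<in> {0..<n}. idx i = c} = card {i \<in> {0..<n}. min i ?k = c}"
    proof cases
      case 1
      have "xs ! c \<in> set xs" using 1 by simp
      then have "{i \<in> {0..<n}. idx i = c} = {xs ! c}"
        using 1 idx idx_nth xs(3) by (auto simp: idx_def split: if_splits)
      moreover have "{i \<in> {0..<n}. min i ?k = c} = {c}" using 1 k by (auto simp: min_def)
      ultimately show ?thesis by simp
    next
      case 2
      have "{i \<in> {0..<n}. idx i = c} = {0..<n} - set xs"
        unfolding 2 idx_k by auto
      moreover have "card ({0..<n} - set xs) = n - ?k" using xs by (simp add: card_Diff_subset distinct_card)
      moreover have "{i \<in> {0..<n}. min i ?k = c} = {?k..<n}" using 2 by (auto simp: min_def)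
      ultimately show ?thesis by simp
    next
      case 3
      have "idx i \<noteq> c" for i using 3 idx[of i] by (cases "i \<in> set xs") (auto simp: idx_def[of i])
      moreover have "min i ?k \<noteq> c" for i using 3 by (auto simp: min_def)
      ultimately show ?thesis by simp
    qed
  qed
qed

definition star_tri :: "nat \<Rightarrow> nat set set" where
  "star_tri n = {{0,1},{1,2},{1,3},{2,3}} \<union> {{0,k} | k. 4 \<le> k \<and> k < n}"

lemma adj_star_tri:
  "adj (star_tri n) i j \<longleftrightarrow> (i = 0 \<and> j = 1) \<or> (i = 1 \<and> j = 0) \<or> (i = 1 \<and> j = 2) \<or> (i = 2 \<and> j = 1)
    \<or> (i = 1 \<and> j = 3) \<or> (i = 3 \<and> j = 1) \<or> (i = 2 \<and> j = 3) \<or> (i = 3 \<and> j = 2)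
    \<or> (i = 0 \<and> 4 \<le> j \<and> j < n) \<or> (j = 0 \<and> 4 \<le> i \<and> i < n)"
  unfolding adj_def star_tri_def by (auto simp: doubleton_eq_iff)

lemma star_tri_shape_iso:
  assumes "star_tri_shape n E y c z q"
  shows "graph_iso n E (star_tri n)"
proof (rule graph_iso_core[of "[y, c, z, q]"])
  have d: "y \<noteq> c" "y \<noteq> z" "y \<noteq> q" "c \<noteq> z" "c \<noteq> q" "z \<noteq> q" "y < n" "c < n" "z < n" "q < n"
    and E: "\<And>i j. i < n \<Longrightarrow> j < n \<Longrightarrow> adj E i j \<longleftrightarrow> {i, j} = {y, c} \<or> {i, j} = {c, z} \<or> {i, j} = {c, q} \<or> {i, j} = {z, q}
      \<or> (i = y \<and> j \<notin> {y, c, z, q}) \<or> (j = y \<and> i \<notin> {y, c, z, q})"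
    using assms by (auto simp: star_tri_shape_def)
  show "distinct [y, c, z, q]" "set [y, c, z, q] \<subseteq> {0..<n}" using d by auto
  show "adj E v u \<longleftrightarrow> u = [y, c, z, q] ! 0" if "v < n" "v \<notin> set [y, c, z, q]" "u < n" for v u
    using that by (simp add: E doubleton_eq_iff)
  fix i j assume "i < length [y, c, z, q]" "j < length [y, c, z, q]"
  then have "i \<in> {0, 1, 2, 3}" "j \<in> {0, 1, 2, 3}" by auto
  then show "adj E ([y, c, z, q] ! i) ([y, c, z, q] ! j) \<longleftrightarrow> adj (star_tri n) i j"
    by (elim insertE emptyE) (simp_all add: E d d(1-6)[symmetric] adj_star_tri doubleton_eq_iff)
qed (auto simp: adj_star_tri)

text \<open>Pendant vertices sit at two corners, hence five colours: three corners, the pendant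
  vertices at \<open>u\<close>, those at \<open>x\<close>. The degrees of \<open>x\<close> and
  \<open>u\<close> add up to \<open>n + 1\<close>, so the bound \<open>n - 3\<close> gives
  \<open>b \<ge> 2\<close>, and \<open>deg u \<le> deg x\<close> gives
  \<open>3 + 2 * b \<le> n\<close>.\<close>

lemma tri_shape_iso:
  assumes G: "simple_graph n E" and T: "tri_shape n E x u c" and dle: "deg n E x \<le> n - 3" and n: "n \<ge> 7"
  shows "\<exists>b. 2 \<le> b \<and> 3 + 2 * b \<le> n \<and> graph_iso n E (tri n b)"
proof -
  let ?N = "nbrs n E"
  have t: "x \<noteq> u" "x \<noteq> c" "u \<noteq> c" "x < n" "u < n" "c < n" "adj E x u" "?N x \<inter> ?N u = {c}"
    "?N x \<union> ?N u = {0..<n}" "rest E x u = {}" "deg n E u \<le> deg n E x"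
    using T by (auto simp: tri_shape_def)
  have mN: "j \<in> ?N i \<longleftrightarrow> adj E i j" for i j by (rule mem_nbrs[OF G])
  have sum: "deg n E x + deg n E u = n + 1"
    using card_Un_Int[of "?N x" "?N u"] t by (simp add: deg_eq_card_nbrs)
  define b where "b = deg n E u - 2"
  have b: "2 \<le> b" "3 + 2 * b \<le> n" "deg n E u = b + 2" "deg n E x = n - 1 - b"
    using sum dle n t(11) by (auto simp: b_def)
  define R where "R i j \<longleftrightarrow> (i, j) \<in> {(0,1),(1,0),(0,2),(2,0),(1,2),(2,1),(1,3),(3,1),(0,4),(4,0::nat)}" for i j :: nat
  define clr where "clr i = (if i = x then 0 else if i = u then 1 else if i = c then 2 else if adj E u i then 3 else (4::nat))" for i
  define clr' where "clr' i = (if i < 3 then i else if i < 3 + b then 3 else (4::nat))" for i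
  have xu: "adj E u x" "adj E x c" "adj E u c" "\<not> adj E x x" "\<not> adj E u u"
  proof -
    have "c \<in> ?N x \<inter> ?N u" using t(8) by blast
    then show "adj E x c" "adj E u c" by (simp_all add: mN)
    show "adj E u x" using t(7) by (simp add: adj_commute)
    show "\<not> adj E x x" "\<not> adj E u u" using simple_graphD(3)[OF G] by blast+
  qed
  have priv: "adj E u i \<longleftrightarrow> \<not> adj E x i" if "i < n" "i \<noteq> c" for i
  proof -
    have "i \<in> ?N x \<union> ?N u" "i \<notin> ?N x \<inter> ?N u" using t(8,9) that by simp_all
    then show ?thesis by (auto simp: mN)
  qed
  have c: "clr i = 0 \<longleftrightarrow> i = x" "clr i = 1 \<longleftrightarrow> i = u" "clr i = 2 \<longleftrightarrow> i = c"
    "clr i = 3 \<longleftrightarrow> i \<notin> {x, u, c} \<and> adj E u i" "clr i = 4 \<longleftrightarrow> i \<notin> {x, u, c} \<and> \<not> adj E u i" "clr i \<le> 4" for i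
    using t by (auto simp: clr_def)
  have c': "clr' i = 0 \<longleftrightarrow> i = 0" "clr' i = 1 \<longleftrightarrow> i = 1" "clr' i = 2 \<longleftrightarrow> i = 2" "clr' i = 3 \<longleftrightarrow> 3 \<le> i \<and> i < 3 + b"
    "clr' i = 4 \<longleftrightarrow> 3 + b \<le> i" "clr' i \<le> 4" for i
    by (auto simp: clr'_def)
  have v: "clr x = 0" "clr u = 1" using t by (simp_all add: c c(2)[unfolded One_nat_def])
  have none: "\<not> adj E i j" if "i \<notin> {x, u}" "j \<notin> {x, u}" for i j
    using t(10) that by (auto simp: rest_def adj_def)
  have "graph_iso n E (tri n b)"
  proof (rule graph_iso_colouring[of n E R clr _ clr'])
    have aux: "adj E i j \<longleftrightarrow> R (clr i) (clr j)" if ij: "i < n" "j < n" "i \<in> {x, u}" for i j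
    proof (cases "i = x")
      case True
      then have "adj E i j \<longleftrightarrow> j = u \<or> j = c \<or> (j \<notin> {x, u, c} \<and> \<not> adj E u j)"
        using xu t priv[OF ij(2)] by auto
      then show ?thesis by (simp add: True v R_def c c(2)[unfolded One_nat_def])
    next
      case False
      then have "i = u" using ij by simp
      then have "adj E i j \<longleftrightarrow> j = x \<or> j = c \<or> (j \<notin> {x, u, c} \<and> adj E u j)"
        using xu t by auto
      then show ?thesis by (simp add: \<open>i = u\<close> v R_def c c(2)[unfolded One_nat_def])
    qed
    show "adj E i j \<longleftrightarrow> R (clr i) (clr j)" if ij: "i < n" "j < n" for i j
    proof -
      consider "i \<in> {x, u}" | "j \<in> {x, u}" | "i \<notin> {x, u}" "j \<notin> {x, u}" by blast
      then show ?thesis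
      proof cases
        case 1 then show ?thesis using aux ij by blast
      next
        case 2
        then have "adj E j i \<longleftrightarrow> R (clr j) (clr i)" using aux[OF ij(2,1)] by blast
        moreover have "R (clr j) (clr i) \<longleftrightarrow> R (clr i) (clr j)" unfolding R_def by (simp, blast)
        ultimately show ?thesis by (simp add: adj_commute)
      next
        case 3 then show ?thesis using none[OF 3] by (simp add: R_def c c(2)[unfolded One_nat_def])
      qed
    qed
    show "adj (tri n b) i j \<longleftrightarrow> R (clr' i) (clr' j)" if "i < n" "j < n" for i j
      using that by (simp add: adj_tri R_def c' c'(2)[unfolded One_nat_def]) argo
    have c3: "card {i \<in> {0..<n}. clr i = 3} = b"
    proof -
      have "{i \<in> {0..<n}. clr i = 3} = ?N u - {x, c}" using xu by (auto simp: c nbrs_def)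
      moreover have "card (?N u - {x, c}) = b"
        using xu t b(3) by (subst card_Diff_subset) (auto simp: mN deg_eq_card_nbrs)
      ultimately show ?thesis by simp
    qed
    have c4: "card {i \<in> {0..<n}. clr i = 4} = n - (3 + b)"
    proof -
      have "{i \<in> {0..<n}. clr i = 4} = ?N x - {u, c}" using xu t priv by (auto simp: c nbrs_def)
      moreover have "card (?N x - {u, c}) = n - (3 + b)"
        using xu t b by (subst card_Diff_subset) (auto simp: mN deg_eq_card_nbrs)
      ultimately show ?thesis by simp
    qed
    show "card {i \<in> {0..<n}. clr i = k} = card {i \<in> {0..<n}. clr' i = k}" for k
    proof -
      consider "k = 0" | "k = 1" | "k = 2" | "k = 3" | "k = 4" | "k > 4" by linarith
      then show ?thesis
      proof cases
        case 4
        have "{i \<in> {0..<n}. clr' i = 3} = {3..<3 + b}" unfolding c' using b by auto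
        then show ?thesis using c3 4 by simp
      next
        case 5
        have "{i \<in> {0..<n}. clr' i = 4} = {3 + b..<n}" unfolding c' by auto
        then show ?thesis using c4 5 by simp
      next
        case 6
        have "\<And>i. clr i \<noteq> k" "\<And>i. clr' i \<noteq> k" using 6 c(6) c'(6) by (metis not_le)+
        then show ?thesis by simp
      qed (use t n in \<open>simp_all add: c c' c(2)[unfolded One_nat_def] c'(2)[unfolded One_nat_def] Collect_conv_if2 conj_commute[of "_ \<in> _"] cong: conj_cong\<close>)
    qed
  qed
  then show ?thesis using b by blast
qed

section \<open>Comparing the extremal graphs\<close>

text \<open>After scaling to Euclidean norm 1 both arguments are at most 1, and an exponent of at
  least 2 makes them no larger than their squares.\<close>

lemma pnorm_le_sqrt:
  assumes p: "p \<ge> 2" and a: "a > 0" and b: "b > 0"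
  shows "pnorm p a b \<le> sqrt (a\<^sup>2 + b\<^sup>2)"
proof -
  define N where "N = sqrt (a\<^sup>2 + b\<^sup>2)"
  have N: "N > 0" "N\<^sup>2 = a\<^sup>2 + b\<^sup>2" using a b by (auto simp: N_def add_pos_pos)
  have le: "a \<le> N" "b \<le> N" unfolding N_def by (auto intro: real_le_rsqrt)
  have 1: "(c / N) powr p \<le> (c / N)\<^sup>2" if "c > 0" "c \<le> N" for c
  proof -
    have "(c / N) powr p \<le> (c / N) powr 2" using that N p by (intro powr_mono') auto
    then show ?thesis using that N by (simp add: powr_numeral)
  qed
  have "(a / N) powr p + (b / N) powr p \<le> (a / N)\<^sup>2 + (b / N)\<^sup>2"
    using 1[OF a le(1)] 1[OF b le(2)] by linarith
  also have "\<dots> = (a\<^sup>2 + b\<^sup>2) / N\<^sup>2" by (simp add: power_divide add_divide_distrib)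
  also have "\<dots> = 1" using N a by (metis divide_self power_not_zero less_irrefl)
  finally have "a powr p + b powr p \<le> N powr p"
    using N a b by (simp add: powr_divide flip: add_divide_distrib)
  then have "pnorm p a b \<le> (N powr p) powr (1 / p)"
    unfolding pnorm_def using p by (intro powr_mono2) auto
  then show ?thesis using N p by (simp add: powr_powr N_def)
qed

lemma pnorm_sq_le:
  assumes "p \<ge> 2" "a > 0" "b > 0"
  shows "(pnorm p a b)\<^sup>2 \<le> a\<^sup>2 + b\<^sup>2"
  using power_mono[OF pnorm_le_sqrt[OF assms] pnorm_nonneg, of 2] by simp

lemma pnorm_le_of_sq:
  assumes "p \<ge> 2" "a > 0" "b > 0" "a\<^sup>2 + b\<^sup>2 \<le> c\<^sup>2" "c \<ge> 0"
  shows "pnorm p a b \<le> c"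
  using pnorm_sq_le[OF assms(1-3)] assms(4,5) by (meson order_trans power2_le_imp_le)

lemma tri_eqs: "tri n 0 = Sn_e n" "tri n 1 = U1 n" "tri n 2 = U4 n"
proof -
  have im: "{{1::nat, k} | k. 3 \<le> k \<and> k < m} = (\<lambda>k. {1, k}) ` {3..<m}" for m by auto
  have "{3..<3 + 0} = ({} :: nat set)" "{3..<3 + 1} = {3::nat}" "{3..<3 + 2} = {3, 4::nat}" by auto
  then have 1: "{{1::nat, k} | k. 3 \<le> k \<and> k < 3 + 0} = {}" "{{1::nat, k} | k. 3 \<le> k \<and> k < 3 + 1} = {{1, 3}}"
    "{{1::nat, k} | k. 3 \<le> k \<and> k < 3 + 2} = {{1, 3}, {1, 4}}"
    unfolding im by simp_all
  have s: "3 + 0 = (3::nat)" "3 + 1 = (4::nat)" "3 + 2 = (5::nat)" by auto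
  show "tri n 0 = Sn_e n" unfolding tri_def 1 Sn_e_def by simp
  show "tri n 1 = U1 n" unfolding tri_def U1_def 1 unfolding s by (simp add: insert_commute)
  show "tri n 2 = U4 n" unfolding tri_def U4_def 1 unfolding s by (simp add: insert_commute)
qed

lemma connected_via_root:
  assumes "n \<ge> 1" "\<And>i. i < n \<Longrightarrow> (adj E)\<^sup>*\<^sup>* 0 i"
  shows "connected_graph n E"
proof -
  have "(adj E)\<inverse>\<inverse> = adj E" by (auto simp: fun_eq_iff adj_commute)
  then have "(adj E)\<^sup>*\<^sup>* i 0" if "i < n" for i
    using assms(2)[OF that] by (metis rtranclp_conversep conversep_iff)
  then show ?thesis using assms unfolding connected_graph_def by (meson rtranclp_trans)
qed

text \<open>Turns the star bound \<open>d * sqrt d\<close> into the linear bound behind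
  \<open>l > 8\<close> and \<open>l > 10\<close>.\<close>

lemma mult_sqrt_ge:
  fixes d :: real
  assumes "d \<ge> 4"
  shows "2 * d \<le> d * sqrt d"
proof -
  have "sqrt d \<ge> sqrt 4" using assms by (intro real_sqrt_le_mono)
  then show ?thesis using mult_left_mono[of 2 "sqrt d" d] assms by simp
qed

lemma split_five: "n \<ge> 5 \<Longrightarrow> (\<Sum>i<n. g i) = g 0 + g 1 + g 2 + g 3 + g 4 + (\<Sum>i\<in>{5..<n}. g i)" for g :: "nat \<Rightarrow> real"
proof -
  assume "n \<ge> 5"
  then have "{..<n} = {0, 1, 2, 3, 4} \<union> {5..<n}" by auto
  then have "(\<Sum>i<n. g i) = (\<Sum>i\<in>{0, 1, 2, 3, 4}. g i) + (\<Sum>i\<in>{5..<n}. g i)"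
    by (simp only:) (rule sum.union_disjoint, auto)
  then show ?thesis by simp
qed

lemma row_pendants:
  assumes x: "perron p n E x" and d: "\<And>k. k \<in> {m..<n} \<Longrightarrow> deg n E k = 1 \<and> nbrs n E k = {0}"
    and l: "l = sombor_rho p n E" "l > 0" and k: "k \<in> {m..<n}"
  shows "x k = pnorm p (deg n E 0) 1 * x 0 / l"
proof -
  have "l * x k = pnorm p 1 (deg n E 0) * x 0"
    using perron_eq[OF x, of k] k d[OF k] l(1) by simp
  then show ?thesis using l(2) by (simp add: field_simps pnorm_commute)
qed

section \<open>The star with a triangle at a leaf\<close>

context
  fixes n :: nat
  assumes n: "n \<ge> 7"
begin

lemma nbrs_star_tri:
  "nbrs n (star_tri n) 0 = {1} \<union> {4..<n}" "nbrs n (star_tri n) 1 = {0, 2, 3}" "nbrs n (star_tri n) 2 = {1, 3}"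
  "nbrs n (star_tri n) 3 = {1, 2}" "k \<in> {4..<n} \<Longrightarrow> nbrs n (star_tri n) k = {0}"
  using n by (auto simp: nbrs_def adj_star_tri)

lemma deg_star_tri:
  "deg n (star_tri n) 0 = n - 3" "deg n (star_tri n) (Suc 0) = 3" "deg n (star_tri n) 2 = 2" "deg n (star_tri n) 3 = 2"
  "k \<in> {4..<n} \<Longrightarrow> deg n (star_tri n) k = 1"
  using n nbrs_star_tri(2) by (simp_all add: deg_eq_card_nbrs nbrs_star_tri)

lemma simple_star_tri: "simple_graph n (star_tri n)"
  using n by (auto simp: simple_graph_def star_tri_def)

lemma connected_star_tri: "connected_graph n (star_tri n)"
proof (rule connected_via_root)
  fix i assume "i < n"
  have 1: "adj (star_tri n) 0 1" "adj (star_tri n) 1 2" "adj (star_tri n) 1 3" by (auto simp: adj_star_tri)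
  consider "i = 0" | "i = 1" | "i = 2" | "i = 3" | "adj (star_tri n) 0 i" using \<open>i < n\<close> by (force simp: adj_star_tri)
  then show "(adj (star_tri n))\<^sup>*\<^sup>* 0 i"
    by cases (use 1 in \<open>auto intro: rtranclp.rtrancl_into_rtrancl r_into_rtranclp\<close>)
qed (use n in simp)

lemma qform_star_tri:
  "qform (entry p n (star_tri n)) n x = 2 *
    (pnorm p (n - 3) 3 * x 0 * x 1 + pnorm p 3 2 * x 1 * x 2 + pnorm p 3 2 * x 1 * x 3 + pnorm p 2 2 * x 2 * x 3
    + (\<Sum>k\<in>{4..<n}. pnorm p (n - 3) 1 * x 0 * x k))"
proof -
  let ?D = "{(0,1),(1,2),(1,3),(2,3)} \<union> Pair 0 ` {4..<n}"
  let ?g = "\<lambda>(i, j). pnorm p (deg n (star_tri n) i) (deg n (star_tri n) j) * x i * x j"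
  have E: "star_tri n = (\<lambda>(i, j). {i, j}) ` ?D" unfolding star_tri_def pendant_edges by (simp add: image_Un)
  have "qform (entry p n (star_tri n)) n x = 2 * (\<Sum>z\<in>?D. ?g z)"
    by (rule qform_pairs[OF _ E]) (use n in auto)
  also have "(\<Sum>z\<in>?D. ?g z) = (\<Sum>z\<in>{(0,1),(1,2),(1,3),(2,3)}. ?g z) + (\<Sum>z\<in>Pair 0 ` {4..<n}. ?g z)"
    by (rule sum.union_disjoint) auto
  also have "(\<Sum>z\<in>Pair 0 ` {4..<n}. ?g z) = (\<Sum>k\<in>{4..<n}. pnorm p (n - 3) 1 * x 0 * x k)"
    by (subst sum.reindex) (auto simp: inj_on_def deg_star_tri intro!: sum.cong)
  finally show ?thesis by (simp add: deg_star_tri)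
qed

text \<open>Hub degree is \<open>n - 3\<close> in both graphs, and explicit estimates replace the
  Kelmans argument. The old Perron vector is tested on \<open>U4\<close> after the edge
  \<open>2 3\<close> is traded for \<open>1 4\<close>. The lost edge counts little, since
  \<open>v 2\<close> is small against \<open>v 1\<close> and not much larger than
  \<open>v 4\<close>.\<close>

lemma sombor_rho_star_tri_less:
  assumes p: "p \<ge> 2"
  shows "sombor_rho p n (star_tri n) < sombor_rho p n (U4 n)"
proof -
  obtain v where v: "perron p n (star_tri n) v" using perron_exists[OF simple_star_tri connected_star_tri] by blast
  define l where "l = sombor_rho p n (star_tri n)"
  define d where "d = real (n - 3)"
  have d4: "d \<ge> 4" using n by (simp add: d_def)
  have vp: "v 0 > 0" "v 1 > 0" "v 2 > 0" "v 3 > 0" "v 4 > 0" using perron_pos[OF v] n by auto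
  have "d * sqrt d < l" unfolding d_def l_def
    by (rule sombor_rho_star[OF simple_star_tri]) (use n p deg_star_tri in auto)
  then have l8: "l > 8" using mult_sqrt_ge[OF d4] d4 by linarith
  define F1 F3 g s where "F1 = pnorm p d 1" and "F3 = pnorm p d 3" and "g = pnorm p 3 2" and "s = pnorm p 2 2"
  \<comment> \<open>\<open>3.606\<close> and, for \<open>s\<close>, \<open>2.829\<close> round up
    \<open>sqrt 13\<close> and \<open>sqrt 8\<close>.\<close>
  have g: "g \<le> (3606 / 1000)" "g \<ge> 0" unfolding g_def using pnorm_le_of_sq[of p 3 2 "(3606 / 1000)"] p by (simp_all add: pnorm_nonneg power2_eq_square)
  have s: "s \<le> (2829 / 1000)" "s \<ge> 0" unfolding s_def using pnorm_le_of_sq[of p 2 2 "(2829 / 1000)"] p by (simp_all add: pnorm_nonneg power2_eq_square)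
  \<comment> \<open>From \<open>d \<ge> 4\<close>: \<open>9 \<le> (9/16) d^2\<close>, hence the
    factor \<open>5/4\<close>.\<close>
  have F3: "F3 \<le> (125 / 100) * d"
    unfolding F3_def
  proof (rule pnorm_le_of_sq)
    have "16 \<le> d\<^sup>2" using power_mono[OF d4, of 2] by simp
    then show "d\<^sup>2 + 3\<^sup>2 \<le> ((125 / 100) * d)\<^sup>2" by (simp add: power_mult_distrib power2_eq_square)
  qed (use p d4 in auto)
  have F1: "F1 \<ge> d" unfolding F1_def using pnorm_gt[of p d 1] p d4 by simp
  have leaf: "v k = F1 * v 0 / l" if "k \<in> {4..<n}" for k
    using row_pendants[OF v _ l_def _ that] nbrs_star_tri deg_star_tri l8 by (simp add: F1_def d_def)
  have r1: "l * v 1 = F3 * v 0 + g * v 2 + g * v 3"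
    using perron_eq[OF v, of 1] n nbrs_star_tri(2) by (simp add: deg_star_tri l_def F3_def g_def d_def pnorm_commute[of p 3])
  have r2: "l * v 2 = g * v 1 + s * v 3"
    using perron_eq[OF v, of 2] n by (simp add: nbrs_star_tri deg_star_tri l_def g_def s_def pnorm_commute)
  have r3: "l * v 3 = g * v 1 + s * v 2"
    using perron_eq[OF v, of 3] n by (simp add: nbrs_star_tri deg_star_tri l_def g_def s_def pnorm_commute)
  have "(l + s) * (v 2 - v 3) = 0" using r2 r3 by (simp add: algebra_simps)
  then have v32: "v 3 = v 2" using l8 s by simp
  \<comment> \<open>Row 2 solved for \<open>v 2\<close> with \<open>l > 8\<close>;
    \<open>7/10\<close> rounds up \<open>3.606 / (8 - 2.829)\<close>.\<close>
  have "(8 - (2829 / 1000)) * v 2 \<le> (l - s) * v 2" using l8 s vp by (intro mult_right_mono) auto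
  also have "\<dots> = g * v 1" using r2 v32 by (simp add: algebra_simps)
  also have "\<dots> \<le> (3606 / 1000) * v 1" using g vp by (intro mult_right_mono) auto
  finally have v21: "v 2 \<le> (7 / 10) * v 1" using vp by simp
  have gv: "g * v 2 \<le> (3606 / 1000) * ((7 / 10) * v 1)" using g v21 vp by (intro mult_mono) auto
  \<comment> \<open>The hub bounds \<open>v 1\<close>, hence \<open>v 2\<close>, and the hub is tied
    to the pendant entry by \<open>l * v 4 \<ge> d * v 0\<close>. The resulting \<open>2.37\<close>
    rounds up \<open>5.5863 * 1.25 / 2.95\<close>, where \<open>5.5863\<close> is
    \<open>3.606 + 2.829 * 0.7\<close>.\<close>
  have "8 * v 1 \<le> l * v 1" using l8 vp by (intro mult_right_mono) auto
  also have "\<dots> \<le> (125 / 100) * (d * v 0) + 2 * ((3606 / 1000) * ((7 / 10) * v 1))"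
  proof -
    have "F3 * v 0 \<le> (125 / 100) * (d * v 0)" using mult_right_mono[OF F3, of "v 0"] vp by (simp add: mult.assoc)
    then show ?thesis using r1 v32 gv by simp
  qed
  finally have v10: "(295 / 100) * v 1 \<le> (125 / 100) * (d * v 0)" using vp(2) by simp
  have "l * v 4 = F1 * v 0" using leaf[of 4] n l8 by simp
  then have l4: "l * v 4 \<ge> d * v 0" using mult_right_mono[OF F1, of "v 0"] vp by simp
  have "l * v 2 \<le> (3606 / 1000) * v 1 + (2829 / 1000) * ((7 / 10) * v 1)"
  proof -
    have "g * v 1 \<le> (3606 / 1000) * v 1" using g vp by (intro mult_right_mono) auto
    moreover have "s * v 2 \<le> (2829 / 1000) * ((7 / 10) * v 1)" using s v21 vp by (intro mult_mono) auto
    ultimately show ?thesis using r2 v32 by simp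
  qed
  also have "\<dots> \<le> (237 / 100) * (d * v 0)" using v10 vp by simp
  also have "\<dots> \<le> l * ((237 / 100) * v 4)" using l4 by simp
  finally have v24: "v 2 \<le> (237 / 100) * v 4" using l8 by simp
  \<comment> \<open>Relabelling for \<open>tri n 2\<close>: the former pendant vertex 4 becomes the
    third corner 2, and the former triangle vertices 2 and 3 become the pendant vertices 3 and 4 of
    corner 1.\<close>
  define y where "y i = (if i = 2 then v 4 else if i = 3 then v 2 else if i = 4 then v 3 else v i)" for i
  have n5: "n \<ge> 5" using n by simp
  have norm: "(\<Sum>i<n. (y i)\<^sup>2) = (\<Sum>i<n. (v i)\<^sup>2)"
    unfolding split_five[OF n5] by (simp add: y_def)
  have nb: "3 + 2 \<le> n" using n by simp
  let ?S = "\<Sum>k\<in>{5..<n}. F1 * v 0 * v k"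
  have q: "qform (entry p n (star_tri n)) n v = 2 * (F3 * v 0 * v 1 + 2 * (g * v 1 * v 2) + s * v 2 * v 2 + F1 * v 0 * v 4 + ?S)"
  proof -
    have "(\<Sum>k\<in>{4..<n}. F1 * v 0 * v k) = F1 * v 0 * v 4 + ?S"
      using n by (subst sum.atLeast_Suc_lessThan) (auto simp: eval_nat_numeral)
    then show ?thesis unfolding qform_star_tri v32
      by (simp add: F1_def F3_def d_def g_def s_def)
  qed
  have q': "qform (entry p n (tri n 2)) n y = 2 * (pnorm p d 4 * v 0 * v 1 + pnorm p d 2 * v 0 * v 4 + pnorm p 4 2 * v 1 * v 4
      + 2 * (pnorm p 4 1 * v 1 * v 2) + ?S)"
  proof -
    have "real (n - 2 - 1) = d" by (simp add: d_def)
    moreover have "(\<Sum>k\<in>{5..<n}. F1 * v 0 * y k) = ?S" by (intro sum.cong) (auto simp: y_def)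
    moreover have "{3..<5::nat} = {3, 4}" by auto
    ultimately show ?thesis unfolding qform_tri[OF nb] by (simp add: y_def F1_def v32)
  qed
  have "F3 * v 0 * v 1 \<le> pnorm p d 4 * v 0 * v 1"
    unfolding F3_def using p d4 vp by (intro mult_right_mono pnorm_mono) auto
  moreover have "F1 * v 0 * v 4 \<le> pnorm p d 2 * v 0 * v 4"
    unfolding F1_def using p d4 vp by (intro mult_right_mono pnorm_mono) auto
  moreover have "4 * v 1 * v 4 \<le> pnorm p 4 2 * v 1 * v 4"
    using pnorm_gt[of p 4 2] p vp by (intro mult_right_mono) auto
  moreover have "4 * v 1 * v 2 \<le> pnorm p 4 1 * v 1 * v 2"
    using pnorm_gt[of p 4 1] p vp by (intro mult_right_mono) auto
  moreover have "g * v 1 * v 2 \<le> (3606 / 1000) * v 1 * v 2" using g vp by (intro mult_right_mono) auto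
  moreover have "s * v 2 * v 2 \<le> (2829 / 1000) * ((7 / 10) * (v 1 * v 2))"
    
  proof -
    have "v 2 * v 2 \<le> (7 / 10) * v 1 * v 2" using v21 vp by (intro mult_right_mono) auto
    then have "s * (v 2 * v 2) \<le> (2829 / 1000) * ((7 / 10) * v 1 * v 2)" using s vp by (intro mult_mono) auto
    then show ?thesis by (simp add: mult.assoc)
  qed
  moreover have "v 1 * v 2 \<le> (237 / 100) * (v 1 * v 4)" using mult_left_mono[OF v24, of "v 1"] vp by simp
  moreover have "v 1 * v 2 > 0" using vp by simp
  ultimately have "qform (entry p n (star_tri n)) n v < qform (entry p n (tri n 2)) n y"
    unfolding q q' by (simp add: mult.assoc)
  then show ?thesis using sombor_rho_less[OF _ v norm] n by (simp add: tri_eqs)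
qed

end

section \<open>The graphs \<open>U2\<close> and \<open>U3\<close>\<close>

lemma adj_U2:
  "adj (U2 n) i j \<longleftrightarrow> (i = 0 \<and> j = 1) \<or> (i = 1 \<and> j = 0) \<or> (i = 0 \<and> j = 2) \<or> (i = 2 \<and> j = 0)
    \<or> (i = 1 \<and> j = 2) \<or> (i = 2 \<and> j = 1) \<or> (i = 0 \<and> j = 3) \<or> (i = 3 \<and> j = 0)
    \<or> (i = 3 \<and> j = 4) \<or> (i = 4 \<and> j = 3) \<or> (i = 0 \<and> 5 \<le> j \<and> j < n) \<or> (j = 0 \<and> 5 \<le> i \<and> i < n)"
  unfolding adj_def U2_def by (auto simp: doubleton_eq_iff)

lemma adj_U3:
  "adj (U3 n) i j \<longleftrightarrow> (i = 0 \<and> j = 1) \<or> (i = 1 \<and> j = 0) \<or> (i = 1 \<and> j = 2) \<or> (i = 2 \<and> j = 1)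
    \<or> (i = 2 \<and> j = 3) \<or> (i = 3 \<and> j = 2) \<or> (i = 0 \<and> j = 3) \<or> (i = 3 \<and> j = 0)
    \<or> (i = 0 \<and> 4 \<le> j \<and> j < n) \<or> (j = 0 \<and> 4 \<le> i \<and> i < n)"
  unfolding adj_def U3_def by (auto simp: doubleton_eq_iff)

context
  fixes n :: nat
  assumes n: "n \<ge> 7"
begin

lemma nbrs_U2:
  "nbrs n (U2 n) 0 = {1, 2, 3} \<union> {5..<n}" "nbrs n (U2 n) 1 = {0, 2}" "nbrs n (U2 n) 2 = {0, 1}"
  "nbrs n (U2 n) 3 = {0, 4}" "nbrs n (U2 n) 4 = {3}" "k \<in> {5..<n} \<Longrightarrow> nbrs n (U2 n) k = {0}"
  using n by (auto simp: nbrs_def adj_U2)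

lemma deg_U2:
  "deg n (U2 n) 0 = n - 2" "deg n (U2 n) (Suc 0) = 2" "deg n (U2 n) 2 = 2" "deg n (U2 n) 3 = 2"
  "deg n (U2 n) 4 = 1" "k \<in> {5..<n} \<Longrightarrow> deg n (U2 n) k = 1"
proof -
  have "card ({1, 2, 3} \<union> {5..<n}) = 3 + (n - 5)" by (subst card_Un_disjoint) auto
  then show "deg n (U2 n) 0 = n - 2" using n by (simp add: deg_eq_card_nbrs nbrs_U2)
qed (use nbrs_U2(2) in \<open>simp_all add: deg_eq_card_nbrs nbrs_U2\<close>)

lemma simple_U2: "simple_graph n (U2 n)"
  using n by (auto simp: simple_graph_def U2_def)

lemma connected_U2: "connected_graph n (U2 n)"
proof (rule connected_via_root)
  fix i assume "i < n"
  have 1: "adj (U2 n) 0 1" "adj (U2 n) 0 2" "adj (U2 n) 0 3" "adj (U2 n) 3 4" by (auto simp: adj_U2)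
  consider "i = 0" | "i = 1" | "i = 2" | "i = 3" | "i = 4" | "adj (U2 n) 0 i" using \<open>i < n\<close> by (force simp: adj_U2)
  then show "(adj (U2 n))\<^sup>*\<^sup>* 0 i"
    by cases (use 1 in \<open>auto intro: rtranclp.rtrancl_into_rtrancl r_into_rtranclp\<close>)
qed (use n in simp)

lemma nbrs_U3:
  "nbrs n (U3 n) 0 = {1, 3} \<union> {4..<n}" "nbrs n (U3 n) 1 = {0, 2}" "nbrs n (U3 n) 2 = {1, 3}"
  "nbrs n (U3 n) 3 = {0, 2}" "k \<in> {4..<n} \<Longrightarrow> nbrs n (U3 n) k = {0}"
  using n by (auto simp: nbrs_def adj_U3)

lemma deg_U3:
  "deg n (U3 n) 0 = n - 2" "deg n (U3 n) (Suc 0) = 2" "deg n (U3 n) 2 = 2" "deg n (U3 n) 3 = 2"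
  "k \<in> {4..<n} \<Longrightarrow> deg n (U3 n) k = 1"
proof -
  have "card ({1, 3} \<union> {4..<n}) = 2 + (n - 4)" by (subst card_Un_disjoint) auto
  then show "deg n (U3 n) 0 = n - 2" using n by (simp add: deg_eq_card_nbrs nbrs_U3)
qed (use nbrs_U3(2) in \<open>simp_all add: deg_eq_card_nbrs nbrs_U3\<close>)

lemma simple_U3: "simple_graph n (U3 n)"
  using n by (auto simp: simple_graph_def U3_def)

lemma connected_U3: "connected_graph n (U3 n)"
proof (rule connected_via_root)
  fix i assume "i < n"
  have 1: "adj (U3 n) 0 1" "adj (U3 n) 1 2" "adj (U3 n) 0 3" by (auto simp: adj_U3)
  consider "i = 0" | "i = 1" | "i = 2" | "i = 3" | "adj (U3 n) 0 i" using \<open>i < n\<close> by (force simp: adj_U3)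
  then show "(adj (U3 n))\<^sup>*\<^sup>* 0 i"
    by cases (use 1 in \<open>auto intro: rtranclp.rtrancl_into_rtrancl r_into_rtranclp\<close>)
qed (use n in simp)

lemma qform_U2:
  "qform (entry p n (U2 n)) n x = 2 *
    (pnorm p (n - 2) 2 * x 0 * x 1 + pnorm p (n - 2) 2 * x 0 * x 2 + pnorm p 2 2 * x 1 * x 2
    + pnorm p (n - 2) 2 * x 0 * x 3 + pnorm p 2 1 * x 3 * x 4 + (\<Sum>k\<in>{5..<n}. pnorm p (n - 2) 1 * x 0 * x k))"
proof -
  let ?D = "{(0,1),(0,2),(1,2),(0,3),(3,4)} \<union> Pair 0 ` {5..<n}"
  let ?g = "\<lambda>(i, j). pnorm p (deg n (U2 n) i) (deg n (U2 n) j) * x i * x j"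
  have E: "U2 n = (\<lambda>(i, j). {i, j}) ` ?D" unfolding U2_def pendant_edges by (simp add: image_Un)
  have "qform (entry p n (U2 n)) n x = 2 * (\<Sum>z\<in>?D. ?g z)"
    by (rule qform_pairs[OF _ E]) (use n in auto)
  also have "(\<Sum>z\<in>?D. ?g z) = (\<Sum>z\<in>{(0,1),(0,2),(1,2),(0,3),(3,4)}. ?g z) + (\<Sum>z\<in>Pair 0 ` {5..<n}. ?g z)"
    by (rule sum.union_disjoint) auto
  also have "(\<Sum>z\<in>Pair 0 ` {5..<n}. ?g z) = (\<Sum>k\<in>{5..<n}. pnorm p (n - 2) 1 * x 0 * x k)"
    by (subst sum.reindex) (auto simp: inj_on_def deg_U2 intro!: sum.cong)
  finally show ?thesis by (simp add: deg_U2)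
qed

text \<open>The Kelmans transformation from 3 to 1 moves the end vertex 4 and yields
  \<open>U1\<close>. It is carried out in the labels of \<open>tri n 1\<close>, after
  \<open>v 3 \<le> v 1\<close> has been read off the eigenvector equations.\<close>

lemma sombor_rho_U2_less:
  assumes p: "p \<ge> 2"
  shows "sombor_rho p n (U2 n) < sombor_rho p n (U1 n)"
proof -
  obtain v where v: "perron p n (U2 n) v" using perron_exists[OF simple_U2 connected_U2] by blast
  define l where "l = sombor_rho p n (U2 n)"
  define d where "d = real (n - 2)"
  have d5: "d \<ge> 5" using n by (simp add: d_def)
  have vp: "v 0 > 0" "v 1 > 0" "v 2 > 0" "v 3 > 0" "v 4 > 0" using perron_pos[OF v] n by auto
  have "d * sqrt d < l" unfolding d_def l_def
    by (rule sombor_rho_star[OF simple_U2]) (use n p deg_U2 in auto)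
  moreover have "2 * d \<le> d * sqrt d" by (rule mult_sqrt_ge) (use d5 in simp)
  ultimately have l10: "l > 10" using d5 by linarith
  define F1 F2 s e where "F1 = pnorm p d 1" and "F2 = pnorm p d 2" and "s = pnorm p 2 2" and "e = pnorm p 2 1"
  have s: "s \<le> 3" "s \<ge> 0" unfolding s_def using pnorm_le_of_sq[of p 2 2 3] p by (simp_all add: pnorm_nonneg)
  have e: "e \<le> s" "e > 0" unfolding e_def s_def using p by (auto intro!: pnorm_mono pnorm_pos)
  have r1: "l * v 1 = F2 * v 0 + s * v 2"
    using perron_eq[OF v, of 1] n nbrs_U2(2) by (simp add: deg_U2 l_def F2_def s_def d_def pnorm_commute)
  have r2: "l * v 2 = F2 * v 0 + s * v 1"
    using perron_eq[OF v, of 2] n by (simp add: nbrs_U2 deg_U2 l_def F2_def s_def d_def pnorm_commute)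
  have r3: "l * v 3 = F2 * v 0 + e * v 4"
    using perron_eq[OF v, of 3] n by (simp add: nbrs_U2 deg_U2 l_def F2_def e_def d_def pnorm_commute)
  have r4: "l * v 4 = e * v 3"
    using perron_eq[OF v, of 4] n by (simp add: nbrs_U2 deg_U2 l_def e_def pnorm_commute)
  have "(l + s) * (v 1 - v 2) = 0" using r1 r2 by (simp add: algebra_simps)
  then have v12: "v 2 = v 1" using l10 s by simp
  \<comment> \<open>Besides the hub, corner 1 is fed by the equal entry \<open>v 2\<close> with
    weight \<open>s\<close>, vertex 3 only by the smaller \<open>v 4\<close> with weight
    \<open>e \<le> s\<close>.\<close>
  have v31: "v 3 \<le> v 1"
  proof (rule ccontr)
    assume "\<not> v 3 \<le> v 1"
    then have lt: "v 1 < v 3" by simp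
    have "l * v 4 \<le> l * v 3"
      unfolding r4 using e s l10 vp by (intro mult_right_mono) auto
    then have "v 4 \<le> v 3" using l10 by simp
    then have "e * v 4 \<le> s * v 3" using e vp by (intro mult_mono) auto
    then have "(l - s) * v 3 \<le> (l - s) * v 1" using r1 r3 v12 by (simp add: algebra_simps)
    then show False using lt s l10 by simp
  qed
  \<comment> \<open>Labels 3 and 4 are exchanged: in \<open>tri n 1\<close>, vertex 3 is pendant at
    corner 1 and vertex 4 at corner 0.\<close>
  define y where "y i = (if i = 3 then v 4 else if i = 4 then v 3 else v i)" for i
  have n5: "n \<ge> 5" using n by simp
  have norm: "(\<Sum>i<n. (y i)\<^sup>2) = (\<Sum>i<n. (v i)\<^sup>2)"
    unfolding split_five[OF n5] by (simp add: y_def)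
  have nb: "3 + 1 \<le> n" using n by simp
  let ?S = "\<Sum>k\<in>{5..<n}. F1 * v 0 * v k"
  have q: "qform (entry p n (U2 n)) n v = 2 * (F2 * v 0 * v 1 + F2 * v 0 * v 2 + s * v 1 * v 2 + F2 * v 0 * v 3 + e * v 3 * v 4 + ?S)"
    unfolding qform_U2 by (simp add: F1_def F2_def d_def s_def e_def)
  have q': "qform (entry p n (tri n 1)) n y = 2 * (pnorm p d 3 * v 0 * v 1 + F2 * v 0 * v 2 + pnorm p 3 2 * v 1 * v 2
      + pnorm p 3 1 * v 1 * v 4 + (F1 * v 0 * v 3 + ?S))"
  proof -
    have "real (n - 1 - 1) = d" by (simp add: d_def)
    moreover have "(\<Sum>k\<in>{4..<n}. F1 * v 0 * y k) = F1 * v 0 * y 4 + (\<Sum>k\<in>{5..<n}. F1 * v 0 * y k)"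
      using n by (subst sum.atLeast_Suc_lessThan) (auto simp: eval_nat_numeral)
    moreover have "(\<Sum>k\<in>{5..<n}. F1 * v 0 * y k) = ?S" by (intro sum.cong) (auto simp: y_def)
    moreover have "{3..<4::nat} = {3}" by auto
    ultimately show ?thesis unfolding qform_tri[OF nb] by (simp add: y_def F1_def F2_def)
  qed
  have c1: "F2 - F1 \<le> pnorm p d 3 - F2"
    using pnorm_transfer_fixed[of p d 1 2 2] p d5 by (simp add: F1_def F2_def)
  have c2: "0 \<le> pnorm p d 3 - F2" unfolding F2_def using p d5 by (auto intro!: pnorm_mono)
  have "(F2 - F1) * v 3 \<le> (pnorm p d 3 - F2) * v 1"
    using mult_right_mono[OF c1, of "v 3"] mult_left_mono[OF v31 c2] vp by linarith
  then have i1: "(F2 - F1) * v 3 * v 0 \<le> (pnorm p d 3 - F2) * v 1 * v 0" using vp by (intro mult_right_mono) auto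
  have i2: "s * v 1 * v 2 \<le> pnorm p 3 2 * v 1 * v 2"
    unfolding s_def using p vp by (intro mult_right_mono pnorm_mono) auto
  have "e < pnorm p 3 1" unfolding e_def using p by (intro pnorm_strict_mono) auto
  then have "e * v 3 < pnorm p 3 1 * v 1" using e v31 vp by (intro mult_less_le_imp_less) auto
  then have i3: "e * v 3 * v 4 < pnorm p 3 1 * v 1 * v 4" using vp by (intro mult_strict_right_mono) auto
  have "qform (entry p n (U2 n)) n v < qform (entry p n (tri n 1)) n y"
    unfolding q q' using i1 i2 i3 by (simp add: algebra_simps)
  then show ?thesis using sombor_rho_less[OF _ v norm] n tri_eqs(2) by simp
qed

text \<open>Symmetry identifies the entries at 1 and 3; with vertex 2 and the pendant vertices
  eliminated, a 2 by 2 system for the hub and its cycle neighbours is left.\<close>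

lemma perron_U3:
  assumes p: "p \<ge> 2"
  obtains v where "v 0 > 0" "v (1::nat) > 0"
    "sombor_rho p n (U3 n) > real (n - 2) * sqrt (real (n - 2))"
    "sombor_rho p n (U3 n) * v 1 = pnorm p (n - 2) 2 * v 0 + 2 * (pnorm p 2 2)\<^sup>2 * v 1 / sombor_rho p n (U3 n)"
    "sombor_rho p n (U3 n) * v 0 = 2 * pnorm p (n - 2) 2 * v 1 + real (n - 4) * (pnorm p (n - 2) 1)\<^sup>2 * v 0 / sombor_rho p n (U3 n)"
proof -
  obtain v where v: "perron p n (U3 n) v" using perron_exists[OF simple_U3 connected_U3] by blast
  define l where "l = sombor_rho p n (U3 n)"
  define d where "d = real (n - 2)"
  have d5: "d \<ge> 5" using n by (simp add: d_def)
  have vp: "v 0 > 0" "v 1 > 0" "v 2 > 0" "v 3 > 0" using perron_pos[OF v] n by auto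
  have ld: "d * sqrt d < l" unfolding d_def l_def
    by (rule sombor_rho_star[OF simple_U3]) (use n p deg_U3 in auto)
  moreover have "2 * d \<le> d * sqrt d" by (rule mult_sqrt_ge) (use d5 in simp)
  ultimately have l10: "l > 10" using d5 by linarith
  define F1 F2 s where "F1 = pnorm p d 1" and "F2 = pnorm p d 2" and "s = pnorm p 2 2"
  have r1: "l * v 1 = F2 * v 0 + s * v 2"
    using perron_eq[OF v, of 1] n nbrs_U3(2) by (simp add: deg_U3 l_def F2_def s_def d_def pnorm_commute)
  have r3: "l * v 3 = F2 * v 0 + s * v 2"
    using perron_eq[OF v, of 3] n by (simp add: nbrs_U3 deg_U3 l_def F2_def s_def d_def pnorm_commute)
  have r2: "l * v 2 = s * v 1 + s * v 3"
    using perron_eq[OF v, of 2] n by (simp add: nbrs_U3 deg_U3 l_def s_def)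
  have v31: "v 3 = v 1" using r1 r3 l10 by (metis mult_cancel_left not_less_iff_gr_or_eq order_less_trans zero_less_numeral)
  have v2: "v 2 = 2 * s * v 1 / l" using r2 v31 l10 by (simp add: field_simps)
  have leaf: "v k = F1 * v 0 / l" if "k \<in> {4..<n}" for k
    using row_pendants[OF v _ l_def _ that] nbrs_U3 deg_U3 l10 by (simp add: F1_def d_def)
  have "l * v 0 = (\<Sum>j\<in>{1, 3} \<union> {4..<n}. pnorm p d (deg n (U3 n) j) * v j)"
    using perron_eq[OF v, of 0] n nbrs_U3(1) by (simp add: deg_U3 l_def d_def)
  also have "\<dots> = (\<Sum>j\<in>{1, 3}. pnorm p d (deg n (U3 n) j) * v j) + (\<Sum>j\<in>{4..<n}. pnorm p d (deg n (U3 n) j) * v j)"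
    by (rule sum.union_disjoint) auto
  also have "(\<Sum>j\<in>{4..<n}. pnorm p d (deg n (U3 n) j) * v j) = (\<Sum>j\<in>{4..<n}. F1 * (F1 * v 0 / l))"
    by (intro sum.cong refl) (simp add: deg_U3 leaf F1_def)
  finally have r0: "l * v 0 = 2 * F2 * v 1 + real (n - 4) * F1\<^sup>2 * v 0 / l"
    by (simp add: deg_U3 F2_def v31 power2_eq_square)
  show thesis
    by (rule that[of v]) (use vp ld r1 v2 r0 in \<open>simp_all add: F1_def F2_def s_def d_def l_def power2_eq_square mult_ac\<close>)
qed

text \<open>The test vector on \<open>U2\<close> solves every eigenvector equation of \<open>U2\<close> for the eigenvalue \<open>\<rho>(U3)\<close> except the one at the root.\<close>

lemma sombor_rho_U3_less:
  assumes p: "p \<ge> 2"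
  shows "sombor_rho p n (U3 n) < sombor_rho p n (U2 n)"
proof -
  define l where "l = sombor_rho p n (U3 n)"
  define d where "d = real (n - 2)"
  define F1 F2 s e where "F1 = pnorm p d 1" and "F2 = pnorm p d 2" and "s = pnorm p 2 2" and "e = pnorm p 2 1"
  obtain v where v: "v 0 > 0" "v (1::nat) > 0" "l > d * sqrt d"
    "l * v 1 = F2 * v 0 + 2 * s\<^sup>2 * v 1 / l"
    "l * v 0 = 2 * F2 * v 1 + real (n - 4) * F1\<^sup>2 * v 0 / l"
    unfolding l_def d_def F1_def F2_def s_def by (rule perron_U3[OF p])
  have d5: "d \<ge> 5" using n by (simp add: d_def)
  have "2 * d \<le> d * sqrt d" by (rule mult_sqrt_ge) (use d5 in simp)
  then have l10: "l > 10" using v(3) d5 by linarith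
  have s: "s \<le> 3" "s \<ge> 0" unfolding s_def using pnorm_le_of_sq[of p 2 2 3] p by (simp_all add: pnorm_nonneg)
  have e: "e \<le> s" "e > 0" unfolding e_def s_def using p by (auto intro!: pnorm_mono pnorm_pos)
  have F: "F1 > 0" "F1 \<le> F2" unfolding F1_def F2_def using d5 p by (auto intro!: pnorm_pos pnorm_mono)
  \<comment> \<open>\<open>Y\<close> is the common entry of the corners 1 and 2, \<open>w\<close>
    that of vertex 3; each is solved from its own rows of \<open>U2\<close> with hub entry
    \<open>v 0\<close>.\<close>
  define Y where "Y = F2 * v 0 / (l - s)"
  define w where "w = F2 * v 0 * l / (l\<^sup>2 - e\<^sup>2)"
  have le: "l\<^sup>2 - e\<^sup>2 > 0" using e s l10 power_strict_mono[of e l 2] by simp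
  have Yp: "Y > 0" and wp: "w > 0" unfolding Y_def w_def using F v l10 s le by auto
  have Y: "l * Y = F2 * v 0 + s * Y" unfolding Y_def using s l10 by (simp add: field_simps)
  have w: "l * w = F2 * v 0 + e * (e * w / l)"
  proof -
    have "(l\<^sup>2 - e\<^sup>2) * w = F2 * v 0 * l" unfolding w_def using le by simp
    then show ?thesis using l10 by (simp add: field_simps power2_eq_square)
  qed
  \<comment> \<open>In \<open>U3\<close> a cycle neighbour gets \<open>2 s^2 / l\<close> of itself
    back through vertex 2, in the triangle of \<open>U2\<close> a corner gets \<open>s\<close>; and
    \<open>2 s \<le> l\<close>.\<close>
  have Yv: "v 1 \<le> Y"
  proof -
    have "2 * s\<^sup>2 \<le> s * l" using mult_left_mono[of "2 * s" l s] s l10 by (simp add: power2_eq_square mult_ac)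
    then have "2 * s\<^sup>2 * v 1 / l \<le> s * v 1" using v(2) l10 by (simp add: divide_le_eq mult_right_mono mult_ac)
    then have "(l - s) * v 1 \<le> (l - s) * Y" using v(4) Y by (simp add: algebra_simps)
    then show ?thesis using l10 s by simp
  qed
  define u where "u i = (if i = 0 then v 0 else if i = 1 \<or> i = 2 then Y else if i = 3 then w
    else if i = 4 then e * w / l else F1 * v 0 / l)" for i :: nat
  have up: "u i > 0" for i unfolding u_def using v Yp wp e l10 F by auto
  have root: "l * u 0 < (\<Sum>j\<in>nbrs n (U2 n) 0. pnorm p (deg n (U2 n) 0) (deg n (U2 n) j) * u j)"
  proof -
    have "(\<Sum>j\<in>nbrs n (U2 n) 0. pnorm p (deg n (U2 n) 0) (deg n (U2 n) j) * u j)
        = (\<Sum>j\<in>{1, 2, 3}. pnorm p d (deg n (U2 n) j) * u j) + (\<Sum>j\<in>{5..<n}. pnorm p d (deg n (U2 n) j) * u j)"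
      unfolding nbrs_U2 by (subst sum.union_disjoint) (auto simp: deg_U2 d_def)
    also have "(\<Sum>j\<in>{5..<n}. pnorm p d (deg n (U2 n) j) * u j) = (\<Sum>j\<in>{5..<n}. F1 * (F1 * v 0 / l))"
      by (intro sum.cong refl) (simp add: deg_U2 F1_def u_def)
    also have "(\<Sum>j\<in>{1, 2, 3}. pnorm p d (deg n (U2 n) j) * u j) = 2 * F2 * Y + F2 * w"
      by (simp add: deg_U2 F2_def u_def)
    also have "(\<Sum>j\<in>{5..<n}. F1 * (F1 * v 0 / l)) = (real (n - 4) - 1) * (F1\<^sup>2 * v 0 / l)"
      using n by (simp add: power2_eq_square of_nat_diff)
    finally have S: "(\<Sum>j\<in>nbrs n (U2 n) 0. pnorm p (deg n (U2 n) 0) (deg n (U2 n) j) * u j)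
      = 2 * F2 * Y + F2 * w + (real (n - 4) - 1) * (F1\<^sup>2 * v 0 / l)" .
    \<comment> \<open>At the hub the corners 1 and 2 make up for the two cycle neighbours, and
      vertex 3 beats the one pendant vertex that \<open>U3\<close> has in excess.\<close>
    have "F1 * v 0 / l < w"
    proof -
      have "F1 * v 0 \<le> F2 * v 0" using F v by (intro mult_right_mono) auto
      also have "\<dots> < l * w" using w wp e l10 by simp
      finally show ?thesis using l10 by (simp add: divide_less_eq mult_ac)
    qed
    then have "F1 * (F1 * v 0 / l) < F2 * w" using F v l10 by (intro mult_le_less_imp_less) auto
    moreover have "2 * F2 * v 1 \<le> 2 * F2 * Y" using Yv F by simp
    ultimately show ?thesis unfolding S using v(5) by (simp add: u_def power2_eq_square algebra_simps)
  qed
  have "l < sombor_rho p n (U2 n)"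
  proof (rule sombor_rho_greater[OF _ _ _ _ _ root])
    fix i assume "i < n"
    then consider "i = 0" | "i = 1" | "i = 2" | "i = 3" | "i = 4" | "i \<in> {5..<n}" by force
    then show "l * u i \<le> (\<Sum>j\<in>nbrs n (U2 n) i. pnorm p (deg n (U2 n) i) (deg n (U2 n) j) * u j)"
    proof cases
      case 1 then show ?thesis using root by simp
    next
      case 2 then show ?thesis using Y nbrs_U2(2)
        by (simp add: deg_U2 u_def F2_def s_def d_def pnorm_commute)
    next
      case 3 then show ?thesis using Y
        by (simp add: nbrs_U2 deg_U2 u_def F2_def s_def d_def pnorm_commute)
    next
      case 4 then show ?thesis using w
        by (simp add: nbrs_U2 deg_U2 u_def F2_def e_def d_def pnorm_commute)
    next
      case 5 then show ?thesis using l10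
        by (simp add: nbrs_U2 deg_U2 u_def e_def pnorm_commute)
    next
      case 6 then show ?thesis using l10 nbrs_U2(6)[OF 6]
        by (simp add: deg_U2 u_def F1_def d_def pnorm_commute)
    qed
  qed (use n up in \<open>auto simp: less_imp_le\<close>)
  then show ?thesis by (simp add: l_def)
qed

end

section \<open>The graph \<open>U4\<close> against \<open>U3\<close>\<close>

lemma U4_rows:
  assumes n: "n \<ge> 7"
  obtains v where "v 0 > 0" "v (1::nat) > 0" "v (2::nat) > 0"
    "sombor_rho p n (U4 n) > 0"
    "sombor_rho p n (U4 n) * v 0 = pnorm p (real (n - 3)) 4 * v 1 + pnorm p (real (n - 3)) 2 * v 2
      + (real (n - 3) - 2) * (pnorm p (real (n - 3)) 1)\<^sup>2 * v 0 / sombor_rho p n (U4 n)"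
    "sombor_rho p n (U4 n) * v 1 = pnorm p (real (n - 3)) 4 * v 0 + pnorm p 4 2 * v 2
      + 2 * (pnorm p 4 1)\<^sup>2 * v 1 / sombor_rho p n (U4 n)"
    "sombor_rho p n (U4 n) * v 2 = pnorm p (real (n - 3)) 2 * v 0 + pnorm p 4 2 * v 1"
proof -
  have nb: "3 + 2 \<le> n" using n by simp
  obtain v where v: "perron p n (tri n 2) v" using perron_exists[OF simple_tri connected_tri] nb by blast
  have "real (n - 2 - 1) = real (n - 3)" "real (2 + 2) = 4" "real (n - (3 + 2)) = real (n - 3) - 2" using n by auto
  note rows = tri_rows[OF nb v, unfolded this tri_eqs]
  show thesis by (rule that[of v]) (use perron_pos[OF v] n rows in simp_all)
qed

text \<open>The hub of \<open>U3\<close> has degree \<open>d + 1\<close>, so the radius exceeds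
  \<open>(d + 1) * sqrt (d + 1)\<close>. If \<open>U4\<close> reached this value, eliminating all
  entries but the hub's would give \<open>1.2 d^2 + 2 d \<le> 35\<close>. This fails for
  \<open>d \<ge> 5\<close> but holds for \<open>d = 4\<close>, so seven vertices need a separate
  argument.\<close>

lemma sombor_rho_U4_less_large:
  assumes p: "p \<ge> 2" and n8: "n \<ge> 8"
  shows "sombor_rho p n (U4 n) < sombor_rho p n (U3 n)"
proof -
  define l where "l = sombor_rho p n (U4 n)"
  define d where "d = real (n - 3)"
  define a b g h F where "a = pnorm p d 4" and "b = pnorm p d 2" and "g = pnorm p 4 2" and "h = pnorm p 4 1" and "F = pnorm p d 1"
  have n7: "n \<ge> 7" using n8 by simp
  obtain v where v: "v 0 > 0" "v (1::nat) > 0" "v (2::nat) > 0" "l > 0"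
    "l * v 0 = a * v 1 + b * v 2 + (d - 2) * F\<^sup>2 * v 0 / l"
    "l * v 1 = a * v 0 + g * v 2 + 2 * h\<^sup>2 * v 1 / l"
    "l * v 2 = b * v 0 + g * v 1"
    unfolding l_def d_def a_def b_def g_def h_def F_def by (rule U4_rows[OF n7]) blast
  have d5: "d \<ge> 5" using n8 by (simp add: d_def)
  have sq: "a\<^sup>2 \<le> d\<^sup>2 + 16" "b\<^sup>2 \<le> d\<^sup>2 + 4" "g\<^sup>2 \<le> 20" "h\<^sup>2 \<le> 17" "F\<^sup>2 \<le> d\<^sup>2 + 1"
    unfolding a_def b_def g_def h_def F_def
    using pnorm_sq_le[OF p, of d 4] pnorm_sq_le[OF p, of d 2] pnorm_sq_le[OF p, of 4 2] pnorm_sq_le[OF p, of 4 1]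
      pnorm_sq_le[OF p, of d 1] d5 by simp_all
  have g: "g \<le> (44722 / 10000)" "g \<ge> 0"
    unfolding g_def using pnorm_le_of_sq[of p 4 2 "(44722 / 10000)"] p by (simp_all add: pnorm_nonneg power2_eq_square)
  have "l < (d + 1) * sqrt (d + 1)"
  proof (rule ccontr)
    assume "\<not> ?thesis"
    then have lm: "(d + 1) * sqrt (d + 1) \<le> l" by simp
    have l2: "(d + 1) ^ 3 \<le> l\<^sup>2"
    proof -
      have le: "((d + 1) * sqrt (d + 1))\<^sup>2 \<le> l\<^sup>2" using lm d5 by (intro power_mono) auto
      have "((d + 1) * sqrt (d + 1))\<^sup>2 = (d + 1)\<^sup>2 * (sqrt (d + 1))\<^sup>2" by (rule power_mult_distrib)
      also have "(sqrt (d + 1))\<^sup>2 = d + 1" using d5 by simp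
      also have "(d + 1)\<^sup>2 * (d + 1) = (d + 1) ^ 3" by (simp add: power3_eq_cube power2_eq_square)
      finally show ?thesis using le by (rule subst)
    qed
    have "6 ^ 3 \<le> (d + 1) ^ 3" using d5 by (intro power_mono) auto
    \<comment> \<open>\<open>14.5\<close> is just below \<open>sqrt 216\<close>. It makes
      \<open>g + 2 h^2 / l\<close> at most \<open>9/19\<close> of \<open>l\<close>, whence the
      factor \<open>19/10\<close> in the bound by \<open>K\<close>.\<close>
    then have "((145 / 10))\<^sup>2 \<le> l\<^sup>2" using l2 by (simp add: power2_eq_square)
    then have l14: "l \<ge> (145 / 10)" using v(4) by (meson less_imp_le power2_le_imp_le)
    define K where "K = l - g - 2 * h\<^sup>2 / l"
    have "2 * h\<^sup>2 / l \<le> 34 / (145 / 10)" using sq(4) l14 by (intro frac_le) auto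
    then have K: "l \<le> (19 / 10) * K" unfolding K_def using g l14 by simp
    then have K0: "K > 0" using l14 by simp
    \<comment> \<open>The entries at the corners 1 and 2 are treated as one vector: \<open>Q\<close>
      is its squared norm, \<open>s\<close> what it sends to the hub. Cauchy-Schwarz and
      \<open>K * Q \<le> v 0 * s\<close> then bound \<open>s\<close> by the hub entry alone.\<close>
    define Q where "Q = (v 1)\<^sup>2 + (v 2)\<^sup>2"
    define s where "s = a * v 1 + b * v 2"
    have s0: "s > 0" unfolding s_def a_def b_def using v d5 p by (intro add_pos_pos mult_pos_pos pnorm_pos) auto
    have "l * Q = v 1 * (l * v 1) + v 2 * (l * v 2)" by (simp add: Q_def power2_eq_square algebra_simps)
    also have "\<dots> = v 0 * s + 2 * g * (v 1 * v 2) + 2 * h\<^sup>2 / l * (v 1)\<^sup>2"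
      unfolding v(6,7) by (simp add: s_def power2_eq_square algebra_simps)
    also have "\<dots> \<le> v 0 * s + g * Q + 2 * h\<^sup>2 / l * Q"
    proof -
      have "2 * (v 1 * v 2) \<le> Q" unfolding Q_def using sum_squares_bound[of "v 1" "v 2"] by simp
      then have "g * (2 * (v 1 * v 2)) \<le> g * Q" using g by (intro mult_left_mono) auto
      moreover have "2 * h\<^sup>2 / l * (v 1)\<^sup>2 \<le> 2 * h\<^sup>2 / l * Q"
        using v(4) by (intro mult_left_mono) (auto simp: Q_def)
      ultimately show ?thesis by (simp add: algebra_simps)
    qed
    finally have KQ: "K * Q \<le> v 0 * s" by (simp add: K_def algebra_simps)
    have "s\<^sup>2 \<le> (a\<^sup>2 + b\<^sup>2) * Q"
      using zero_le_power2[of "a * v 2 - b * v 1"]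
      unfolding s_def Q_def by (simp add: power2_eq_square algebra_simps)
    then have "K * s\<^sup>2 \<le> (a\<^sup>2 + b\<^sup>2) * (K * Q)" using K0 by (simp add: mult_left_mono mult.left_commute)
    also have "\<dots> \<le> (a\<^sup>2 + b\<^sup>2) * (v 0 * s)" using KQ by (intro mult_left_mono) auto
    finally have "(K * s) * s \<le> ((a\<^sup>2 + b\<^sup>2) * v 0) * s" by (simp add: power2_eq_square mult_ac)
    then have Ks: "K * s \<le> (a\<^sup>2 + b\<^sup>2) * v 0" using s0 by simp
    have "l\<^sup>2 * v 0 = l * s + (d - 2) * F\<^sup>2 * v 0"
      using v(4,5) by (simp add: s_def power2_eq_square field_simps)
    also have "\<dots> \<le> (19 / 10) * (K * s) + (d - 2) * F\<^sup>2 * v 0"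
      using mult_right_mono[OF K, of s] s0 by simp
    also have "\<dots> \<le> (19 / 10) * ((2 * d\<^sup>2 + 20) * v 0) + (d - 2) * (d\<^sup>2 + 1) * v 0"
    proof -
      have "(a\<^sup>2 + b\<^sup>2) * v 0 \<le> (2 * d\<^sup>2 + 20) * v 0" using sq v by (intro mult_right_mono) auto
      moreover have "(d - 2) * F\<^sup>2 * v 0 \<le> (d - 2) * (d\<^sup>2 + 1) * v 0"
        using sq v d5 by (intro mult_right_mono mult_left_mono) auto
      ultimately show ?thesis using Ks by simp
    qed
    finally have "l\<^sup>2 * v 0 \<le> ((19 / 10) * (2 * d\<^sup>2 + 20) + (d - 2) * (d\<^sup>2 + 1)) * v 0" by (simp add: algebra_simps)
    then have "l\<^sup>2 \<le> (19 / 10) * (2 * d\<^sup>2 + 20) + (d - 2) * (d\<^sup>2 + 1)" using v(1) by simp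
    with l2 have "(d + 1) ^ 3 \<le> (19 / 10) * (2 * d\<^sup>2 + 20) + (d - 2) * (d\<^sup>2 + 1)" by simp
    then have "(12 / 10) * d\<^sup>2 + 2 * d \<le> 35" by (simp add: power2_eq_square power3_eq_cube algebra_simps)
    moreover have "d\<^sup>2 \<ge> 25" using power_mono[OF d5, of 2] by simp
    ultimately show False using d5 by simp
  qed
  moreover have "(d + 1) * sqrt (d + 1) < sombor_rho p n (U3 n)"
  proof -
    have r: "real (n - 2) = d + 1" using n8 by (simp add: d_def)
    have "real (n - 2) * sqrt (real (n - 2)) < sombor_rho p n (U3 n)"
      by (rule sombor_rho_star[OF simple_U3[OF n7]]) (use p n8 deg_U3[OF n7] in auto)
    then show ?thesis unfolding r .
  qed
  ultimately show ?thesis by (simp add: l_def)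
qed

section \<open>Seven vertices: \<open>U4\<close> against \<open>U3\<close> in terms of
  \<open>2 / p\<close>\<close>

lemma bernoulli_powr:
  fixes q x :: real
  assumes "0 \<le> q" "q \<le> 1" "x \<ge> 0"
  shows "(1 + x) powr q \<le> 1 + q * x"
  using Youngs_inequality_0[of q "1 - q" "1 + x" 1] assms by (simp add: algebra_simps)

lemma powr_ge_one_plus:
  fixes q w :: real
  assumes "w > 0"
  shows "w powr q \<ge> 1 + q * ln w"
  using exp_ge_add_one_self[of "q * ln w"] assms by (simp add: powr_def)

text \<open>Hoelder's inequality bounds the squared weight from below by its tangent at \<open>p = 2\<close>.\<close>

lemma pnorm_sq_ge_tangent:
  assumes p: "p \<ge> 2" and xy: "x > 0" "y > 0"
  shows "(pnorm p x y)\<^sup>2 \<ge> (x\<^sup>2 + y\<^sup>2)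
    - (1 - 2 / p) * (x\<^sup>2 * ln ((x\<^sup>2 + y\<^sup>2) / x\<^sup>2) + y\<^sup>2 * ln ((x\<^sup>2 + y\<^sup>2) / y\<^sup>2))"
proof -
  define q where "q = 2 / p"
  have q: "0 < q" "q \<le> 1" using p by (auto simp: q_def)
  define X where "X = x powr p + y powr p"
  have X: "X > 0" using xy by (simp add: X_def add_pos_pos)
  define S where "S = x\<^sup>2 + y\<^sup>2"
  have S: "S > 0" using xy by (simp add: S_def add_pos_pos)
  \<comment> \<open>Young's inequality with weights \<open>q\<close> and \<open>1 - q\<close>;
    summed over \<open>x\<close> and \<open>y\<close>, the right-hand side collapses to
    \<open>X powr q\<close>, the squared weight.\<close>
  have hoelder: "z\<^sup>2 * (z\<^sup>2 / S) powr (1 - q) \<le> X powr q * (q * (z powr p / X) + (1 - q) * (z\<^sup>2 / S))"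
    if z: "z > 0" for z
  proof -
    have z2: "z\<^sup>2 = (z powr p) powr q"
      using p z by (simp add: q_def powr_powr powr_numeral)
    have "(z powr p / X) powr q * (z\<^sup>2 / S) powr (1 - q) \<le> q * (z powr p / X) + (1 - q) * (z\<^sup>2 / S)"
      by (rule Youngs_inequality_0) (use q z X S in auto)
    then have "X powr q * ((z powr p / X) powr q * (z\<^sup>2 / S) powr (1 - q))
        \<le> X powr q * (q * (z powr p / X) + (1 - q) * (z\<^sup>2 / S))"
      by (rule mult_left_mono) simp
    moreover have "X powr q * (z powr p / X) powr q = z\<^sup>2"
      unfolding z2 using X z by (simp add: powr_divide)
    ultimately show ?thesis by (simp add: mult.assoc[symmetric])
  qed
  have "x\<^sup>2 * (x\<^sup>2 / S) powr (1 - q) + y\<^sup>2 * (y\<^sup>2 / S) powr (1 - q)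
      \<le> X powr q * (q * (x powr p / X) + (1 - q) * (x\<^sup>2 / S)) + X powr q * (q * (y powr p / X) + (1 - q) * (y\<^sup>2 / S))"
    using hoelder[OF xy(1)] hoelder[OF xy(2)] by linarith
  also have "\<dots> = X powr q * (q * ((x powr p + y powr p) / X) + (1 - q) * ((x\<^sup>2 + y\<^sup>2) / S))"
    by (simp add: algebra_simps add_divide_distrib)
  also have "\<dots> = X powr q" using X S by (simp add: X_def[symmetric] S_def[symmetric])
  also have "\<dots> = (pnorm p x y)\<^sup>2"
    unfolding pnorm_def X_def[symmetric] q_def using X by (simp add: powr_powr flip: powr_numeral)
  finally have *: "x\<^sup>2 * (x\<^sup>2 / S) powr (1 - q) + y\<^sup>2 * (y\<^sup>2 / S) powr (1 - q) \<le> (pnorm p x y)\<^sup>2" .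
  \<comment> \<open>\<open>w powr (1 - q) \<ge> 1 + (1 - q) * ln w\<close> makes the bound linear in
    \<open>1 - q\<close>, which vanishes at \<open>p = 2\<close>.\<close>
  have low: "z\<^sup>2 - (1 - q) * (z\<^sup>2 * ln (S / z\<^sup>2)) \<le> z\<^sup>2 * (z\<^sup>2 / S) powr (1 - q)" if z: "z > 0" for z
  proof -
    have "ln (z\<^sup>2 / S) = - ln (S / z\<^sup>2)" using z S by (simp add: ln_div)
    then have "1 - (1 - q) * ln (S / z\<^sup>2) \<le> (z\<^sup>2 / S) powr (1 - q)"
      using powr_ge_one_plus[of "z\<^sup>2 / S" "1 - q"] z S by simp
    then have "z\<^sup>2 * (1 - (1 - q) * ln (S / z\<^sup>2)) \<le> z\<^sup>2 * (z\<^sup>2 / S) powr (1 - q)"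
      by (rule mult_left_mono) simp
    then show ?thesis by (simp add: algebra_simps)
  qed
  show ?thesis
    using * low[OF xy(1)] low[OF xy(2)] by (simp add: S_def q_def algebra_simps)
qed

lemma pnorm_sq_eq_powr:
  assumes "p > 0" "x > 0" "y > 0"
  shows "(pnorm p x y)\<^sup>2 = x\<^sup>2 * (1 + (y / x) powr p) powr (2 / p)"
proof -
  have "x powr p + y powr p = x powr p * (1 + (y / x) powr p)"
    using assms by (simp add: powr_divide field_simps)
  then have "(pnorm p x y)\<^sup>2 = (x powr p * (1 + (y / x) powr p)) powr (2 / p)"
    unfolding pnorm_def using assms by (simp add: powr_powr flip: powr_numeral)
  also have "\<dots> = (x powr p) powr (2 / p) * (1 + (y / x) powr p) powr (2 / p)"
    by (rule powr_mult)
  also have "(x powr p) powr (2 / p) = x\<^sup>2" using assms by (simp add: powr_powr flip: powr_numeral)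
  finally show ?thesis .
qed

text \<open>The larger argument is factored out. Bernoulli's inequality with exponent
  \<open>2 / p\<close> and \<open>(y / x) powr p \<le> (y / x)^2\<close> leave a bound linear in
  \<open>2 / p\<close>.\<close>

lemma pnorm_sq_le_bernoulli:
  assumes p: "p \<ge> 2" and xy: "0 < y" "y \<le> x"
  shows "(pnorm p x y)\<^sup>2 \<le> x\<^sup>2 + 2 / p * y\<^sup>2"
proof -
  have x: "x > 0" using xy by simp
  have "(1 + (y / x) powr p) powr (2 / p) \<le> 1 + 2 / p * (y / x) powr p"
    using p by (intro bernoulli_powr) auto
  also have "(y / x) powr p \<le> (y / x) powr 2" using xy x p by (intro powr_mono') auto
  then have "1 + 2 / p * (y / x) powr p \<le> 1 + 2 / p * (y / x) powr 2"
    using p by (intro add_left_mono mult_left_mono) auto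
  also have "(y / x) powr 2 = (y / x)\<^sup>2" using xy x by (simp add: powr_numeral)
  finally have "x\<^sup>2 * (1 + (y / x) powr p) powr (2 / p) \<le> x\<^sup>2 * (1 + 2 / p * (y / x)\<^sup>2)"
    by (rule mult_left_mono) simp
  also have "\<dots> = x\<^sup>2 + 2 / p * y\<^sup>2" using x by (simp add: power_divide field_simps)
  finally show ?thesis using pnorm_sq_eq_powr[of p x y] p xy x by simp
qed

text \<open>At \<open>n = 7\<close> the two radii nearly meet as \<open>p\<close> tends to 2, so both are estimated by explicit functions of \<open>q = 2 / p\<close>.\<close>

lemma rho_U4_7_upper:
  assumes p: "p \<ge> 2"
  shows "sombor_rho p 7 (U4 7) \<le> 1025 / 100 + 164 / 100 * (2 / p)"
proof -
  define l where "l = sombor_rho p 7 (U4 7)"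
  define q where "q = 2 / p"
  have q: "0 < q" "q \<le> 1" using p by (auto simp: q_def)
  define a g h where "a = pnorm p 4 4" and "g = pnorm p 4 2" and "h = pnorm p 4 1"
  have n7: "(7::nat) \<le> 7" by simp
  have d: "real (7 - 3) = 4" by simp
  obtain v where v: "v 0 > 0" "v (1::nat) > 0" "v (2::nat) > 0" "l > 0"
    "l * v 0 = a * v 1 + g * v 2 + 2 * h\<^sup>2 * v 0 / l"
    "l * v 1 = a * v 0 + g * v 2 + 2 * h\<^sup>2 * v 1 / l"
    "l * v 2 = g * v 0 + g * v 1"
    using U4_rows[OF n7, of p, unfolded d, folded l_def a_def g_def h_def] by auto
  have "real 4 * sqrt 4 < l"
    using sombor_rho_star[OF simple_tri[of 2 7], of p 0 4] deg_tri[of 2 7] p by (simp add: l_def tri_eqs)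
  then have l8: "l > 8" by simp
  have h2: "h\<^sup>2 \<le> 16 + q" unfolding h_def q_def using pnorm_sq_le_bernoulli[OF p, of 1 4] by simp
  have g2: "g\<^sup>2 \<le> 16 + 4 * q" unfolding g_def q_def using pnorm_sq_le_bernoulli[OF p, of 2 4] by simp
  \<comment> \<open>\<open>a\<close> is 4 times \<open>sqrt 2 powr q\<close>; Bernoulli's inequality
    and \<open>sqrt 2 \<le> 1.4143\<close> give the slope \<open>4 * 0.4143\<close>.\<close>
  have a: "a \<le> 4 + (16572 / 10000) * q"
  proof -
    have "a = (4 powr p * 2) powr (1 / p)" by (simp add: a_def pnorm_def mult.commute)
    also have "\<dots> = (4 powr p) powr (1 / p) * 2 powr (1 / p)" by (rule powr_mult)
    also have "(4 powr p) powr (1 / p) = 4" using p by (simp add: powr_powr)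
    also have "2 powr (1 / p) = (sqrt 2) powr q"
      by (simp add: q_def powr_half_sqrt[symmetric] powr_powr)
    also have "(sqrt 2) powr q \<le> 1 + q * (sqrt 2 - 1)"
      using bernoulli_powr[of q "sqrt 2 - 1"] q by simp
    also have "q * (sqrt 2 - 1) \<le> q * (4143 / 10000)"
    proof -
      have "sqrt 2 \<le> 14143 / 10000" by (rule real_le_lsqrt) (auto simp: power2_eq_square)
      then show ?thesis using q by (intro mult_left_mono) auto
    qed
    finally show ?thesis by simp
  qed
  \<comment> \<open>On seven vertices both loaded corners carry two pendant vertices, so their
    entries agree and a single quadratic equation for \<open>l\<close> remains.\<close>
  have v01: "v 1 = v 0"
  proof -
    have "(v 0 - v 1) * (l + a - 2 * h\<^sup>2 / l) = 0" using v(5,6) by (simp add: algebra_simps diff_divide_distrib)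
    moreover have "2 * h\<^sup>2 / l \<le> 34 / 8" using h2 q l8 by (intro frac_le) auto
    then have "l + a - 2 * h\<^sup>2 / l > 0" using l8 pnorm_nonneg[of p 4 4] by (simp add: a_def)
    ultimately show ?thesis by simp
  qed
  have "l\<^sup>2 * v 0 = (a * l + 2 * g\<^sup>2 + 2 * h\<^sup>2) * v 0"
  proof -
    have "l * (l * v 0) = l * (a * v 0) + g * (l * v 2) + 2 * h\<^sup>2 * v 0"
      using v(5) v(4) v01 by (simp add: field_simps)
    then show ?thesis unfolding v(7) v01 by (simp add: power2_eq_square algebra_simps)
  qed
  then have "l\<^sup>2 = a * l + 2 * g\<^sup>2 + 2 * h\<^sup>2" using v(1) by simp
  also have "\<dots> \<le> (4 + (16572 / 10000) * q) * l + 64 + 10 * q"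
  proof -
    have "a * l \<le> (4 + (16572 / 10000) * q) * l" using a v(4) by (intro mult_right_mono) auto
    then show ?thesis using g2 h2 by linarith
  qed
  finally have quad: "l * (l - (4 + (16572 / 10000) * q)) \<le> 64 + 10 * q"
    by (simp add: power2_eq_square algebra_simps)
  \<comment> \<open>\<open>l * (l - c)\<close> grows with \<open>l\<close>; at
    \<open>10.25 + 1.64 q\<close> it exceeds \<open>64 + 10 q\<close> by little, between
    \<open>0.06\<close> and \<open>0.11\<close>, so the constants lie close to the positive
    root.\<close>
  have "l \<le> 1025 / 100 + 164 / 100 * q"
  proof (rule ccontr)
    let ?m = "1025 / 100 + 164 / 100 * q"
    let ?c = "4 + (16572 / 10000) * q"
    assume "\<not> ?thesis"
    then have lm: "?m < l" by simp
    have "?m * (?m - ?c) < l * (l - ?c)"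
      using lm q by (intro mult_strict_mono) auto
    also have "\<dots> \<le> 64 + 10 * q" by (rule quad)
    finally have "?m * (?m - ?c) < 64 + 10 * q" .
    moreover have "?m * (?m - ?c) = 640625 / 10000 + 100737 / 10000 * q - 28208 / 1000000 * q\<^sup>2"
      by (simp add: power2_eq_square algebra_simps)
    moreover have "q\<^sup>2 \<le> q" using q by (simp add: power2_eq_square mult_left_le_one_le)
    ultimately show False using q by simp
  qed
  then show ?thesis by (simp add: l_def q_def)
qed

text \<open>With \<open>A\<close>, \<open>B\<close>, \<open>C\<close> the squared weights
  themselves, eliminating the two entries gives \<open>(X - 3 A) (X - 2 C) = 2 B X\<close>, that is
  \<open>(X - 3 A - 2 B) (X - 2 C) = 4 B C\<close>; as an inequality it survives when the squared
  weights are replaced by lower bounds. The value 125 is the square of the star bound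
  \<open>5 * sqrt 5\<close>.\<close>

lemma rho_U3_7_lower:
  assumes p: "p \<ge> 2" and A: "A \<le> (pnorm p 5 1)\<^sup>2" and B: "0 \<le> B" "B \<le> (pnorm p 5 2)\<^sup>2"
    and C: "C \<le> (pnorm p 2 2)\<^sup>2"
  defines "X \<equiv> (sombor_rho p 7 (U3 7))\<^sup>2"
  shows "X > 125" and "4 * B * C \<le> (X - 3 * A - 2 * B) * (X - 2 * C)"
proof -
  define l where "l = sombor_rho p 7 (U3 7)"
  have X: "X = l\<^sup>2" by (simp add: X_def l_def)
  have n7: "(7::nat) \<le> 7" by simp
  have d: "real (7 - 2) = 5" "real (7 - 4) = 3" by auto
  obtain v where v: "v 0 > 0" "v (1::nat) > 0" "l > 5 * sqrt 5"
    "l * v 1 = pnorm p 5 2 * v 0 + 2 * (pnorm p 2 2)\<^sup>2 * v 1 / l"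
    "l * v 0 = 2 * pnorm p 5 2 * v 1 + 3 * (pnorm p 5 1)\<^sup>2 * v 0 / l"
    using perron_U3[OF n7 p, unfolded d, folded l_def] by auto
  have l0: "l > 0" using v(3) by (smt (verit) real_sqrt_ge_zero)
  have "(5 * sqrt 5)\<^sup>2 < l\<^sup>2" using v(3) by (intro power_strict_mono) auto
  then show X125: "X > 125" by (simp add: X power_mult_distrib)
  let ?A = "(pnorm p 5 1)\<^sup>2" and ?B = "(pnorm p 5 2)\<^sup>2" and ?C = "(pnorm p 2 2)\<^sup>2"
  have e1: "(X - 2 * ?C) * v 1 = l * pnorm p 5 2 * v 0"
    using v(4) l0 by (simp add: X power2_eq_square field_simps)
  have e0: "(X - 3 * ?A) * v 0 = 2 * pnorm p 5 2 * l * v 1"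
    using v(5) l0 by (simp add: X power2_eq_square field_simps)
  have "((X - 3 * ?A) * (X - 2 * ?C)) * (v 0 * v 1) = ((X - 3 * ?A) * v 0) * ((X - 2 * ?C) * v 1)"
    by (simp add: mult_ac)
  also have "\<dots> = (2 * ?B * X) * (v 0 * v 1)"
    unfolding e0 e1 by (simp add: X power2_eq_square mult_ac)
  finally have eq: "(X - 3 * ?A) * (X - 2 * ?C) = 2 * ?B * X" using v(1,2) by simp
  have C8: "?C \<le> 8" using pnorm_sq_le[OF p, of 2 2] by simp
  have "2 * ?B * X > 0" using pnorm_pos[of 5 p 2] X125 by simp
  then have "(X - 3 * ?A) * (X - 2 * ?C) > 0" using eq by simp
  moreover have "X - 2 * ?C > 0" using X125 C8 by simp
  ultimately have pos: "X - 3 * ?A > 0" by (simp add: zero_less_mult_iff)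
  have "2 * B * X \<le> 2 * ?B * X" using B X125 by (intro mult_right_mono) auto
  also have "\<dots> \<le> (X - 3 * A) * (X - 2 * C)"
    unfolding eq[symmetric] using A C C8 X125 pos by (intro mult_mono) auto
  finally show "4 * B * C \<le> (X - 3 * A - 2 * B) * (X - 2 * C)" by (simp add: algebra_simps)
qed

text \<open>Otherwise the squared radius \<open>X\<close> of \<open>U3\<close> is at most
  \<open>M\<close>, which is too small for the inequality of \<open>rho_U3_7_lower\<close>. Crude
  weight bounds show this for large \<open>p\<close>, tangents at \<open>p = 2\<close> for
  \<open>p\<close> near 2.\<close>

lemma sombor_rho_U4_less_7:
  assumes p: "p \<ge> 2"
  shows "sombor_rho p 7 (U4 7) < sombor_rho p 7 (U3 7)"
proof (rule ccontr)
  define q where "q = 2 / p"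
  have q: "0 < q" "q \<le> 1" using p by (auto simp: q_def)
  define X where "X = (sombor_rho p 7 (U3 7))\<^sup>2"
  define M where "M = (1025 / 100 + 164 / 100 * q)\<^sup>2"
  assume "\<not> ?thesis"
  then have "sombor_rho p 7 (U3 7) \<le> 1025 / 100 + 164 / 100 * q"
    using rho_U4_7_upper[OF p] by (simp add: q_def)
  moreover have "sombor_rho p 7 (U3 7) \<ge> 0"
  proof -
    have "0 \<le> real 5 * sqrt (real 5)" by simp
    also have "\<dots> < sombor_rho p 7 (U3 7)"
      by (rule sombor_rho_star[OF simple_U3]) (use p deg_U3[of 7] in auto)
    finally show ?thesis by simp
  qed
  ultimately have XM: "X \<le> M" unfolding X_def M_def by (rule power_mono)
  have C: "(pnorm p 2 2)\<^sup>2 = 4 * 2 powr q"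
    using pnorm_sq_eq_powr[of p 2 2] p by (simp add: q_def)
  have X125: "X > 125" unfolding X_def by (rule rho_U3_7_lower(1)[OF p, of 0 0 0]) auto
  show False
  \<comment> \<open>The crude bounds 25, 25 and \<open>4 + 8 q / 3\<close> for the squared weights
    barely suffice at \<open>q = 7/10\<close>; the tangent bounds cover \<open>s = 1 - q\<close>
    below \<open>3/10\<close>.\<close>
  proof (cases "q \<le> 7 / 10")
    case True
    have ln2: "ln 2 \<ge> (2 / 3 :: real)" by (rule ln2_ge_two_thirds)
    have "4 * (1 + q * (2 / 3)) \<le> (pnorm p 2 2)\<^sup>2"
    proof -
      have "q * (2 / 3) \<le> q * ln 2" using q ln2 by (intro mult_left_mono) auto
      then show ?thesis using powr_ge_one_plus[of 2 q] by (simp add: C)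
    qed
    moreover have "25 \<le> (pnorm p 5 1)\<^sup>2" "25 \<le> (pnorm p 5 2)\<^sup>2"
      using power_mono[of 5 "pnorm p 5 1" 2] power_mono[of 5 "pnorm p 5 2" 2] pnorm_gt[of p 5 1] pnorm_gt[of p 5 2] p by auto
    ultimately have low: "100 * (4 * (1 + q * (2 / 3))) \<le> (X - 125) * (X - 2 * (4 * (1 + q * (2 / 3))))"
      using rho_U3_7_lower(2)[OF p, of 25 25 "4 * (1 + q * (2 / 3))"] by (simp add: X_def)
    have Mq: "M = 1050625 / 10000 + 3362 / 100 * q + 26896 / 10000 * q\<^sup>2"
      unfolding M_def by (simp add: power2_eq_square algebra_simps)
    have q2: "q\<^sup>2 \<le> 7 / 10 * q" using True q by (simp add: power2_eq_square mult_right_mono)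
    have "X - 2 * (4 * (1 + q * (2 / 3))) \<le> 1182 / 10"
      using XM Mq q2 True q by simp
    then have "(X - 125) * (X - 2 * (4 * (1 + q * (2 / 3)))) \<le> (X - 125) * (1182 / 10)"
      using X125 by (intro mult_left_mono) auto
    also have "\<dots> \<le> (M - 125) * (1182 / 10)" using XM by (intro mult_right_mono) auto
    finally show False using low Mq q2 True q by simp
  next
    case False
    define s where "s = 1 - q"
    have s: "0 \<le> s" "s \<le> 3 / 10" using False q by (auto simp: s_def)
    have ln2: "ln 2 \<le> (25 / 36 :: real)" by (rule ln2_le_25_over_36)
    have l32: "ln (2 ^ k :: real) \<le> k * (25 / 36)" for k :: nat
      using mult_left_mono[OF ln2, of "real k"] by (simp add: ln_realpow)
    \<comment> \<open>The slopes round up \<open>1 + 5 ln 2\<close> here and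
      \<open>4 + 12 ln 2\<close> for \<open>B\<close>, by \<open>26 \<le> 32\<close>,
      \<open>29/4 \<le> 8\<close> and \<open>ln 2 \<le> 25/36\<close>.\<close>
    have A: "26 - 448 / 100 * s \<le> (pnorm p 5 1)\<^sup>2"
    proof -
      have "ln (26 / 25 :: real) \<le> 1 / 25" using ln_le_minus_one[of "26 / 25 :: real"] by simp
      moreover have "ln (26 :: real) \<le> ln 32" by simp
      moreover have "ln (32 :: real) \<le> 5 * (25 / 36)" using l32[of 5] by simp
      ultimately have "25 * ln (26 / 25 :: real) + ln 26 \<le> 448 / 100" by linarith
      then have "s * (25 * ln (26 / 25 :: real) + ln 26) \<le> s * (448 / 100)" using s by (intro mult_left_mono) auto
      moreover have "26 - s * (25 * ln (26 / 25) + ln 26) \<le> (pnorm p 5 1)\<^sup>2"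
        using pnorm_sq_ge_tangent[OF p, of 5 1] by (simp add: s_def q_def)
      ultimately show ?thesis by linarith
    qed
    have B: "29 - 1234 / 100 * s \<le> (pnorm p 5 2)\<^sup>2"
    proof -
      have "ln (29 / 25 :: real) \<le> 4 / 25" using ln_le_minus_one[of "29 / 25 :: real"] by simp
      moreover have "ln (29 / 4 :: real) \<le> ln 8" by (subst ln_le_cancel_iff) auto
      moreover have "ln (8 :: real) \<le> 3 * (25 / 36)" using l32[of 3] by simp
      ultimately have "25 * ln (29 / 25 :: real) + 4 * ln (29 / 4) \<le> 1234 / 100" by linarith
      then have "s * (25 * ln (29 / 25 :: real) + 4 * ln (29 / 4)) \<le> s * (1234 / 100)" using s by (intro mult_left_mono) auto
      moreover have "29 - s * (25 * ln (29 / 25) + 4 * ln (29 / 4)) \<le> (pnorm p 5 2)\<^sup>2"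
        using pnorm_sq_ge_tangent[OF p, of 5 2] by (simp add: s_def q_def)
      ultimately show ?thesis by linarith
    qed
    have C': "8 - 56 / 10 * s \<le> (pnorm p 2 2)\<^sup>2"
    proof -
      have "2 powr q = 2 * 2 powr (- s)" by (simp add: s_def powr_diff powr_minus field_simps)
      moreover have "1 - s * ln 2 \<le> 2 powr (- s)" using powr_ge_one_plus[of 2 "- s"] by simp
      moreover have "s * ln 2 \<le> s * (7 / 10)" using s ln2 by (intro mult_left_mono) auto
      ultimately show ?thesis by (simp add: C)
    qed
    let ?A = "26 - 448 / 100 * s" and ?B = "29 - 1234 / 100 * s" and ?C = "8 - 56 / 10 * s"
    have low: "4 * ?B * ?C \<le> (X - 3 * ?A - 2 * ?B) * (X - 2 * ?C)"
      unfolding X_def by (rule rho_U3_7_lower(2)[OF p A _ B C']) (use s in simp)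
    have Ms: "M = 1413721 / 10000 - 389992 / 10000 * s + 26896 / 10000 * s\<^sup>2"
    proof -
      have qs: "q = 1 - s" by (simp add: s_def)
      show ?thesis unfolding M_def qs by (simp add: power2_eq_square field_simps)
    qed
    have s2: "s\<^sup>2 \<le> 3 / 10 * s" using mult_right_mono[OF s(2,1)] by (simp add: power2_eq_square)
    \<comment> \<open>The slopes in \<open>s\<close> nearly cancel,
      \<open>3 * 4.48 + 2 * 12.34 = 38.12\<close> against at least \<open>38.19\<close> from
      \<open>M\<close>, so the constant \<open>141.3721 - 136\<close> bounds the factor.\<close>
    have 1: "X - 3 * ?A - 2 * ?B \<le> 53721 / 10000" using XM Ms s2 s by simp
    have 2: "X - 2 * ?C \<le> 1253721 / 10000 - 2699 / 100 * s" using XM Ms s2 s by simp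
    have "X - 2 * ?C > 0" using X125 s by simp
    then have "(X - 3 * ?A - 2 * ?B) * (X - 2 * ?C) \<le> 53721 / 10000 * (X - 2 * ?C)"
      using 1 by (intro mult_right_mono) auto
    also have "\<dots> \<le> 53721 / 10000 * (1253721 / 10000 - 2699 / 100 * s)" using 2 by (intro mult_left_mono) auto
    finally have up: "(X - 3 * ?A - 2 * ?B) * (X - 2 * ?C) \<le> 53721 / 10000 * (1253721 / 10000 - 2699 / 100 * s)" .
    have e: "4 * ?B * ?C = 928 - 104448 / 100 * s + 276416 / 1000 * s\<^sup>2"
      by (simp add: power2_eq_square field_simps)
    \<comment> \<open>The tangent of \<open>s^2\<close> at \<open>3/10\<close> makes the final
      comparison linear; it would force \<open>s\<close> above \<open>0.31\<close>.\<close>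
    have "s\<^sup>2 \<ge> 6 / 10 * s - 9 / 100"
      using zero_le_power2[of "s - 3 / 10"] by (simp add: power2_eq_square algebra_simps)
    with order_trans[OF low up, unfolded e] show False using s by simp
  qed
qed

lemma sombor_rho_U4_less:
  assumes "p \<ge> 2" "n \<ge> 7"
  shows "sombor_rho p n (U4 n) < sombor_rho p n (U3 n)"
proof (cases "n = 7")
  case True
  then show ?thesis using sombor_rho_U4_less_7[OF assms(1)] by simp
next
  case False
  then show ?thesis using sombor_rho_U4_less_large assms by simp
qed

section \<open>Cycles and edge counts\<close>

text \<open>The vertex set is arbitrary because the induction on it deletes vertices.\<close>

definition simple_on :: "nat set \<Rightarrow> nat set set \<Rightarrow> bool" where
  "simple_on V E \<longleftrightarrow> finite V \<and> (\<forall>e\<in>E. e \<subseteq> V \<and> card e = 2)"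

lemma is_cycle_mono: "is_cycle E C \<Longrightarrow> E \<subseteq> E' \<Longrightarrow> is_cycle E' C"
  unfolding is_cycle_def adj_def by blast

lemma simple_onD:
  assumes "simple_on V E" "adj E i j"
  shows "i \<in> V" "j \<in> V" "i \<noteq> j"
proof -
  have "{i, j} \<subseteq> V" "card {i, j} = 2" using assms by (auto simp: simple_on_def adj_def)
  then show "i \<in> V" "j \<in> V" "i \<noteq> j" by auto
qed

text \<open>All neighbours of the first vertex of a longest path lie on the path; one of two
  distinct neighbours sits at position 2 or later and closes a cycle.\<close>

lemma cycle_of_min_degree_2:
  assumes S: "simple_on V E" and ne: "V \<noteq> {}"
    and deg: "\<And>v. v \<in> V \<Longrightarrow> \<exists>u w. adj E v u \<and> adj E v w \<and> u \<noteq> w"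
  shows "\<exists>C. is_cycle E C"
proof -
  define P where "P vs \<longleftrightarrow> vs \<noteq> [] \<and> distinct vs \<and> set vs \<subseteq> V \<and>
    (\<forall>i. Suc i < length vs \<longrightarrow> adj E (vs ! i) (vs ! Suc i))" for vs
  have fV: "finite V" using S by (simp add: simple_on_def)
  obtain v where "v \<in> V" using ne by blast
  then have P1: "P [v]" by (simp add: P_def)
  have "length vs < Suc (card V)" if "P vs" for vs
    using that distinct_card[of vs] card_mono[OF fV, of "set vs"] by (simp add: P_def)
  then obtain vs where vs: "P vs" and mx: "\<And>ws. P ws \<Longrightarrow> length ws \<le> length vs"
    using ex_has_greatest_nat[of P "[v]" length "Suc (card V)"] P1 by (metis less_imp_le)
  have V: "vs \<noteq> []" "distinct vs" "set vs \<subseteq> V" "\<And>i. Suc i < length vs \<Longrightarrow> adj E (vs ! i) (vs ! Suc i)"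
    using vs by (auto simp: P_def)
  then have "vs ! 0 \<in> V" by (cases vs) auto
  then obtain u w where uw: "adj E (vs ! 0) u" "adj E (vs ! 0) w" "u \<noteq> w" using deg by blast
  have inv: "x \<in> set vs" if "adj E (vs ! 0) x" for x
  proof (rule ccontr)
    assume x: "x \<notin> set vs"
    have "P (x # vs)"
      unfolding P_def
    proof (intro conjI allI impI)
      show "set (x # vs) \<subseteq> V" using simple_onD[OF S that] V by auto
      fix i assume "Suc i < length (x # vs)"
      then show "adj E ((x # vs) ! i) ((x # vs) ! Suc i)"
        using V that by (cases i) (auto simp: adj_commute)
    qed (use V x in auto)
    then show False using mx[of "x # vs"] by simp
  qed
  have "\<exists>k\<ge>2. k < length vs \<and> adj E (vs ! 0) (vs ! k)"
  proof -
    obtain i j where ij: "i < length vs" "j < length vs" "vs ! i = u" "vs ! j = w"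
      using inv[OF uw(1)] inv[OF uw(2)] by (metis in_set_conv_nth)
    have "i \<noteq> j" using ij uw by auto
    moreover have "i \<noteq> 0" "j \<noteq> 0" using ij uw simple_onD(3)[OF S] by metis+
    ultimately have "i \<ge> 2 \<or> j \<ge> 2" by linarith
    then show ?thesis using ij uw by blast
  qed
  then obtain k where k: "k \<ge> 2" "k < length vs" "adj E (vs ! 0) (vs ! k)" by blast
  let ?c = "take (Suc k) vs"
  have len: "length ?c = Suc k" using k by simp
  have "adj E (?c ! i) (?c ! ((i + 1) mod length ?c))" if "i < length ?c" for i
  proof (cases "i = k")
    case True
    then show ?thesis using k len V(1) by (simp add: adj_commute)
  next
    case False
    then have "i < k" using that len by simp
    then show ?thesis using k len V(4)[of i] by simp
  qed
  then have "is_cycle E {{?c ! i, ?c ! ((i + 1) mod length ?c)} | i. i < length ?c}"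
    unfolding is_cycle_def using V(2) k len by (intro exI[of _ ?c]) auto
  then show ?thesis by blast
qed

text \<open>If some vertex has at most one neighbour, deleting it removes at most one edge, and the
  hypothesis passes to the smaller vertex set; otherwise a longest path closes up.\<close>

lemma cycle_of_many_edges:
  assumes "simple_on V E" "V \<noteq> {}" "card V \<le> card E"
  shows "\<exists>C. is_cycle E C"
  using assms
proof (induction "card V" arbitrary: V E)
  case 0
  then show ?case by (auto simp: simple_on_def)
next
  case (Suc m)
  note S = Suc.prems(1)
  have fV: "finite V" using S by (simp add: simple_on_def)
  have fE: "finite E" by (rule finite_subset[of E "Pow V"]) (use S fV in \<open>auto simp: simple_on_def\<close>)
  show ?case
  proof (cases "\<forall>v\<in>V. \<exists>u w. adj E v u \<and> adj E v w \<and> u \<noteq> w")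
    case True
    then show ?thesis using cycle_of_min_degree_2[OF S Suc.prems(2)] by blast
  next
    case False
    then obtain v where v: "v \<in> V" "\<And>u w. adj E v u \<Longrightarrow> adj E v w \<Longrightarrow> u = w" by blast
    let ?E = "{e \<in> E. v \<notin> e}" and ?F = "{e \<in> E. v \<in> e}"
    have ?thesis if "V - {v} \<noteq> {}"
    proof -
      have "e = f" if ef: "e \<in> ?F" "f \<in> ?F" for e f
      proof -
        have "\<exists>u. g = {v, u} \<and> adj E v u" if "g \<in> ?F" for g
        proof -
          have "card g = 2" "v \<in> g" "g \<in> E" using that S by (auto simp: simple_on_def)
          then obtain x y where g: "g = {x, y}" unfolding card_2_iff by blast
          then have "v = x \<or> v = y" using \<open>v \<in> g\<close> by simp
          then have "g = {v, x} \<or> g = {v, y}" using g by (auto simp: insert_commute)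
          then show ?thesis using \<open>g \<in> E\<close> by (auto simp: adj_def)
        qed
        then show ?thesis using ef v(2) by metis
      qed
      then have "card ?F \<le> 1" using fE by (simp add: card_le_Suc0_iff_eq)
      moreover have "card E = card ?E + card ?F"
        by (subst card_Un_disjoint[symmetric]) (use fE in \<open>auto intro: arg_cong[where f = card]\<close>)
      ultimately have "card (V - {v}) \<le> card ?E" using Suc.prems(3) v fV by simp
      moreover have "simple_on (V - {v}) ?E" using S by (auto simp: simple_on_def)
      moreover have "m = card (V - {v})" using Suc.hyps(2) v fV by simp
      ultimately have "\<exists>C. is_cycle ?E C" using Suc.hyps(1)[of "V - {v}" ?E] that by simp
      then obtain C where "is_cycle ?E C" ..
      then show ?thesis using is_cycle_mono[of ?E C E] by blast
    qed
    moreover have False if "V - {v} = {}"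
    proof -
      have "V = {v}" using that v by auto
      then have "e \<notin> E" for e
        using S card_mono[of "{v}" e] by (fastforce simp: simple_on_def)
      then have "E = {}" by blast
      then show False using Suc.prems(2,3) fV by simp
    qed
    ultimately show ?thesis by blast
  qed
qed

text \<open>Every vertex other than 0 picks an edge to a neighbour closer to 0. Distances strictly
  decrease along these edges, so none is picked twice.\<close>

lemma connected_card_edges:
  assumes G: "simple_graph n E" and c: "connected_graph n E"
  shows "n - 1 \<le> card E"
proof -
  have n: "n \<ge> 1" using c by (simp add: connected_graph_def)
  define D where "D i = (LEAST k. ((adj E) ^^ k) 0 i)" for i
  have ex: "\<exists>k. ((adj E) ^^ k) 0 i" if "i < n" for i
    using c that n rtranclp_imp_relpowp[of "adj E" 0 i] by (auto simp: connected_graph_def)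
  have "\<exists>j. adj E i j \<and> D j < D i" if i: "i \<in> {1..<n}" for i
  proof -
    have Di: "((adj E) ^^ D i) 0 i" unfolding D_def using ex[of i] i by (auto intro: LeastI_ex)
    have "D i \<noteq> 0" using Di i by (auto intro: ccontr)
    then obtain m where m: "D i = Suc m" using not0_implies_Suc by blast
    then obtain j where j: "((adj E) ^^ m) 0 j" "adj E j i" using Di by auto
    then have "D j \<le> m" unfolding D_def by (intro Least_le)
    then show ?thesis using j m by (auto simp: adj_commute)
  qed
  then obtain par where par: "\<And>i. i \<in> {1..<n} \<Longrightarrow> adj E i (par i) \<and> D (par i) < D i" by metis
  have "inj_on (\<lambda>i. {i, par i}) {1..<n}"
  proof (rule inj_onI)
    fix i j assume ij: "i \<in> {1..<n}" "j \<in> {1..<n}" "{i, par i} = {j, par j}"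
    then show "i = j" using par[OF ij(1)] par[OF ij(2)] by (auto simp: doubleton_eq_iff)
  qed
  then have "card {1..<n} \<le> card E"
    by (rule card_inj_on_le) (use par finite_simple_graph[OF G] in \<open>auto simp: adj_def\<close>)
  then show ?thesis by simp
qed

text \<open>Deleting an edge of the cycle destroys the only cycle, so fewer than \<open>n\<close>
  edges remain; the rest of the cycle is a detour, so the graph stays connected and keeps at least
  \<open>n - 1\<close> edges.\<close>

lemma unicyclic_card_edges:
  assumes "unicyclic n E"
  shows "card E = n"
proof -
  have G: "simple_graph n E" and c: "connected_graph n E" using assms by (auto simp: unicyclic_def)
  have n: "n \<ge> 1" using c by (simp add: connected_graph_def)
  have fE: "finite E" by (rule finite_simple_graph[OF G])
  obtain C where C: "{C. is_cycle E C} = {C}" using assms by (auto simp: unicyclic_def card_1_singleton_iff)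
  then have "is_cycle E C" by blast
  then obtain vs where vs: "distinct vs" "length vs \<ge> 3"
    "\<And>i. i < length vs \<Longrightarrow> adj E (vs ! i) (vs ! ((i + 1) mod length vs))"
    "C = {{vs ! i, vs ! ((i + 1) mod length vs)} | i. i < length vs}"
    unfolding is_cycle_def by blast
  let ?m = "length vs"
  define e where "e = {vs ! 0, vs ! 1}"
  have m: "0 < ?m" "1 < ?m" using vs(2) by auto
  have eE: "e \<in> E" using vs(3)[OF m(1)] m by (simp add: e_def adj_def)
  have "(0 + 1) mod ?m = 1" using m by simp
  then have eC: "e \<in> C" unfolding vs(4) e_def using m by (intro CollectI exI[of _ 0]) simp
  let ?E = "E - {e}"
  have G': "simple_graph n ?E" using G by (auto simp: simple_graph_def)
  have "\<not> is_cycle ?E C'" for C'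
  proof
    assume *: "is_cycle ?E C'"
    then have "is_cycle E C'" by (rule is_cycle_mono) auto
    then have "C' = C" using C by blast
    moreover have "C' \<subseteq> ?E" using * by (auto simp: is_cycle_def adj_def)
    ultimately show False using eC by blast
  qed
  then have "card ?E < n"
    using cycle_of_many_edges[of "{0..<n}" ?E] G' n by (force simp: simple_on_def simple_graph_def)
  then have upper: "card E \<le> n" using eE fE by simp
  have path: "(adj ?E)\<^sup>*\<^sup>* (vs ! 1) (vs ! i)" if "1 \<le> i" "i < ?m" for i
    using that
  proof (induction i rule: dec_induct)
    case (step i)
    have "adj E (vs ! i) (vs ! Suc i)" using vs(3)[of i] step by simp
    moreover have "{vs ! i, vs ! Suc i} \<noteq> e"
      using step vs(1) m by (auto simp: e_def doubleton_eq_iff nth_eq_iff_index_eq)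
    ultimately have "adj ?E (vs ! i) (vs ! Suc i)" by (simp add: adj_def)
    then show ?case using step by (simp add: rtranclp.rtrancl_into_rtrancl)
  qed simp
  have last: "adj ?E (vs ! (?m - 1)) (vs ! 0)"
  proof -
    have "Suc (?m - 1) mod ?m = 0" using m by simp
    then have "adj E (vs ! (?m - 1)) (vs ! 0)" using vs(3)[of "?m - 1"] m by simp
    moreover have "{vs ! (?m - 1), vs ! 0} \<noteq> e"
      using vs(1,2) by (auto simp: e_def doubleton_eq_iff nth_eq_iff_index_eq)
    ultimately show ?thesis by (simp add: adj_def)
  qed
  have 10: "(adj ?E)\<^sup>*\<^sup>* (vs ! 1) (vs ! 0)" 
    by (rule rtranclp.rtrancl_into_rtrancl[OF path last]) (use vs(2) in auto)
  have conv: "(adj ?E)\<inverse>\<inverse> = adj ?E" by (auto simp: fun_eq_iff adj_commute)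
  have 01: "(adj ?E)\<^sup>*\<^sup>* (vs ! 0) (vs ! 1)" using 10 conv by (metis rtranclp_conversep conversep_iff)
  have step: "(adj ?E)\<^sup>*\<^sup>* i j" if "adj E i j" for i j
  proof (cases "{i, j} = e")
    case True
    then show ?thesis using 01 10 by (auto simp: e_def doubleton_eq_iff)
  next
    case False
    then have "adj ?E i j" using that by (simp add: adj_def)
    then show ?thesis by blast
  qed
  have "(adj E)\<^sup>*\<^sup>* i j \<Longrightarrow> (adj ?E)\<^sup>*\<^sup>* i j" for i j
    by (induction rule: rtranclp_induct) (use step in \<open>auto intro: rtranclp_trans\<close>)
  then have "connected_graph n ?E" using c by (auto simp: connected_graph_def)
  then have "n - 1 \<le> card ?E" using connected_card_edges[OF G'] by blast
  moreover have "card E > 0" using eE fE by (auto simp: card_gt_0_iff)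
  ultimately show ?thesis using upper eE fE n by simp
qed

text \<open>The third part, that a cycle leaves each of its vertices by a second edge, is what
  allows the cycles of a concrete graph to be found by following forced edges.\<close>

lemma is_cycleD:
  assumes "is_cycle E C"
  shows "C \<noteq> {}" "C \<subseteq> E" "{u, v} \<in> C \<Longrightarrow> \<exists>w. w \<noteq> v \<and> {u, w} \<in> C"
proof -
  obtain vs where vs: "distinct vs" "length vs \<ge> 3"
    "\<And>i. i < length vs \<Longrightarrow> adj E (vs ! i) (vs ! ((i + 1) mod length vs))"
    "C = {{vs ! i, vs ! ((i + 1) mod length vs)} | i. i < length vs}"
    using assms unfolding is_cycle_def by blast
  let ?m = "length vs"
  have inC: "{vs ! i, vs ! ((i + 1) mod ?m)} \<in> C" if "i < ?m" for i using that vs(4) by blast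
  have "0 < ?m" using vs(2) by linarith
  then show "C \<noteq> {}" using inC by blast
  show "C \<subseteq> E" using vs(3,4) by (auto simp: adj_def)
  assume "{u, v} \<in> C"
  then obtain i where i: "i < ?m" "{u, v} = {vs ! i, vs ! ((i + 1) mod ?m)}" using vs(4) by blast
  then consider "u = vs ! i" "v = vs ! ((i + 1) mod ?m)" | "v = vs ! i" "u = vs ! ((i + 1) mod ?m)"
    by (auto simp: doubleton_eq_iff)
  then show "\<exists>w. w \<noteq> v \<and> {u, w} \<in> C"
  proof cases
    case 1
    \<comment> \<open>The cyclic predecessor of \<open>i\<close>; it differs from the successor
      since the cycle has at least three vertices.\<close>
    define k where "k = (if i = 0 then ?m - 1 else i - 1)"
    have k: "k < ?m" "(k + 1) mod ?m = i" using i vs(2) by (auto simp: k_def)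
    have "k \<noteq> (i + 1) mod ?m"
      using i vs(2) by (cases "i + 1 = ?m") (auto simp: k_def)
    moreover have "(i + 1) mod ?m < ?m" using vs(2) by (intro mod_less_divisor) linarith
    ultimately have "vs ! k \<noteq> v" using 1 k i vs(1,2) by (simp add: nth_eq_iff_index_eq)
    moreover have "{u, vs ! k} \<in> C" using inC[OF k(1)] k(2) 1 by (simp add: insert_commute)
    ultimately show ?thesis by blast
  next
    case 2
    define j where "j = (i + 1) mod ?m"
    have j: "j < ?m" unfolding j_def using vs(2) by (intro mod_less_divisor) linarith
    have "(j + 1) mod ?m \<noteq> i"
    proof (cases "i + 1 = ?m")
      case True then show ?thesis using vs(2) by (simp add: j_def)
    next
      case False
      then have "j = i + 1" using i by (simp add: j_def)
      show ?thesis
      proof (cases "j + 1 = ?m")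
        case True then show ?thesis using \<open>j = i + 1\<close> vs(2) by auto
      next
        case False
        then have "(j + 1) mod ?m = j + 1" using j by simp
        then show ?thesis using \<open>j = i + 1\<close> by simp
      qed
    qed
    moreover have "(j + 1) mod ?m < ?m" using vs(2) by (intro mod_less_divisor) linarith
    ultimately have "vs ! ((j + 1) mod ?m) \<noteq> v" using 2 i j vs(1,2) by (simp add: nth_eq_iff_index_eq)
    moreover have "{u, vs ! ((j + 1) mod ?m)} \<in> C" using inC[OF j] 2 by (simp add: j_def)
    ultimately show ?thesis by blast
  qed
qed

section \<open>The cycles of the extremal graphs\<close>

lemma unicyclicI:
  assumes "simple_graph n E" "connected_graph n E" "is_cycle E K" "\<And>C. is_cycle E C \<Longrightarrow> C = K"
  shows "unicyclic n E"
proof -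
  have "{C. is_cycle E C} = {K}" using assms(3) by (auto dest: assms(4))
  then show ?thesis using assms(1,2) by (simp add: unicyclic_def)
qed

lemma is_cycle_triangle:
  assumes "adj E 0 1" "adj E 1 2" "adj E 0 2"
  shows "is_cycle E {{0, 1}, {1, 2}, {0, 2}}"
proof -
  have s: "adj E 2 0" using assms(3) by (simp add: adj_commute)
  have S: "{i. i < Suc (Suc (Suc 0))} = {0, 1, 2::nat}" by auto
  show ?thesis unfolding is_cycle_def
  proof (intro exI[of _ "[0, 1, 2::nat]"] conjI allI impI)
    show "{{0, 1}, {1, 2}, {0, 2}} = {{[0, 1, 2::nat] ! i, [0, 1, 2] ! ((i + 1) mod length [0, 1, 2::nat])} | i. i < length [0, 1, 2::nat]}"
      unfolding setcompr_eq_image by (simp add: S insert_commute)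
  qed (use assms s in \<open>auto simp: less_Suc_eq\<close>)
qed

lemma is_cycle_square:
  assumes "adj E 0 1" "adj E 1 2" "adj E 2 3" "adj E 0 3"
  shows "is_cycle E {{0, 1}, {1, 2}, {2, 3}, {0, 3}}"
proof -
  have s: "adj E 3 0" using assms(4) by (simp add: adj_commute)
  have S: "{i. i < Suc (Suc (Suc (Suc 0)))} = {0, 1, 2, 3::nat}" by auto
  show ?thesis unfolding is_cycle_def
  proof (intro exI[of _ "[0, 1, 2, 3::nat]"] conjI allI impI)
    show "{{0, 1}, {1, 2}, {2, 3}, {0, 3}} = {{[0, 1, 2, 3::nat] ! i, [0, 1, 2, 3] ! ((i + 1) mod length [0, 1, 2, 3::nat])} | i. i < length [0, 1, 2, 3::nat]}"
      unfolding setcompr_eq_image by (simp add: S insert_commute[of 3 0])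
  qed (use assms s in \<open>auto simp: less_Suc_eq\<close>)
qed

lemma cycle_step:
  assumes "is_cycle E C" "{u, v} \<in> C" "\<And>w. adj E u w \<Longrightarrow> w \<noteq> v \<Longrightarrow> {u, w} \<in> C \<Longrightarrow> w = t"
  shows "{u, t} \<in> C"
proof -
  obtain w where w: "w \<noteq> v" "{u, w} \<in> C" using is_cycleD(3)[OF assms(1,2)] by blast
  have "adj E u w" using is_cycleD(2)[OF assms(1)] w(2) unfolding adj_def by (rule subsetD)
  from assms(3)[OF this w] w(2) show ?thesis by simp
qed

text \<open>Only neighbours along edges of \<open>C\<close> count, so that a pendant path can be
  peeled off edge by edge, such as \<open>{3, 4}\<close> and then \<open>{0, 3}\<close> in
  \<open>U2\<close>.\<close>

lemma cycle_no_pendant: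
  assumes "is_cycle E C" "\<And>w. adj E k w \<Longrightarrow> {k, w} \<in> C \<Longrightarrow> w = v"
  shows "{v, k} \<notin> C" "{k, v} \<notin> C"
proof -
  show "{k, v} \<notin> C"
  proof
    assume "{k, v} \<in> C"
    then obtain w where w: "w \<noteq> v" "{k, w} \<in> C" using is_cycleD(3)[OF assms(1)] by blast
    have "adj E k w" using is_cycleD(2)[OF assms(1)] w(2) unfolding adj_def by (rule subsetD)
    from assms(2)[OF this w(2)] w(1) show False by simp
  qed
  then show "{v, k} \<notin> C" by (simp add: insert_commute)
qed

text \<open>Every cycle leaves each of its vertices by a second edge, so a cycle inside a triangle is the triangle.\<close>

lemma cycle_in_triangle:
  assumes C: "is_cycle E C" and sub: "C \<subseteq> {{0, 1}, {1, 2}, {0, 2::nat}}"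
  shows "C = {{0, 1}, {1, 2}, {0, 2}}"
proof -
  have inC: "{u, w} \<in> C \<Longrightarrow> {u, w} \<in> {{0, 1}, {1, 2}, {0, 2}}" for u w by (rule subsetD[OF sub])
  have k0: "w = 1 \<or> w = 2" if "{0, w} \<in> C" for w using inC[OF that] by (auto simp: doubleton_eq_iff)
  have k1: "w = 0 \<or> w = 2" if "{1, w} \<in> C" for w using inC[OF that] by (auto simp: doubleton_eq_iff)
  have k2: "w = 0 \<or> w = 1" if "{2, w} \<in> C" for w using inC[OF that] by (auto simp: doubleton_eq_iff)
  have sw: "{u, w} \<in> C \<Longrightarrow> {w, u} \<in> C" for u w by (simp add: insert_commute)
  have step1: "{1, 2} \<in> C" "{0, 2} \<in> C" if "{0, 1} \<in> C"
    by (rule cycle_step[OF C sw[OF that]], use k1 in blast) (rule cycle_step[OF C that], use k0 in blast)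
  have step2: "{0, 1} \<in> C" if "{1, 2} \<in> C"
    by (rule sw, rule cycle_step[OF C that]) (use k1 in blast)
  have step3: "{0, 1} \<in> C" if "{0, 2} \<in> C"
    by (rule cycle_step[OF C that]) (use k0 in blast)
  obtain e where "e \<in> C" using is_cycleD(1)[OF C] by blast
  then have "{0, 1} \<in> C" using sub step2 step3 by auto
  then show ?thesis using sub step1 by blast
qed

lemma unicyclic_tri:
  assumes nb: "3 + b \<le> n"
  shows "unicyclic n (tri n b)"
proof (rule unicyclicI[OF simple_tri[OF nb] connected_tri[OF nb]])
  show "is_cycle (tri n b) {{0, 1}, {1, 2}, {0, 2}}"
    by (rule is_cycle_triangle) (auto simp: adj_tri)
  fix C assume C: "is_cycle (tri n b) C"
  have "{1, k} \<notin> C" if "3 \<le> k" "k < 3 + b" for k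
    by (rule cycle_no_pendant[OF C]) (use that in \<open>auto simp: adj_tri\<close>)
  moreover have "{0, k} \<notin> C" if "3 + b \<le> k" "k < n" for k
    by (rule cycle_no_pendant[OF C]) (use that in \<open>auto simp: adj_tri\<close>)
  ultimately have "C \<subseteq> {{0, 1}, {1, 2}, {0, 2}}"
    using is_cycleD(2)[OF C] unfolding tri_def by blast
  then show "C = {{0, 1}, {1, 2}, {0, 2}}" by (rule cycle_in_triangle[OF C])
qed

section \<open>The extremal ordering\<close>

lemma card_edges_hub:
  assumes G: "simple_graph n E"
  shows "card E = deg n E x + card {e \<in> E. x \<notin> e}"
proof -
  have fin: "finite E" using G by (rule finite_simple_graph)
  let ?F = "(\<lambda>j. {x, j}) ` nbrs n E x"
  have "E = ?F \<union> {e \<in> E. x \<notin> e}"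
  proof (intro equalityI subsetI)
    fix e assume e: "e \<in> E"
    obtain i j where ij: "e = {i, j}" "adj E i j" using simple_edgeE[OF G e] by metis
    show "e \<in> ?F \<union> {e \<in> E. x \<notin> e}"
      using e ij adj_commute[of E i j] by (auto simp: mem_nbrs[OF G] insert_commute)
  qed (auto simp: mem_nbrs[OF G] adj_def)
  then have "card E = card (?F \<union> {e \<in> E. x \<notin> e})" by simp
  also have "\<dots> = card ?F + card {e \<in> E. x \<notin> e}"
    by (rule card_Un_disjoint) (use fin in auto)
  also have "card ?F = deg n E x"
    unfolding deg_eq_card_nbrs by (rule card_image) (auto simp: inj_on_def doubleton_eq_iff)
  finally show ?thesis .
qed

text \<open>The edge count leaves exactly one edge off the hub, and it joins two of the hub's
  neighbours.\<close>

lemma hub_spanning: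
  assumes G: "simple_graph n E" and cE: "card E = n" and x: "x < n" "deg n E x = n - 1"
  shows "graph_iso n E (Sn_e n)"
proof -
  have nx: "nbrs n E x = {0..<n} - {x}"
  proof (rule card_subset_eq)
    show "nbrs n E x \<subseteq> {0..<n} - {x}" using adj_irrefl[OF G] by (auto simp: nbrs_def)
  qed (use x in \<open>auto simp: deg_eq_card_nbrs\<close>)
  have ax: "adj E x v \<longleftrightarrow> v < n \<and> v \<noteq> x" for v using nx by (auto simp flip: mem_nbrs[OF G])
  then have ax': "adj E v x \<longleftrightarrow> v < n \<and> v \<noteq> x" for v by (simp add: adj_commute)
  have "card {e \<in> E. x \<notin> e} = 1" using card_edges_hub[OF G, of x] cE x by simp
  then obtain e where e: "{e \<in> E. x \<notin> e} = {e}" by (auto simp: card_1_singleton_iff)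
  then have "e \<in> E" "x \<notin> e" by auto
  then obtain r s where rs: "e = {r, s}" "r \<noteq> s" "r < n" "s < n" "x \<noteq> r" "x \<noteq> s"
    by (metis insertCI simple_edgeE[OF G])
  have other: "adj E i j \<longleftrightarrow> {i, j} = {r, s}" if "i \<noteq> x" "j \<noteq> x" for i j
  proof -
    have "adj E i j \<longleftrightarrow> {i, j} \<in> {e \<in> E. x \<notin> e}" using that by (auto simp: adj_def)
    then show ?thesis unfolding e rs(1) by simp
  qed
  show ?thesis unfolding tri_eqs(1)[symmetric]
  proof (rule graph_iso_core[of "[x, r, s]"])
    note ne = rs(2,5,6)
    fix i j assume "i < length [x, r, s]" "j < length [x, r, s]"
    then have "i \<in> {0, 1, 2}" "j \<in> {0, 1, 2}" by auto
    then show "adj E ([x, r, s] ! i) ([x, r, s] ! j) \<longleftrightarrow> adj (tri n 0) i j"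
      by (elim insertE emptyE) (simp_all add: ne ne[symmetric] rs(3,4) x(1) ax ax' other adj_tri doubleton_eq_iff)
  next
    fix v u assume "v < n" "v \<notin> set [x, r, s]" "u < n"
    then show "adj E v u \<longleftrightarrow> u = [x, r, s] ! 0"
      by (cases "u = x") (auto simp: ax' other doubleton_eq_iff)
  qed (use rs x in \<open>auto simp: adj_tri\<close>)
qed

text \<open>One vertex \<open>w\<close> is not joined to the hub, and two edges avoid the hub. One
  of them joins \<open>w\<close> to some \<open>u\<close>; the other meets \<open>w\<close>, or only
  \<open>u\<close>, or neither, which gives \<open>U3\<close>, \<open>U1\<close> and
  \<open>U2\<close>.\<close>

lemma hub_missing_one:
  assumes G: "simple_graph n E" and conn: "connected_graph n E" and cE: "card E = n" and n: "n \<ge> 7"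
    and x: "x < n" "deg n E x = n - 2"
  shows "graph_iso n E (U1 n) \<or> graph_iso n E (U2 n) \<or> graph_iso n E (U3 n)"
proof -
  have sub: "nbrs n E x \<subseteq> {0..<n} - {x}" using adj_irrefl[OF G] by (auto simp: nbrs_def)
  have "card ({0..<n} - {x} - nbrs n E x) = 1"
    using x n sub by (subst card_Diff_subset) (auto simp: deg_eq_card_nbrs)
  then obtain w where weq: "{0..<n} - {x} - nbrs n E x = {w}" by (auto simp: card_1_singleton_iff)
  then have "w \<in> {0..<n} - {x} - nbrs n E x" by simp
  then have w: "w < n" "w \<noteq> x" by auto
  have nx: "nbrs n E x = {0..<n} - {x, w}" using sub weq by blast
  have ax: "adj E x v \<longleftrightarrow> v < n \<and> v \<noteq> x \<and> v \<noteq> w" for v using nx by (auto simp flip: mem_nbrs[OF G])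
  then have ax': "adj E v x \<longleftrightarrow> v < n \<and> v \<noteq> x \<and> v \<noteq> w" for v by (simp add: adj_commute)
  have c2: "card {e \<in> E. x \<notin> e} = 2" using card_edges_hub[OF G, of x] cE x n by simp
  have "\<exists>u. adj E w u"
  proof (rule ccontr)
    assume no: "\<not> ?thesis"
    have "x = w" by (rule connected_zero_set[OF conn w(1) x(1), of "\<lambda>i. i = w"]) (use no in auto)
    then show False using w by simp
  qed
  then obtain u where u: "adj E w u" by blast
  have uw: "u < n" "u \<noteq> w" "u \<noteq> x" using simple_graphD[OF G u] u ax' by auto
  have "{w, u} \<in> {e \<in> E. x \<notin> e}" using u uw w by (auto simp: adj_def)
  then obtain e where e: "{e \<in> E. x \<notin> e} = {{w, u}, e}" "e \<noteq> {w, u}"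
    using c2 unfolding card_2_iff by (metis doubleton_eq_iff insertE singletonD)
  then have "e \<in> E" "x \<notin> e" by auto
  then obtain r s where rs: "e = {r, s}" "r \<noteq> s" "r < n" "s < n" "x \<noteq> r" "x \<noteq> s"
    by (metis insertCI simple_edgeE[OF G])
  have other: "adj E i j \<longleftrightarrow> {i, j} = {w, u} \<or> {i, j} = {r, s}" if "i \<noteq> x" "j \<noteq> x" for i j
  proof -
    have "adj E i j \<longleftrightarrow> {i, j} \<in> {e \<in> E. x \<notin> e}" using that by (auto simp: adj_def)
    then show ?thesis unfolding e rs(1) by simp
  qed
  have U3: "graph_iso n E (U3 n)" if t: "e = {w, t}" "t < n" "t \<noteq> w" "t \<noteq> x" for t
  proof (rule graph_iso_core[of "[x, u, w, t]"])
    have ut: "u \<noteq> t" using t e(2) by auto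
    note ne = ut w(2) uw(2,3) t(3,4)
    have o: "adj E i j \<longleftrightarrow> {i, j} = {w, u} \<or> {i, j} = {w, t}" if "i \<noteq> x" "j \<noteq> x" for i j
      using other[OF that] rs(1) t(1) by simp
    show "distinct [x, u, w, t]" "set [x, u, w, t] \<subseteq> {0..<n}" using w uw t ut x by auto
    fix i j assume "i < length [x, u, w, t]" "j < length [x, u, w, t]"
    then have "i \<in> {0, 1, 2, 3}" "j \<in> {0, 1, 2, 3}" by auto
    then show "adj E ([x, u, w, t] ! i) ([x, u, w, t] ! j) \<longleftrightarrow> adj (U3 n) i j"
      by (elim insertE emptyE) (simp_all add: ne ne[symmetric] w(1) uw(1) t(2) x(1) ax ax' o adj_U3 doubleton_eq_iff)
  next
    fix i j assume "i < n" "i \<notin> set [x, u, w, t]" "j < n"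
    then show "adj E i j \<longleftrightarrow> j = [x, u, w, t] ! 0"
      using t rs(1) by (cases "j = x") (auto simp: ax' other doubleton_eq_iff)
  qed (auto simp: adj_U3)
  show ?thesis
  proof (cases "w \<in> e")
    case True
    then have "e = {w, r} \<or> e = {w, s}" using rs(1) by auto
    then show ?thesis using U3[of r] U3[of s] rs True by auto
  next
    case we: False
    have U1: "graph_iso n E (U1 n)" if t: "e = {u, t}" "t < n" "t \<noteq> w" "t \<noteq> x" "t \<noteq> u" for t
      unfolding tri_eqs(2)[symmetric]
    proof (rule graph_iso_core[of "[x, u, t, w]"])
      note ne = w(2) uw(2,3) t(3-5)
      have o: "adj E i j \<longleftrightarrow> {i, j} = {w, u} \<or> {i, j} = {u, t}" if "i \<noteq> x" "j \<noteq> x" for i j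
        using other[OF that] rs(1) t(1) by simp
      show "distinct [x, u, t, w]" "set [x, u, t, w] \<subseteq> {0..<n}" using w uw t x by auto
      fix i j assume "i < length [x, u, t, w]" "j < length [x, u, t, w]"
      then have "i \<in> {0, 1, 2, 3}" "j \<in> {0, 1, 2, 3}" by auto
      then show "adj E ([x, u, t, w] ! i) ([x, u, t, w] ! j) \<longleftrightarrow> adj (tri n 1) i j"
        by (elim insertE emptyE) (simp_all add: ne ne[symmetric] w(1) uw(1) t(2) x(1) ax ax' o adj_tri doubleton_eq_iff)
    next
      fix i j assume "i < n" "i \<notin> set [x, u, t, w]" "j < n"
      then show "adj E i j \<longleftrightarrow> j = [x, u, t, w] ! 0"
        using t rs(1) by (cases "j = x") (auto simp: ax' other doubleton_eq_iff)
    qed (auto simp: adj_tri)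
    have rw: "r \<noteq> w" "s \<noteq> w" using we rs(1) by auto
    show ?thesis
    proof (cases "u \<in> e")
      case True
      then have "e = {u, r} \<and> r \<noteq> u \<or> e = {u, s} \<and> s \<noteq> u" using rs(1,2) by auto
      then show ?thesis using U1[of r] U1[of s] rs rw by auto
    next
      case False
      then have ru: "r \<noteq> u" "s \<noteq> u" using rs(1) by auto
      have "graph_iso n E (U2 n)"
      proof (rule graph_iso_core[of "[x, r, s, u, w]"])
        note ne = w(2) uw(2,3) rs(2,5,6) rw ru
        show "distinct [x, r, s, u, w]" "set [x, r, s, u, w] \<subseteq> {0..<n}" using w uw rs rw ru x by auto
        fix i j assume "i < length [x, r, s, u, w]" "j < length [x, r, s, u, w]"
        then have "i \<in> {0, 1, 2, 3, 4}" "j \<in> {0, 1, 2, 3, 4}" by auto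
        then show "adj E ([x, r, s, u, w] ! i) ([x, r, s, u, w] ! j) \<longleftrightarrow> adj (U2 n) i j"
          by (elim insertE emptyE) (simp_all add: ne ne[symmetric] w(1) uw(1) rs(3,4) x(1) ax ax' other adj_U2 doubleton_eq_iff)
      next
        fix i j assume "i < n" "i \<notin> set [x, r, s, u, w]" "j < n"
        then show "adj E i j \<longleftrightarrow> j = [x, r, s, u, w] ! 0"
          by (cases "j = x") (auto simp: ax' other doubleton_eq_iff)
      qed (auto simp: adj_U2)
      then show ?thesis by blast
    qed
  qed
qed

definition low_graphs :: "nat \<Rightarrow> nat set set set" where
  "low_graphs n = {E. simple_graph n E \<and> connected_graph n E \<and> card E = n \<and> (\<forall>i<n. deg n E i \<le> n - 3)}"

lemma low_graphs_tri:
  assumes "2 \<le> b" "3 + 2 * b \<le> n"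
  shows "tri n b \<in> low_graphs n"
proof -
  have nb: "3 + b \<le> n" using assms by simp
  have "deg n (tri n b) i \<le> n - 3" if "i < n" for i
  proof -
    consider "i = 0" | "i = 1" | "i = 2" | "i \<in> {3..<3 + b}" | "i \<in> {3 + b..<n}" using \<open>i < n\<close> by force
    then show ?thesis by cases (use deg_tri[OF nb] assms in auto)
  qed
  then show ?thesis
    using simple_tri[OF nb] connected_tri[OF nb] unicyclic_card_edges[OF unicyclic_tri[OF nb]]
    by (simp add: low_graphs_def)
qed

text \<open>A strict transformation must leave the class, and only the recipient's degree grows. The
  Perron vector decides which of \<open>y\<close> and \<open>z\<close> receives, but the resulting
  degree is the same; \<open>y\<close> is subtracted only when the two are adjacent, since only then
  does it lie in the union.\<close>

lemma maximal_stuck: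
  assumes p: "p \<ge> 1" and E: "E \<in> low_graphs n"
    and mx: "\<And>E'. E' \<in> low_graphs n \<Longrightarrow> sombor_rho p n E' \<le> sombor_rho p n E"
    and yz: "y < n" "z < n" "y \<noteq> z" "adj E y z \<or> (\<exists>c. adj E y c \<and> adj E z c)"
    and priv: "nbrs n E y - nbrs n E z - {z} \<noteq> {}" "nbrs n E z - nbrs n E y - {y} \<noteq> {}"
  shows "n - 2 \<le> card (nbrs n E y \<union> nbrs n E z - (if adj E y z then {y} else {}))"
proof -
  have G: "simple_graph n E" and conn: "connected_graph n E" and cE: "card E = n"
    and dle: "\<And>i. i < n \<Longrightarrow> deg n E i \<le> n - 3" using E by (auto simp: low_graphs_def)
  obtain x where x: "perron p n E x" using perron_exists[OF G conn] by blast
  have main: "n - 3 < card (nbrs n E y \<union> nbrs n E z - {y})"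
    if yz: "y < n" "z < n" "y \<noteq> z" "adj E y z \<or> (\<exists>c. adj E y c \<and> adj E z c)" and le: "x z \<le> x y"
      and priv: "nbrs n E y - nbrs n E z - {z} \<noteq> {}" "nbrs n E z - nbrs n E y - {y} \<noteq> {}" for y z
  proof (rule ccontr)
    assume no: "\<not> ?thesis"
    let ?P = "nbrs n E z - nbrs n E y - {y}" and ?K = "kelmans n y z E"
    note deg = deg_kelmans[OF G yz(1-3) refl]
    have "nbrs n E y \<union> nbrs n E z - {y} = nbrs n E y \<union> ?P"
      using adj_irrefl[OF G] by (auto simp: mem_nbrs[OF G])
    moreover have "card (nbrs n E y \<union> ?P) = deg n E y + card ?P"
      unfolding deg_eq_card_nbrs by (rule card_Un_disjoint) auto
    ultimately have "deg n ?K y \<le> n - 3" using no deg(1) by simp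
    moreover have "deg n ?K z \<le> n - 3" using deg(3) dle[OF yz(2)] by simp
    moreover have "deg n ?K i \<le> n - 3" if "i < n" "i \<noteq> y" "i \<noteq> z" for i
      using deg(4)[OF that(2,3)] dle[OF that(1)] by simp
    ultimately have "\<forall>i<n. deg n ?K i \<le> n - 3" by blast
    then have "?K \<in> low_graphs n"
      using simple_kelmans[OF G yz(1-3) refl] connected_kelmans[OF G yz(1-3) refl conn yz(4)]
        card_kelmans[OF G yz(1-3) refl] cE by (simp add: low_graphs_def)
    moreover have "sombor_rho p n E < sombor_rho p n ?K"
      by (rule sombor_rho_kelmans[OF G yz(1-3) refl p x le yz(4) priv(2,1)])
    ultimately show False using mx by fastforce
  qed
  have irr: "y \<notin> nbrs n E y" "z \<notin> nbrs n E z" using adj_irrefl[OF G] by (auto simp: mem_nbrs[OF G])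
  have yzn: "y \<in> nbrs n E z \<longleftrightarrow> adj E y z" "z \<in> nbrs n E y \<longleftrightarrow> adj E y z"
    by (auto simp: mem_nbrs[OF G] adj_commute)
  let ?N = "nbrs n E y \<union> nbrs n E z"
  have eq: "card (?N - {v}) = card (?N - (if adj E y z then {y} else {}))" if "v \<in> {y, z}" for v
  proof (cases "adj E y z")
    case True
    then have "v \<in> ?N" "y \<in> ?N" using that yzn by auto
    then show ?thesis using True by (simp add: card_Diff_singleton)
  next
    case False
    then have "v \<notin> ?N" using that yzn irr by auto
    then show ?thesis using False by simp
  qed
  show ?thesis
  proof (cases "x z \<le> x y")
    case True
    then show ?thesis using main[OF yz(1-4) True priv] eq[OF insertI1] by linarith
  next
    case False
    have "n - 3 < card (nbrs n E z \<union> nbrs n E y - {z})"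
      by (rule main) (use yz priv False in \<open>auto simp: adj_commute[of E z y]\<close>)
    then have "n - 3 < card (?N - {z})" by (simp add: Un_commute)
    then show ?thesis using eq[of z] by auto
  qed
qed

text \<open>A maximiser has one of two shapes. A star with a triangle at a leaf has smaller radius
  than \<open>U4\<close>, and \<open>tri n b\<close> with \<open>b \<ge> 3\<close> has smaller
  radius than \<open>tri n (b - 1)\<close>; both competitors lie in the class.\<close>

lemma maximal_is_U4:
  assumes p: "p \<ge> 2" and n: "n \<ge> 7" and E: "E \<in> low_graphs n"
    and mx: "\<And>E'. E' \<in> low_graphs n \<Longrightarrow> sombor_rho p n E' \<le> sombor_rho p n E"
  shows "graph_iso n E (U4 n)"
proof -
  have G: "simple_graph n E" and conn: "connected_graph n E" and cE: "card E = n"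
    and dle: "\<And>i. i < n \<Longrightarrow> deg n E i \<le> n - 3" using E by (auto simp: low_graphs_def)
  have p1: "p \<ge> 1" using p by simp
  note stuck = maximal_stuck[OF p1 E mx]
  note irr = adj_irrefl[OF G]
  have stuck_adj: "n - 1 \<le> card (nbrs n E y \<union> nbrs n E z)"
    if "adj E y z" "adj E y v" "\<not> adj E z v" "v \<noteq> z" "adj E z w" "\<not> adj E y w" "w \<noteq> y" for y z v w
  proof -
    have "n - 2 \<le> card (nbrs n E y \<union> nbrs n E z - (if adj E y z then {y} else {}))"
      by (rule stuck) (use that simple_graphD[OF G that(1)] in \<open>auto simp: mem_nbrs[OF G]\<close>)
    moreover have "y \<in> nbrs n E y \<union> nbrs n E z" using that(1) by (simp add: mem_nbrs[OF G] adj_commute)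
    ultimately show ?thesis using that(1) n by (simp add: card_Diff_singleton)
  qed
  have dom: "dominating_pair n E y z c"
    if yz: "y \<noteq> z" "\<not> adj E y z" "adj E y c" "adj E z c" "adj E y v" "\<not> adj E z v" "adj E z w" "\<not> adj E y w" for y z c v w
  proof -
    have lt: "y < n" "z < n" using simple_graphD[OF G] yz by blast+
    have "v \<noteq> z" "w \<noteq> y" using yz(2,5,7) adj_commute[of E z y] by auto
    then have "v \<in> nbrs n E y - nbrs n E z - {z}" "w \<in> nbrs n E z - nbrs n E y - {y}"
      using yz by (simp_all add: mem_nbrs[OF G])
    \<comment> \<open>Turns the two memberships into nonemptiness of the private
      neighbourhoods.\<close>
    note priv = this[THEN ex_in_conv[THEN iffD1, OF exI]]
    have "n - 2 \<le> card (nbrs n E y \<union> nbrs n E z - (if adj E y z then {y} else {}))"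
      by (rule stuck) (use yz(1,3,4) lt priv in auto)
    then have "n - 2 \<le> card (nbrs n E y \<union> nbrs n E z)" using yz by simp
    moreover have "nbrs n E y \<union> nbrs n E z \<subseteq> {0..<n} - {y, z}"
      using yz irr by (auto simp: nbrs_def adj_commute[of E z y])
    moreover have "card ({0..<n} - {y, z}) = n - 2" using lt yz by (simp add: card_Diff_subset)
    ultimately have eqN: "nbrs n E y \<union> nbrs n E z = {0..<n} - {y, z}" by (intro card_seteq) auto
    then have "adj E y i \<or> adj E z i" if "i < n" "i \<noteq> y" "i \<noteq> z" for i
    proof -
      have "i \<in> {0..<n} - {y, z}" using that by simp
      then have "i \<in> nbrs n E y \<union> nbrs n E z" using eqN by simp
      then show ?thesis by (simp add: mem_nbrs[OF G])
    qed
    then show ?thesis using yz by (auto simp: dominating_pair_def)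
  qed
  show ?thesis
  proof (cases "\<exists>y z c. dominating_pair n E y z c")
    case True
    then obtain y z c where d: "dominating_pair n E y z c" by blast
    have "\<exists>y c z q. star_tri_shape n E y c z q"
    proof (rule dominating_pair_star_tri[OF G conn cE n])
      show "n - 1 \<le> card (nbrs n E y \<union> nbrs n E z)"
        if "adj E y z" "adj E y v" "\<not> adj E z v" "v \<noteq> z" "adj E z w" "\<not> adj E y w" "w \<noteq> y" for y z v w
        by (rule stuck_adj[OF that])
    qed (fact dle, fact d)
    then obtain y c z q where "star_tri_shape n E y c z q" by blast
    then have "graph_iso n E (star_tri n)" by (rule star_tri_shape_iso)
    then have "sombor_rho p n E < sombor_rho p n (U4 n)"
      using graph_iso_rho[of n E "star_tri n" p] sombor_rho_star_tri_less[OF n p] n by simp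
    moreover have "U4 n \<in> low_graphs n" using low_graphs_tri[of 2 n] n by (simp add: tri_eqs)
    ultimately show ?thesis using mx by fastforce
  next
    case False
    have "\<exists>x u c. tri_shape n E x u c"
    proof (rule tri_shape_exists[OF G conn cE n])
      show "n - 1 \<le> card (nbrs n E y \<union> nbrs n E z)"
        if "adj E y z" "adj E y v" "\<not> adj E z v" "v \<noteq> z" "adj E z w" "\<not> adj E y w" "w \<noteq> y" for y z v w
        by (rule stuck_adj[OF that])
      show False if "y \<noteq> z" "\<not> adj E y z" "adj E y c" "adj E z c" "adj E y v" "\<not> adj E z v" "adj E z w" "\<not> adj E y w" for y z c v w
        using dom[OF that] False by blast
    qed (fact dle)
    then obtain x u c where T: "tri_shape n E x u c" by blast
    then have "x < n" by (auto simp: tri_shape_def)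
    then obtain b where b: "2 \<le> b" "3 + 2 * b \<le> n" "graph_iso n E (tri n b)"
      using tri_shape_iso[OF G T dle n] by blast
    show ?thesis
    proof (cases "b = 2")
      case True
      then show ?thesis using b by (simp add: tri_eqs)
    next
      case False
      have "sombor_rho p n E < sombor_rho p n (tri n (b - 1))"
        using graph_iso_rho[OF b(3), of p] sombor_rho_tri_less[OF p1 _ b(2)] b n by simp
      moreover have "tri n (b - 1) \<in> low_graphs n" using b False by (intro low_graphs_tri) auto
      ultimately show ?thesis using mx by fastforce
    qed
  qed
qed

text \<open>The class is finite, so a maximum exists, and every graph attaining it is isomorphic to
  \<open>U4\<close>; any other graph lies strictly below.\<close>

lemma low_graphs_less_U4:
  assumes p: "p \<ge> 2" and n: "n \<ge> 7" and E: "E \<in> low_graphs n" and ni: "\<not> graph_iso n E (U4 n)"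
  shows "sombor_rho p n E < sombor_rho p n (U4 n)"
proof -
  have "low_graphs n \<subseteq> Pow (Pow {0..<n})" by (auto simp: low_graphs_def simple_graph_def)
  then have fin: "finite (low_graphs n)" by (rule finite_subset) simp
  define m where "m = Max (sombor_rho p n ` low_graphs n)"
  have le: "sombor_rho p n E' \<le> m" if "E' \<in> low_graphs n" for E'
    unfolding m_def using that fin by simp
  have "m \<in> sombor_rho p n ` low_graphs n" unfolding m_def using fin E by (intro Max_in) auto
  then obtain M where M: "M \<in> low_graphs n" "m = sombor_rho p n M" by blast
  have "graph_iso n M (U4 n)" by (rule maximal_is_U4[OF p n M(1)]) (use le M in simp)
  then have mU: "m = sombor_rho p n (U4 n)" using graph_iso_rho[of n M "U4 n" p] M(2) n by simp
  have "sombor_rho p n E \<noteq> m"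
  proof
    assume "sombor_rho p n E = m"
    then have "graph_iso n E (U4 n)" by (intro maximal_is_U4[OF p n E]) (use le in simp)
    then show False using ni by simp
  qed
  then show ?thesis using le[OF E] mU by simp
qed

lemma unicyclic_U2:
  assumes n: "n \<ge> 7"
  shows "unicyclic n (U2 n)"
proof (rule unicyclicI[OF simple_U2[OF n] connected_U2[OF n]])
  show "is_cycle (U2 n) {{0, 1}, {1, 2}, {0, 2}}"
    by (rule is_cycle_triangle) (auto simp: adj_U2)
  fix C assume C: "is_cycle (U2 n) C"
  have 34: "{3, 4} \<notin> C" by (rule cycle_no_pendant[OF C]) (auto simp: adj_U2)
  moreover have "{0, 3} \<notin> C"
    by (rule cycle_no_pendant[OF C]) (use 34 in \<open>auto simp: adj_U2\<close>)
  moreover have "{0, k} \<notin> C" if "5 \<le> k" "k < n" for k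
    by (rule cycle_no_pendant[OF C]) (use that in \<open>auto simp: adj_U2\<close>)
  ultimately have "C \<subseteq> {{0, 1}, {1, 2}, {0, 2}}"
    using is_cycleD(2)[OF C] unfolding U2_def by blast
  then show "C = {{0, 1}, {1, 2}, {0, 2}}" by (rule cycle_in_triangle[OF C])
qed

text \<open>Around the square each edge forces the next, so a cycle with one of the four edges
  contains all of them.\<close>

lemma unicyclic_U3:
  assumes n: "n \<ge> 7"
  shows "unicyclic n (U3 n)"
proof (rule unicyclicI[OF simple_U3[OF n] connected_U3[OF n]])
  show "is_cycle (U3 n) {{0, 1}, {1, 2}, {2, 3}, {0, 3}}"
    by (rule is_cycle_square) (auto simp: adj_U3)
  fix C assume C: "is_cycle (U3 n) C"
  have pend: "{0, k} \<notin> C" if "4 \<le> k" "k < n" for k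
    by (rule cycle_no_pendant[OF C]) (use that in \<open>auto simp: adj_U3\<close>)
  then have sub: "C \<subseteq> {{0, 1}, {1, 2}, {2, 3}, {0, 3}}"
    using is_cycleD(2)[OF C] unfolding U3_def by (auto simp: insert_commute)
  have sw: "{u, w} \<in> C \<Longrightarrow> {w, u} \<in> C" for u w by (simp add: insert_commute)
  have a: "{1, 2} \<in> C" if "{0, 1} \<in> C" by (rule cycle_step[OF C sw[OF that]]) (auto simp: adj_U3)
  have b: "{2, 3} \<in> C" if "{1, 2} \<in> C" by (rule cycle_step[OF C sw[OF that]]) (auto simp: adj_U3)
  have c: "{0, 3} \<in> C" if "{2, 3} \<in> C" by (rule sw, rule cycle_step[OF C sw[OF that]]) (auto simp: adj_U3)
  have d: "{0, 1} \<in> C" if "{0, 3} \<in> C"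
    by (rule cycle_step[OF C that]) (use pend in \<open>auto simp: adj_U3\<close>)
  obtain e where "e \<in> C" using is_cycleD(1)[OF C] by blast
  then have "{0, 1} \<in> C" using sub b c d by blast
  then show "C = {{0, 1}, {1, 2}, {2, 3}, {0, 3}}" using sub a b c by blast
qed

theorem theorem4p2:
  fixes n :: nat and p :: real
  assumes "n \<ge> 7" and "p \<ge> 2"
  shows "unicyclic n (Sn_e n) \<and> unicyclic n (U1 n) \<and> unicyclic n (U2 n) \<and>
         unicyclic n (U3 n) \<and> unicyclic n (U4 n) \<and>
         (\<forall>G. unicyclic n G \<and> \<not> graph_iso n G (Sn_e n) \<and> \<not> graph_iso n G (U1 n) \<and>
              \<not> graph_iso n G (U2 n) \<and> \<not> graph_iso n G (U3 n) \<and> \<not> graph_iso n G (U4 n)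
              \<longrightarrow> sombor_rho p n G < sombor_rho p n (U4 n)) \<and>
         sombor_rho p n (U4 n) < sombor_rho p n (U3 n) \<and>
         sombor_rho p n (U3 n) < sombor_rho p n (U2 n) \<and>
         sombor_rho p n (U2 n) < sombor_rho p n (U1 n) \<and>
         sombor_rho p n (U1 n) < sombor_rho p n (Sn_e n)"
proof (intro conjI allI impI)
  show "unicyclic n (Sn_e n)" using unicyclic_tri[of 0 n] assms by (simp add: tri_eqs)
  show "unicyclic n (U1 n)" using unicyclic_tri[of 1 n] assms by (simp add: tri_eqs(2)[simplified])
  show "unicyclic n (U4 n)" using unicyclic_tri[of 2 n] assms by (simp add: tri_eqs)
  show "unicyclic n (U2 n)" by (rule unicyclic_U2[OF assms(1)])
  show "unicyclic n (U3 n)" by (rule unicyclic_U3[OF assms(1)])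
  show "sombor_rho p n (U4 n) < sombor_rho p n (U3 n)" by (rule sombor_rho_U4_less[OF assms(2,1)])
  show "sombor_rho p n (U3 n) < sombor_rho p n (U2 n)" by (rule sombor_rho_U3_less[OF assms])
  show "sombor_rho p n (U2 n) < sombor_rho p n (U1 n)" by (rule sombor_rho_U2_less[OF assms])
  have "sombor_rho p n (tri n 1) < sombor_rho p n (tri n (1 - 1))" by (rule sombor_rho_tri_less) (use assms in auto)
  then show "sombor_rho p n (U1 n) < sombor_rho p n (Sn_e n)" unfolding tri_eqs diff_self_eq_0 .
  fix G
  assume *: "unicyclic n G \<and> \<not> graph_iso n G (Sn_e n) \<and> \<not> graph_iso n G (U1 n) \<and>
    \<not> graph_iso n G (U2 n) \<and> \<not> graph_iso n G (U3 n) \<and> \<not> graph_iso n G (U4 n)"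
  then have G: "simple_graph n G" "connected_graph n G" "card G = n"
    using unicyclic_card_edges by (auto simp: unicyclic_def)
  have "deg n G i \<le> n - 3" if i: "i < n" for i
  proof -
    have "nbrs n G i \<subseteq> {0..<n} - {i}" using adj_irrefl[OF G(1)] by (auto simp: nbrs_def)
    then have "deg n G i \<le> card ({0..<n} - {i})" unfolding deg_eq_card_nbrs by (intro card_mono) auto
    then have "deg n G i \<le> n - 1" using i by simp
    moreover have "deg n G i \<noteq> n - 1" using hub_spanning[OF G(1,3) i] * by blast
    moreover have "deg n G i \<noteq> n - 2" using hub_missing_one[OF G assms(1) i] * by blast
    ultimately show ?thesis by linarith
  qed
  then have "G \<in> low_graphs n" using G by (simp add: low_graphs_def)
  then show "sombor_rho p n G < sombor_rho p n (U4 n)" using low_graphs_less_U4 assms * by blast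
qed

end
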